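(* Let $c$ be a real number with $1<c<2$. Then the sequence $n\mapsto \mathbf t(\lfloor n^c\rfloor)$ is simply normal (each of $0$ and $1$ appears with asymptotic frequency $1/2$). More precisely, there exist an exponent $\eta>0$ and a constant $C$ such that for all integers $N\ge 1$ \[ \left\lvert\frac 1N\bigl\lvert\bigl\{0\leq n<N:\mathbf t(\lfloor n^c\rfloor)=0\bigr\}\bigr\rvert-\frac 12\right\rvert \leq CN^{-\eta}. \]
   Context: For a nonnegative integer $n$, $s(n)$ denotes the number of $1$s in the binary expansion of $n$. The Thue--Morse sequence $\mathbf t=(\mathbf t(n))_{n\ge 0}$ takes values in $\{0,1\}$, with $\mathbf t(n)=0$ if and only if $s(n)\equiv 0\bmod 2$. *)

theory Defs
  imports Complex_Main
begin

definition binary_ones :: "nat \<Rightarrow> nat" where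
  "binary_ones n = card {i. bit n i}"

definition thue_morse :: "nat \<Rightarrow> nat" where
  "thue_morse n = (if binary_ones n mod 2 = 0 then 0 else 1)"

definition simply_normal :: "(nat \<Rightarrow> nat) \<Rightarrow> bool" where
  "simply_normal a \<longleftrightarrow>
     (\<forall>d\<in>{0, 1}. (\<lambda>N. real (card {n. n < N \<and> a n = d}) / real N) \<longlonglongrightarrow> 1 / 2)"

text \<open>The set in \<^const>\<open>binary_ones\<close> is finite, so its cardinality is not the junk value 0 of \<^const>\<open>card\<close>.\<close>

lemma finite_bits: "finite {i. bit (n :: nat) i}"
proof (rule finite_subset)
  show "{i. bit n i} \<subseteq> {..<n}"
  proof (rule subsetI, rule ccontr)
    fix i assume "i \<in> {i. bit n i}" "i \<notin> {..<n}"
    then have "n \<le> i" "odd (n div 2 ^ i)" by (auto simp: bit_iff_odd)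
    moreover have "i < 2 ^ i" by simp
    ultimately show False by simp
  qed
qed simp

end

theory Submission
  imports Defs "HOL-Analysis.Analysis"
begin

text \<open>
  Write \<open>tm n = (-1) ^ s n\<close> for the sign of the Thue--Morse sequence. Both claims follow from a
  bound \<open>O(N powr (1 - \<eta>))\<close> for the sum of \<open>tm \<lfloor>n powr c\<rfloor>\<close> over \<open>n < N\<close>, and it suffices to consider
  the dyadic blocks \<open>[N, 2 * N)\<close>.

  Near a point \<open>n\<close> of such a block, \<open>(n + i) powr c\<close> is almost the linear function \<open>\<beta> + i * \<alpha>\<close>, where
  \<open>\<alpha> = c * n powr (c - 1)\<close>. The error stays small on a window of length \<open>K\<close> if \<open>K\<^sup>2 * N powr (c - 2)\<close> is
  small. As \<open>c\<close> approaches \<open>2\<close>, \<open>K\<close> is only a small power of \<open>\<alpha>\<close>, hence the values of the sequence have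
  far more binary digits than a window could control by equidistribution. Nearly all of these digits
  are removed by differencing.

  The digits are cut into a short window of lowest digits, \<open>k\<close> blocks, and the top digits. Van der
  Corput's inequality is applied once for each block (\<open>vdc_box\<close>), with a family of shifts chosen for
  that block. The multipliers of Dirichlet's theorem provide shifts \<open>g\<close> for which \<open>g * \<alpha>\<close> is nearly a
  multiple of a power of two; such shifts do not change the digits of the block (\<open>shift_family\<close>). In
  the resulting product over the vertices of a \<open>k\<close>-dimensional cube, the block belonging to any one of
  the directions cancels in pairs, and this removes all blocks at the same time
  (\<open>cube_product_eq\<close>). The shifts for the first block are so short that they do not reach the top
  digits either. On the window of lowest digits the shifts act as \<open>0, 1, 2, ...\<close> up to small errors.
  There remains an average of \<open>tm\<close> over the vertices of cubes, in which the shifts are independent and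
  uniformly distributed modulo a power of two.

  This average is a Gowers norm of the Thue--Morse sequence in disguise. It is small because reading
  the digits from the bottom is a finite process, whose states are the carries: for suitable digits
  there are two transitions between the same states with opposite signs, so each group of digits
  gains a constant factor (\<open>cube_cancel\<close>). The opposite sign comes from the fact that \<open>(1 + x) ^ (2 ^ m)\<close>
  equals \<open>1 + x ^ (2 ^ m)\<close> modulo two and that \<open>tm 0 * tm (2 ^ m) = -1\<close>.

  Two exceptional sets have to be small. Rounding errors cause carries only at values close to
  a multiple of a power of two (\<open>near_count\<close>), and the construction of the shifts fails only if \<open>\<alpha>\<close>
  is exceptionally well approximable. Since \<open>\<alpha>\<close> runs through the values of an increasing function whose
  gaps are bounded from below, the points with such a slope can be counted (\<open>card_multiples_near\<close>).

  All parameters are powers of a single scale \<open>S\<close>. The blocks cover the digits of the slope if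
  \<open>S ^ (20 * k - 26)\<close> is about \<open>N powr (c - 1)\<close>. If \<open>k\<close> is large in terms of \<open>2 - c\<close>, then \<open>S\<close> is so small
  a power of \<open>N\<close> that the linear approximation holds on windows of length \<open>S ^ 36\<close>.
\<close>

section \<open>The sign of the Thue--Morse sequence\<close>

text \<open>
  Signs are multiplicative over disjoint groups of digits, which makes them easier to handle
  than the \<open>0\<close>-\<open>1\<close> sequence; a frequency of \<open>1/2\<close> means cancellation in its sums.
\<close>

definition tm :: "nat \<Rightarrow> real" where
  "tm n = (-1) ^ binary_ones n"

lemma binary_ones_rec: "binary_ones n = (if odd n then 1 else 0) + binary_ones (n div 2)"
proof -
  have eq: "{i. bit n i} = (if odd n then {0} else {}) \<union> Suc ` {i. bit (n div 2) i}" (is "?A = ?B")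
  proof (rule set_eqI)
    fix i show "i \<in> ?A \<longleftrightarrow> i \<in> ?B"
      by (cases i) (auto simp: bit_0 bit_Suc)
  qed
  have "card ?B = card (if odd n then {0::nat} else {}) + card (Suc ` {i. bit (n div 2) i})"
    by (rule card_Un_disjoint) (auto intro: finite_imageI finite_bits)
  also have "card (Suc ` {i. bit (n div 2) i}) = card {i. bit (n div 2) i}"
    by (rule card_image) simp
  finally show ?thesis unfolding binary_ones_def eq by auto
qed

lemma tm_rec: "tm n = (if odd n then -1 else 1) * tm (n div 2)"
  unfolding tm_def by (subst binary_ones_rec) (auto simp: power_add)

lemma tm_0 [simp]: "tm 0 = 1"
  by (simp add: tm_def binary_ones_def)

lemma tm_square [simp]: "tm n * tm n = 1"
  by (simp add: tm_def flip: power_add)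

lemma abs_tm [simp]: "\<bar>tm n\<bar> = 1"
  by (simp add: tm_def power_abs)

lemma tm_mod_div: "tm n = tm (n mod 2 ^ l) * tm (n div 2 ^ l)"
proof (induction l arbitrary: n)
  case (Suc l)
  have m: "n mod 2 ^ Suc l = 2 * ((n div 2) mod 2 ^ l) + n mod 2"
    by (simp add: mod_mult2_eq)
  have "tm (n mod 2 ^ Suc l) = (if odd n then -1 else 1) * tm ((n div 2) mod 2 ^ l)"
    unfolding m by (subst tm_rec) (auto simp: mod_2_eq_odd)
  moreover have "n div 2 ^ Suc l = (n div 2) div 2 ^ l"
    by (simp add: div_mult2_eq)
  ultimately show ?case
    using Suc[of "n div 2"] tm_rec[of n] by auto
qed (auto simp: tm_def binary_ones_def)

lemma tm_power2: "tm (2 ^ m) = -1"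
proof (induction m)
  case 0 show ?case by (subst tm_rec) simp
next
  case (Suc m) then show ?case by (subst tm_rec) simp
qed

lemma tm_concat: "b < 2 ^ l \<Longrightarrow> tm (2 ^ l * a + b) = tm a * tm b"
  by (subst tm_mod_div[of _ l]) simp

text \<open>
  Cutting the binary expansion at the positions \<open>b 0 \<le> b 1 \<le> ...\<close> factors the sign into
  independent pieces. Each piece is eliminated later by a shift of its own.
\<close>

lemma tm_blocks:
  assumes "\<And>i. i < k \<Longrightarrow> b i \<le> b (Suc i)"
  shows "tm n = tm (n mod 2 ^ b 0) *
    (\<Prod>i<k. tm (n div 2 ^ b i mod 2 ^ (b (Suc i) - b i))) * tm (n div 2 ^ b k)"
  using assms
proof (induction k)
  case 0
  show ?case using tm_mod_div[of n "b 0"] by simp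
next
  case (Suc k)
  have *: "n div 2 ^ b k div 2 ^ (b (Suc k) - b k) = n div 2 ^ b (Suc k)"
    using Suc.prems[of k] by (simp flip: div_mult2_eq power_add)
  have "tm (n div 2 ^ b k) =
     tm (n div 2 ^ b k mod 2 ^ (b (Suc k) - b k)) * tm (n div 2 ^ b (Suc k))"
    using tm_mod_div[of "n div 2 ^ b k" "b (Suc k) - b k"] unfolding * .
  then show ?case using Suc by simp
qed

section \<open>Cubes with two candidates in each direction\<close>

text \<open>
  A point of a box holds two candidate values for each of the \<open>k\<close> directions. A vertex, given
  by a set \<open>\<omega>\<close> of directions, takes the first candidate in the directions of \<open>\<omega>\<close> and the
  second one elsewhere; \<open>g\<close> translates candidates into shifts. Using two independent
  candidates per direction, instead of a base point and a difference, keeps the averages below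
  free of weights.
\<close>

definition boxes :: "nat \<Rightarrow> nat \<Rightarrow> (nat \<Rightarrow> nat \<times> nat) set" where
  "boxes U k = PiE {..<k} (\<lambda>_. {..<U} \<times> {..<U})"

definition vertex :: "nat \<Rightarrow> (nat \<Rightarrow> nat \<Rightarrow> nat) \<Rightarrow> (nat \<Rightarrow> nat \<times> nat) \<Rightarrow> nat set \<Rightarrow> nat" where
  "vertex k g u \<omega> = (\<Sum>i<k. g i ((if i \<in> \<omega> then fst else snd) (u i)))"

lemma finite_boxes [simp]: "finite (boxes U k)"
  unfolding boxes_def by (intro finite_PiE) auto

lemma card_boxes: "card (boxes U k) = U ^ (2 * k)"
  unfolding boxes_def by (subst card_PiE) (auto simp: power_mult power2_eq_square)

lemma boxesD: "u \<in> boxes U k \<Longrightarrow> i < k \<Longrightarrow> (if i \<in> \<omega> then fst else snd) (u i) < U"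
  unfolding boxes_def by (auto simp: PiE_def Pi_def mem_Times_iff)

lemma sum_boxes_Suc:
  "(\<Sum>u\<in>boxes U (Suc k). F u) = (\<Sum>a<U. \<Sum>b<U. \<Sum>u\<in>boxes U k. F (u(k := (a, b))))"
proof -
  let ?S = "{..<U} \<times> {..<U}"
  have "boxes U (Suc k) = (\<lambda>(y, u). u(k := y)) ` (?S \<times> boxes U k)"
    unfolding boxes_def lessThan_Suc PiE_insert_eq by auto
  moreover have "inj_on (\<lambda>(y, u). u(k := y)) (?S \<times> boxes U k)"
  proof (rule inj_onI, clarify, goal_cases)
    case (1 a b u a' b' u')
    then have "u i = u' i" for i
      by (cases "i = k") (auto simp: boxes_def PiE_def extensional_def fun_upd_def fun_eq_iff split: if_splits)
    moreover have "(a, b) = (a', b')" using 1 by (metis fun_upd_same)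
    ultimately show ?case by auto
  qed
  ultimately have "(\<Sum>u\<in>boxes U (Suc k). F u) = (\<Sum>(y, u)\<in>?S \<times> boxes U k. F (u(k := y)))"
    by (simp add: sum.reindex case_prod_unfold)
  then show ?thesis by (simp add: sum.cartesian_product')
qed

lemma prod_Pow_Suc:
  "(\<Prod>\<omega>\<in>Pow {..<Suc k}. F \<omega>) = (\<Prod>\<omega>\<in>Pow {..<k}. F (insert k \<omega>) * F \<omega>)"
proof -
  have "(\<Prod>\<omega>\<in>Pow {..<Suc k}. F \<omega>) = (\<Prod>\<omega>\<in>Pow {..<k} \<union> insert k ` Pow {..<k}. F \<omega>)"
    by (simp add: lessThan_Suc Pow_insert)
  also have "\<dots> = (\<Prod>\<omega>\<in>Pow {..<k}. F \<omega>) * (\<Prod>\<omega>\<in>insert k ` Pow {..<k}. F \<omega>)"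
    by (rule prod.union_disjoint) auto
  also have "(\<Prod>\<omega>\<in>insert k ` Pow {..<k}. F \<omega>) = (\<Prod>\<omega>\<in>Pow {..<k}. F (insert k \<omega>))"
    by (subst prod.reindex) (auto simp: inj_on_def)
  finally show ?thesis by (simp add: prod.distrib mult.commute)
qed

lemma vertex_Suc:
  assumes "\<omega> \<subseteq> {..<k}"
  shows "vertex (Suc k) g (u(k := (a, b))) \<omega> = vertex k g u \<omega> + g k b"
    and "vertex (Suc k) g (u(k := (a, b))) (insert k \<omega>) = vertex k g u \<omega> + g k a"
  using assms unfolding vertex_def by (auto intro!: sum.cong)

section \<open>Cancellation over cubes\<close>

text \<open>
  Only the size of a vertex matters here, so each direction acts as the multiplicative
  difference operator \<open>h y \<mapsto> h y * h (y + 1)\<close>.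
\<close>

lemma prod_card_Pow:
  "(\<Prod>\<omega>\<in>Pow {..<k}. h (y + card \<omega>)) = (((\<lambda>h y. h y * h (Suc y)) ^^ k) h y :: real)"
proof (induction k arbitrary: h y)
  case (Suc k)
  have "(\<Prod>\<omega>\<in>Pow {..<Suc k}. h (y + card \<omega>)) =
        (\<Prod>\<omega>\<in>Pow {..<k}. h (y + card \<omega>) * h (Suc (y + card \<omega>)))"
    unfolding prod_Pow_Suc
  proof (rule prod.cong)
    fix \<omega> assume "\<omega> \<in> Pow {..<k}"
    then have "k \<notin> \<omega>" "finite \<omega>" by (auto intro: finite_subset)
    then show "h (y + card (insert k \<omega>)) * h (y + card \<omega>) = h (y + card \<omega>) * h (Suc (y + card \<omega>))"
      by simp
  qed simp
  also have "\<dots> = ((\<lambda>h y. h y * h (Suc y)) ^^ k) (\<lambda>y. h y * h (Suc y)) y"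
    by (rule Suc.IH)
  finally show ?case by (simp add: funpow_Suc_right del: funpow.simps)
qed simp

text \<open>
  Signs square to one, so all intermediate factors cancel each time the number of differences
  doubles: this is \<open>(1 + x) ^ (2 ^ m) = 1 + x ^ (2 ^ m)\<close> in characteristic two.
\<close>

lemma difference_power2:
  assumes "\<And>y. h y * h y = (1::real)"
  shows "((\<lambda>h y. h y * h (Suc y)) ^^ (2 ^ m)) h y = h y * h (y + 2 ^ m)"
  using assms
proof (induction m arbitrary: h y)
  case (Suc m)
  let ?D = "\<lambda>(h :: nat \<Rightarrow> real) y. h y * h (Suc y)"
  have 1: "(?D ^^ (2 ^ m)) h = (\<lambda>y. h y * h (y + 2 ^ m))"
    using Suc by blast
  have "(?D ^^ (2 ^ Suc m)) h y = (?D ^^ (2 ^ m)) ((?D ^^ (2 ^ m)) h) y"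
    by (simp add: mult_2 funpow_add)
  also have "\<dots> = (h y * h (y + 2 ^ m)) * (h (y + 2 ^ m) * h (y + 2 ^ m + 2 ^ m))"
    unfolding 1
    by (subst Suc.IH) (use Suc.prems in \<open>auto simp: algebra_simps\<close>)
  also have "\<dots> = h y * (h (y + 2 ^ m) * h (y + 2 ^ m)) * h (y + 2 ^ Suc m)"
    by (simp add: mult_2 algebra_simps)
  also have "\<dots> = h y * h (y + 2 ^ Suc m)" by (simp only: Suc.prems mult_1_right)
  finally show ?case .
qed simp

text \<open>
  The value \<open>-1\<close> is what makes the box averages of the sign small. It is a cube, of any
  prescribed dimension \<open>2 ^ m\<close>, on which the sign does not behave like a polynomial phase of
  degree less than the dimension.
\<close>

lemma prod_tm_card_Pow: "(\<Prod>\<omega>\<in>Pow {..<(2::nat) ^ m}. tm (card \<omega>)) = -1"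
  using prod_card_Pow[of "\<lambda>n. tm n" 0 "2 ^ m"] difference_power2[of tm m 0]
  by (simp add: tm_power2)

lemma sum_boxes_digits:
  assumes "A > 0"
  shows "(\<Sum>u\<in>boxes (A * B) k. F u) =
    (\<Sum>v\<in>boxes A k. \<Sum>w\<in>boxes B k. F (\<lambda>i\<in>{..<k}. (fst (v i) + A * fst (w i), snd (v i) + A * snd (w i))))"
proof -
  let ?f = "\<lambda>(v, w). (\<lambda>i\<in>{..<k}. (fst (v i) + A * fst (w i), snd (v i) + A * snd (w i)))"
  let ?g = "\<lambda>u. ((\<lambda>i\<in>{..<k}. (fst (u i) mod A, snd (u i) mod A)), (\<lambda>i\<in>{..<k}. (fst (u i) div A, snd (u i) div A)))"
  have lt: "a + A * b < A * B" if "a < A" "b < B" for a b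
  proof -
    have "a + A * b < A * Suc b" using that by simp
    also have "\<dots> \<le> A * B" using that by (intro mult_left_mono) auto
    finally show ?thesis .
  qed
  have "(\<Sum>u\<in>boxes (A * B) k. F u) = (\<Sum>p\<in>boxes A k \<times> boxes B k. F (?f p))"
  proof (rule sum.reindex_bij_witness[of _ ?f ?g])
    fix u assume u: "u \<in> boxes (A * B) k"
    show "?f (?g u) = u"
      using u by (auto simp: boxes_def PiE_def extensional_def fun_eq_iff)
    show "?g u \<in> boxes A k \<times> boxes B k"
      using u assms by (auto simp: boxes_def PiE_def Pi_def mem_Times_iff less_mult_imp_div_less mult.commute)
    show "F (?f (?g u)) = F u" using \<open>?f (?g u) = u\<close> by simp
  next
    fix p assume p: "p \<in> boxes A k \<times> boxes B k"
    then obtain v w where p_eq: "p = (v, w)" and v: "v \<in> boxes A k" and w: "w \<in> boxes B k" by auto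
    have vA: "fst (v i) < A" "snd (v i) < A" if "i < k" for i
      using v that by (auto simp: boxes_def PiE_def Pi_def mem_Times_iff)
    have wB: "fst (w i) < B" "snd (w i) < B" if "i < k" for i
      using w that by (auto simp: boxes_def PiE_def Pi_def mem_Times_iff)
    show "?f p \<in> boxes (A * B) k"
      using vA wB by (auto simp: p_eq boxes_def PiE_def Pi_def intro!: lt)
    have "(\<lambda>i\<in>{..<k}. (fst (?f p i) mod A, snd (?f p i) mod A)) = v"
      using v vA by (auto simp: p_eq boxes_def PiE_def extensional_def fun_eq_iff)
    moreover have "(\<lambda>i\<in>{..<k}. (fst (?f p i) div A, snd (?f p i) div A)) = w"
      using w vA assms by (auto simp: p_eq boxes_def PiE_def extensional_def fun_eq_iff)
    ultimately show "?g (?f p) = p" by (simp add: p_eq)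
  qed
  then show ?thesis by (simp add: sum.cartesian_product case_prod_unfold)
qed

lemma vertex_id_digits:
  "vertex k (\<lambda>i a. a) (\<lambda>i\<in>{..<k}. (fst (v i) + A * fst (w i), snd (v i) + A * snd (w i))) \<omega> =
   vertex k (\<lambda>i a. a) v \<omega> + A * vertex k (\<lambda>i a. a) w \<omega>"
  unfolding vertex_def by (auto simp: sum.distrib[symmetric] sum_distrib_left intro!: sum.cong)

text \<open>
  Two choices of the lowest \<open>2 * m + 3\<close> digits that send the same carries into the higher
  digits, but contribute opposite signs. The first one only rounds the base point \<open>x\<close> up to a
  multiple of \<open>2 ^ (2 * m + 2)\<close>; the second one adds \<open>2 ^ Suc m\<close> in every direction of the
  vertex, so that \<open>card \<omega>\<close> shows up in a digit range of its own, above the small offsets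
  \<open>r \<omega> - x \<le> 2 ^ m\<close>. One spare digit on top makes room for the rounding.
\<close>

lemma opposite_boxes:
  assumes k: "k = 2 ^ m" and r: "\<And>\<omega>. x \<le> r \<omega> \<and> r \<omega> \<le> x + k"
  obtains v1 v2 where
    "v1 \<in> boxes (2 ^ (2 * m + 3)) k" "v2 \<in> boxes (2 ^ (2 * m + 3)) k" "v1 \<noteq> v2"
    "\<And>\<omega>. \<omega> \<subseteq> {..<k} \<Longrightarrow> (r \<omega> + vertex k (\<lambda>i a. a) v1 \<omega>) div 2 ^ (2 * m + 3) =
       (r \<omega> + vertex k (\<lambda>i a. a) v2 \<omega>) div 2 ^ (2 * m + 3)"
    "(\<Prod>\<omega>\<in>Pow {..<k}. tm ((r \<omega> + vertex k (\<lambda>i a. a) v2 \<omega>) mod 2 ^ (2 * m + 3))) =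
     - (\<Prod>\<omega>\<in>Pow {..<k}. tm ((r \<omega> + vertex k (\<lambda>i a. a) v1 \<omega>) mod 2 ^ (2 * m + 3)))"
proof -
  let ?V = "vertex k (\<lambda>i a. a)"
  define p :: nat where "p = 2 * m + 2"
  have p3: "2 * m + 3 = Suc p" by (simp add: p_def)
  define e where "e = (2 ^ p - x mod 2 ^ p) mod 2 ^ p"
  have "(x + e) mod 2 ^ p = (x mod 2 ^ p + (2 ^ p - x mod 2 ^ p)) mod 2 ^ p"
    unfolding e_def by (metis mod_add_eq mod_mod_trivial)
  then have "(x + e) mod 2 ^ p = 0" by simp
  then have "2 ^ p dvd x + e" by (rule mod_0_imp_dvd)
  then obtain y where y: "x + e = 2 ^ p * y" by (rule dvdE)
  have e: "e < 2 ^ p" by (simp add: e_def)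
  \<comment> \<open>Both patterns contain \<open>e\<close> in direction \<open>0\<close>, so that every vertex starts from the rounded
      base point.\<close>
  define v1 where "v1 = (\<lambda>i\<in>{..<k}. if i = 0 then (e, e) else (0, 0 :: nat))"
  define v2 where "v2 = (\<lambda>i\<in>{..<k}. if i = 0 then (e + 2 ^ Suc m, e) else (2 ^ Suc m, 0 :: nat))"
  have k0: "0 < k" by (simp add: k)
  have pm: "(2::nat) ^ Suc m \<le> 2 ^ p" by (intro power_increasing) (auto simp: p_def)
  have 1: "?V v1 \<omega> = e" for \<omega>
  proof -
    have "?V v1 \<omega> = (\<Sum>i<k. if i = 0 then e else 0)"
      unfolding vertex_def v1_def by (intro sum.cong) auto
    then show ?thesis using k0 by simp
  qed
  have 2: "?V v2 \<omega> = e + 2 ^ Suc m * card \<omega>" if "\<omega> \<subseteq> {..<k}" for \<omega>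
  proof -
    have "?V v2 \<omega> = (\<Sum>i<k. (if i = 0 then e else 0) + (if i \<in> \<omega> then 2 ^ Suc m else 0))"
      unfolding vertex_def v2_def by (intro sum.cong) auto
    also have "\<dots> = e + card ({..<k} \<inter> \<omega>) * 2 ^ Suc m"
      using k0 by (simp add: sum.distrib sum.If_cases)
    also have "{..<k} \<inter> \<omega> = \<omega>" using that by auto
    finally show ?thesis by simp
  qed
  have split: "(2 ^ p * y + c) mod 2 ^ Suc p = 2 ^ p * (y mod 2) + c"
              "(2 ^ p * y + c) div 2 ^ Suc p = y div 2" if "c < 2 ^ p" for c
  proof -
    have "2 ^ p * y = 2 ^ p * (2 * (y div 2) + y mod 2)" by simp
    also have "\<dots> = 2 ^ Suc p * (y div 2) + 2 ^ p * (y mod 2)" by (simp only: power_Suc algebra_simps)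
    finally have eq: "2 ^ p * y + c = 2 ^ Suc p * (y div 2) + (2 ^ p * (y mod 2) + c)" by simp
    have "y mod 2 \<le> 1" by simp
    then have "2 ^ p * (y mod 2) + c < 2 ^ Suc p" using that
      by (cases "y mod 2 = 0") auto
    then show "(2 ^ p * y + c) mod 2 ^ Suc p = 2 ^ p * (y mod 2) + c"
              "(2 ^ p * y + c) div 2 ^ Suc p = y div 2"
      unfolding eq by simp_all
  qed
  define q where "q \<omega> = r \<omega> - x" for \<omega>
  have q: "r \<omega> = x + q \<omega>" "q \<omega> < 2 ^ Suc m" for \<omega>
  proof -
    show "r \<omega> = x + q \<omega>" using r[of \<omega>] by (simp add: q_def)
    have "q \<omega> \<le> 2 ^ m" using r[of \<omega>] k unfolding q_def by linarith
    also have "(2::nat) ^ m < 2 ^ Suc m" by simp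
    finally show "q \<omega> < 2 ^ Suc m" .
  qed
  have low1: "q \<omega> < 2 ^ p" for \<omega> using q(2)[of \<omega>] pm by linarith
  have low2: "2 ^ Suc m * card \<omega> + q \<omega> < 2 ^ p" if "\<omega> \<subseteq> {..<k}" for \<omega>
  proof -
    have "card \<omega> \<le> card {..<k}" using that by (intro card_mono) auto
    then have "2 ^ Suc m * card \<omega> \<le> 2 ^ Suc m * 2 ^ m" by (simp add: k)
    moreover have "(2::nat) ^ p = 2 ^ Suc m * 2 ^ m + 2 ^ Suc m * 2 ^ m"
    proof -
      have "p = Suc m + m + 1" by (simp add: p_def)
      then show ?thesis by (simp only: power_add power_one_right)
    qed
    moreover have "q \<omega> < 2 ^ Suc m * 2 ^ m"
      using less_le_trans[OF q(2)[of \<omega>], of "2 ^ Suc m * 2 ^ m"] by simp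
    ultimately show ?thesis by linarith
  qed
  have n1: "r \<omega> + ?V v1 \<omega> = 2 ^ p * y + q \<omega>" for \<omega>
    using y by (simp add: 1 q(1))
  have n2: "r \<omega> + ?V v2 \<omega> = 2 ^ p * y + (2 ^ Suc m * card \<omega> + q \<omega>)"
    if "\<omega> \<subseteq> {..<k}" for \<omega>
    using y by (simp add: 2[OF that] q(1))
  have bnd: "e < 2 ^ Suc p" "e + 2 ^ Suc m < 2 ^ Suc p" "(2::nat) ^ Suc m < 2 ^ Suc p"
    using e pm power_Suc[of "2::nat" p] zero_less_power[of "2::nat" p] by linarith+
  show thesis
  proof (rule that[of v1 v2])
    show "v1 \<in> boxes (2 ^ (2 * m + 3)) k" "v2 \<in> boxes (2 ^ (2 * m + 3)) k"
      using bnd unfolding p3 boxes_def v1_def v2_def by (auto simp del: power_Suc)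
    have "v1 0 \<noteq> v2 0" using k0 by (simp add: v1_def v2_def)
    then show "v1 \<noteq> v2" by auto
    show "(r \<omega> + ?V v1 \<omega>) div 2 ^ (2 * m + 3) =
       (r \<omega> + ?V v2 \<omega>) div 2 ^ (2 * m + 3)" if "\<omega> \<subseteq> {..<k}" for \<omega>
      unfolding n1 n2[OF that] p3 split(2)[OF low1] split(2)[OF low2[OF that]] ..
    have "tm ((r \<omega> + ?V v2 \<omega>) mod 2 ^ Suc p) =
          tm (card \<omega>) * tm ((r \<omega> + ?V v1 \<omega>) mod 2 ^ Suc p)"
      if "\<omega> \<subseteq> {..<k}" for \<omega>
      by (simp only: n1 n2[OF that] split(1)[OF low1] split(1)[OF low2[OF that]]
        tm_concat[OF low1] tm_concat[OF low2[OF that]] tm_concat[OF q(2)] mult.left_commute)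
    then have "(\<Prod>\<omega>\<in>Pow {..<k}. tm ((r \<omega> + ?V v2 \<omega>) mod 2 ^ Suc p)) =
      (\<Prod>\<omega>\<in>Pow {..<k}. tm (card \<omega>)) * (\<Prod>\<omega>\<in>Pow {..<k}. tm ((r \<omega> + ?V v1 \<omega>) mod 2 ^ Suc p))"
      by (simp add: prod.distrib)
    also have "(\<Prod>\<omega>\<in>Pow {..<k}. tm (card \<omega>)) = -1"
      unfolding k by (rule prod_tm_card_Pow)
    finally show "(\<Prod>\<omega>\<in>Pow {..<k}. tm ((r \<omega> + ?V v2 \<omega>) mod 2 ^ (2 * m + 3))) =
     - (\<Prod>\<omega>\<in>Pow {..<k}. tm ((r \<omega> + ?V v1 \<omega>) mod 2 ^ (2 * m + 3)))"
      by (simp add: p3)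
  qed
qed

lemma abs_prod_le_1:
  fixes f :: "'a \<Rightarrow> real"
  assumes "\<And>x. x \<in> A \<Longrightarrow> \<bar>f x\<bar> \<le> 1"
  shows "\<bar>prod f A\<bar> \<le> 1"
proof -
  have "\<bar>prod f A\<bar> = (\<Prod>x\<in>A. \<bar>f x\<bar>)" by (rule abs_prod)
  also have "\<dots> \<le> 1" by (rule prod_le_1) (simp add: assms)
  finally show ?thesis .
qed

text \<open>
  Digits are read from the bottom in groups of \<open>l\<close>. The only information passed upwards is the
  tuple of carries \<open>r \<omega>\<close>, whose spread stays at most \<open>k\<close>; after each group two of the
  \<open>2 ^ (2 * k * l)\<close> digit patterns cancel, so every group gains a fixed factor. The functions
  \<open>G \<omega>\<close> of the higher digits are arbitrary: they never interact with the cancellation.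
\<close>

lemma cube_cancel:
  assumes k: "k = 2 ^ m" and l: "l = 2 * m + 3"
  assumes r: "\<And>\<omega>. x \<le> r \<omega> \<and> r \<omega> \<le> x + k" and G: "\<And>\<omega> n. \<bar>G \<omega> n\<bar> \<le> 1"
  shows "\<bar>\<Sum>u\<in>boxes (2 ^ (l * j)) k. \<Prod>\<omega>\<in>Pow {..<k}.
      tm ((r \<omega> + vertex k (\<lambda>i a. a) u \<omega>) mod 2 ^ (l * j)) *
      G \<omega> ((r \<omega> + vertex k (\<lambda>i a. a) u \<omega>) div 2 ^ (l * j))\<bar> \<le> (2 ^ (2 * k * l) - 2) ^ j"
  using r
proof (induction j arbitrary: r x)
  case 0
  have "\<bar>\<Sum>u\<in>boxes 1 k. \<Prod>\<omega>\<in>Pow {..<k}. G \<omega> (r \<omega> + vertex k (\<lambda>i a. a) u \<omega>)\<bar> \<le>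
        (\<Sum>u\<in>boxes 1 k. 1)"
    by (rule order.trans[OF sum_abs], rule sum_mono, rule abs_prod_le_1, rule G)
  also have "\<dots> = 1" by (simp add: card_boxes)
  finally have "\<bar>\<Sum>u\<in>boxes 1 k. \<Prod>\<omega>\<in>Pow {..<k}. G \<omega> (r \<omega> + vertex k (\<lambda>i a. a) u \<omega>)\<bar> \<le> 1" .
  then show ?case by (simp only: mult_0_right power_0 mod_by_1 tm_0 div_by_1 mult_1_left)
next
  case (Suc j)
  let ?V = "vertex k (\<lambda>i a. a)"
  let ?X = "(2 ^ (2 * k * l) - 2 :: real) ^ j"
  define sgn where "sgn v = (\<Prod>\<omega>\<in>Pow {..<k}. tm ((r \<omega> + ?V v \<omega>) mod 2 ^ l))" for v
  define r' where "r' v \<omega> = (r \<omega> + ?V v \<omega>) div 2 ^ l" for v \<omega>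
  define \<Phi> where "\<Phi> v = (\<Sum>w\<in>boxes (2 ^ (l * j)) k. \<Prod>\<omega>\<in>Pow {..<k}.
      tm ((r' v \<omega> + ?V w \<omega>) mod 2 ^ (l * j)) * G \<omega> ((r' v \<omega> + ?V w \<omega>) div 2 ^ (l * j)))" for v
  have eq: "(\<Sum>u\<in>boxes (2 ^ (l * Suc j)) k. \<Prod>\<omega>\<in>Pow {..<k}.
      tm ((r \<omega> + ?V u \<omega>) mod 2 ^ (l * Suc j)) * G \<omega> ((r \<omega> + ?V u \<omega>) div 2 ^ (l * Suc j)))
      = (\<Sum>v\<in>boxes (2 ^ l) k. sgn v * \<Phi> v)"
  proof -
    have dig: "tm ((n + 2 ^ l * d) mod 2 ^ (l + l * j)) = tm (n mod 2 ^ l) * tm ((n div 2 ^ l + d) mod 2 ^ (l * j))"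
      "(n + 2 ^ l * d) div 2 ^ (l + l * j) = (n div 2 ^ l + d) div 2 ^ (l * j)" for n d
    proof -
      have "tm ((n + 2 ^ l * d) mod 2 ^ (l + l * j)) =
         tm ((n + 2 ^ l * d) mod 2 ^ (l + l * j) mod 2 ^ l) * tm ((n + 2 ^ l * d) mod 2 ^ (l + l * j) div 2 ^ l)"
        by (rule tm_mod_div)
      also have "(n + 2 ^ l * d) mod 2 ^ (l + l * j) mod 2 ^ l = n mod 2 ^ l"
        by (simp add: mod_mult2_eq power_add)
      also have "(n + 2 ^ l * d) mod 2 ^ (l + l * j) div 2 ^ l = (n div 2 ^ l + d) mod 2 ^ (l * j)"
        by (simp add: mod_mult2_eq power_add add.commute)
      finally show "tm ((n + 2 ^ l * d) mod 2 ^ (l + l * j)) = tm (n mod 2 ^ l) * tm ((n div 2 ^ l + d) mod 2 ^ (l * j))" .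
      show "(n + 2 ^ l * d) div 2 ^ (l + l * j) = (n div 2 ^ l + d) div 2 ^ (l * j)"
        by (simp add: power_add div_mult2_eq add.commute)
    qed
    have step: "(\<Prod>\<omega>\<in>Pow {..<k}. tm ((r \<omega> + (?V v \<omega> + 2 ^ l * ?V w \<omega>)) mod 2 ^ (l + l * j)) *
          G \<omega> ((r \<omega> + (?V v \<omega> + 2 ^ l * ?V w \<omega>)) div 2 ^ (l + l * j))) =
        sgn v * (\<Prod>\<omega>\<in>Pow {..<k}. tm ((r' v \<omega> + ?V w \<omega>) mod 2 ^ (l * j)) *
          G \<omega> ((r' v \<omega> + ?V w \<omega>) div 2 ^ (l * j)))" for v w
      by (simp only: add.assoc[symmetric] dig sgn_def r'_def prod.distrib[symmetric] mult.assoc)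
    have "boxes (2 ^ (l * Suc j)) k = boxes (2 ^ l * 2 ^ (l * j)) k"
      by (simp only: mult_Suc_right power_add)
    then show ?thesis
      by (simp only: sum_boxes_digits zero_less_power zero_less_numeral vertex_id_digits
         mult_Suc_right step \<Phi>_def sum_distrib_left)
  qed
  have bound: "\<bar>\<Phi> v\<bar> \<le> ?X" if v: "v \<in> boxes (2 ^ l) k" for v
    unfolding \<Phi>_def
  proof (rule Suc.IH[of "x div 2 ^ l"])
    fix \<omega>
    have "?V v \<omega> \<le> (\<Sum>i<k. 2 ^ l - 1)"
      unfolding vertex_def
    proof (rule sum_mono)
      fix i assume "i \<in> {..<k}"
      then have "(if i \<in> \<omega> then fst else snd) (v i) < 2 ^ l" by (intro boxesD[OF v]) simp
      then show "(if i \<in> \<omega> then fst else snd) (v i) \<le> 2 ^ l - 1" by linarith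
    qed
    then have "?V v \<omega> \<le> k * (2 ^ l - 1)" by simp
    moreover have "k + k * (2 ^ l - 1) = k * 2 ^ l" by (cases "2 ^ l :: nat") auto
    ultimately have "r \<omega> + ?V v \<omega> \<le> x + k * 2 ^ l" using Suc.prems[of \<omega>] by linarith
    then have "r' v \<omega> \<le> (x + k * 2 ^ l) div 2 ^ l" unfolding r'_def by (rule div_le_mono)
    moreover have "x div 2 ^ l \<le> r' v \<omega>" unfolding r'_def
      using Suc.prems[of \<omega>] by (intro div_le_mono) linarith
    ultimately show "x div 2 ^ l \<le> r' v \<omega> \<and> r' v \<omega> \<le> x div 2 ^ l + k" by simp
  qed
  obtain v1 v2 where v: "v1 \<in> boxes (2 ^ l) k" "v2 \<in> boxes (2 ^ l) k" "v1 \<noteq> v2"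
    and same0: "\<And>\<omega>. \<omega> \<subseteq> {..<k} \<Longrightarrow> (r \<omega> + ?V v1 \<omega>) div 2 ^ l = (r \<omega> + ?V v2 \<omega>) div 2 ^ l"
    and opp0: "(\<Prod>\<omega>\<in>Pow {..<k}. tm ((r \<omega> + ?V v2 \<omega>) mod 2 ^ l)) =
      - (\<Prod>\<omega>\<in>Pow {..<k}. tm ((r \<omega> + ?V v1 \<omega>) mod 2 ^ l))"
  proof (rule opposite_boxes[OF k, of x r, folded l, OF Suc.prems], goal_cases)
    case (1 v1 v2)
    show ?case by (rule 1(1)) (fact 1)+
  qed
  have same: "r' v1 \<omega> = r' v2 \<omega>" if "\<omega> \<subseteq> {..<k}" for \<omega>
    unfolding r'_def by (rule same0[OF that])
  have opp: "sgn v2 = - sgn v1" unfolding sgn_def by (rule opp0)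
  \<comment> \<open>Equal carries give equal inner sums, hence the two patterns cancel.\<close>
  have "\<Phi> v1 = \<Phi> v2" unfolding \<Phi>_def by (intro sum.cong prod.cong) (auto simp: same)
  then have zero: "sgn v1 * \<Phi> v1 + sgn v2 * \<Phi> v2 = 0" by (simp add: opp)
  have sgn1: "\<bar>sgn v\<bar> \<le> 1" for v unfolding sgn_def by (rule abs_prod_le_1) simp
  let ?B = "boxes (2 ^ l) k - {v1} - {v2}"
  have "(\<Sum>v\<in>boxes (2 ^ l) k. sgn v * \<Phi> v) =
      sgn v1 * \<Phi> v1 + (\<Sum>v\<in>boxes (2 ^ l) k - {v1}. sgn v * \<Phi> v)"
    using v by (intro sum.remove) auto
  also have "(\<Sum>v\<in>boxes (2 ^ l) k - {v1}. sgn v * \<Phi> v) = sgn v2 * \<Phi> v2 + (\<Sum>v\<in>?B. sgn v * \<Phi> v)"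
    using v by (intro sum.remove) auto
  finally have "\<bar>\<Sum>v\<in>boxes (2 ^ l) k. sgn v * \<Phi> v\<bar> = \<bar>\<Sum>v\<in>?B. sgn v * \<Phi> v\<bar>"
    using zero by linarith
  also have "\<dots> \<le> (\<Sum>v\<in>?B. ?X)"
  proof (rule order.trans[OF sum_abs], rule sum_mono)
    fix v assume "v \<in> ?B"
    then have "\<bar>\<Phi> v\<bar> \<le> ?X" using bound by auto
    then show "\<bar>sgn v * \<Phi> v\<bar> \<le> ?X"
      using mult_mono[OF sgn1[of v], of "\<bar>\<Phi> v\<bar>" ?X] by (simp add: abs_mult)
  qed
  also have "\<dots> = real (card ?B) * ?X" by (rule sum_constant)
  finally have *: "\<bar>\<Sum>v\<in>boxes (2 ^ l) k. sgn v * \<Phi> v\<bar> \<le> real (card ?B) * ?X" .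
  have "card (boxes (2 ^ l) k) = Suc (card (boxes (2 ^ l) k - {v1}))"
    using v by (intro card.remove) auto
  also have "card (boxes (2 ^ l) k - {v1}) = Suc (card ?B)"
    using v by (intro card.remove) auto
  finally have "real (card ?B) = real (card (boxes (2 ^ l) k)) - 2" by linarith
  also have "card (boxes (2 ^ l) k) = 2 ^ (2 * k * l)"
    unfolding card_boxes power_mult[symmetric] by (simp only: mult.commute)
  finally have "real (card ?B) = 2 ^ (2 * k * l) - 2" by simp
  then show ?case using * unfolding eq power_Suc by (simp only:)
qed

section \<open>Van der Corput's inequality in box form\<close>

lemma square_sum_le:
  fixes x :: "'a \<Rightarrow> real"
  shows "(\<Sum>i\<in>A. x i)\<^sup>2 \<le> real (card A) * (\<Sum>i\<in>A. (x i)\<^sup>2)"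
  using Cauchy_Schwarz_ineq_sum[of "\<lambda>_. 1" x A] by simp

lemma power_mean_two_power:
  fixes x :: "'a \<Rightarrow> real"
  assumes "finite A" "A \<noteq> {}"
  shows "((\<Sum>i\<in>A. x i) / card A) ^ (2 ^ k) \<le> (\<Sum>i\<in>A. x i ^ (2 ^ k)) / card A"
proof (induction k arbitrary: x)
  case (Suc k)
  have c: "real (card A) > 0" using assms by (simp add: card_gt_0_iff)
  have "((\<Sum>i\<in>A. x i) / card A)\<^sup>2 \<le> (\<Sum>i\<in>A. (x i)\<^sup>2) / card A"
    using square_sum_le[of x A] c by (simp add: field_simps power2_eq_square)
  then have "(((\<Sum>i\<in>A. x i) / card A)\<^sup>2) ^ (2 ^ k) \<le> ((\<Sum>i\<in>A. (x i)\<^sup>2) / card A) ^ (2 ^ k)"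
    by (rule power_mono) simp
  also have "\<dots> \<le> (\<Sum>i\<in>A. ((x i)\<^sup>2) ^ (2 ^ k)) / card A" by (rule Suc.IH)
  finally show ?case by (simp only: power_mult[symmetric] power_Suc)
qed simp

lemma sum_shift_diff:
  fixes w :: "nat \<Rightarrow> real"
  assumes w: "\<And>n. \<bar>w n\<bar> \<le> 1"
  shows "\<bar>(\<Sum>n<K. w n) - (\<Sum>n<K. w (n + d))\<bar> \<le> 2 * real d"
proof (induction d)
  case (Suc d)
  have "(\<Sum>n<K. w (n + Suc d)) + w d = (\<Sum>n<Suc K. w (n + d))"
    by (subst sum.lessThan_Suc_shift) simp
  also have "\<dots> = (\<Sum>n<K. w (n + d)) + w (K + d)" by simp
  finally have "(\<Sum>n<K. w (n + Suc d)) = (\<Sum>n<K. w (n + d)) + w (K + d) - w d" by linarith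
  moreover have "\<bar>w (K + d)\<bar> \<le> 1" "\<bar>w d\<bar> \<le> 1" by (rule w)+
  moreover have "\<bar>a - b\<bar> \<le> 2 * (1 + D)"
    if "b = c + x - y" "\<bar>x\<bar> \<le> 1" "\<bar>y\<bar> \<le> 1" "\<bar>a - c\<bar> \<le> 2 * D" for a b c x y D :: real
    using that by (auto simp: abs_le_iff)
  ultimately show ?case using Suc unfolding of_nat_Suc by blast
qed simp

text \<open>
  Shifting a long average changes it little, so it may be averaged over any family of short
  shifts; Cauchy--Schwarz then doubles the shift variable.
\<close>

lemma vdc_step:
  fixes w :: "nat \<Rightarrow> real" and K U M :: nat
  assumes w: "\<And>n. \<bar>w n\<bar> \<le> 1" and K: "K > 0" and U: "U > 0"
    and g: "\<And>u. u < U \<Longrightarrow> g u \<le> M"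
  shows "((\<Sum>n<K. w n) / K)\<^sup>2 \<le>
    (\<Sum>a<U. \<Sum>b<U. (\<Sum>n<K. w (n + g a) * w (n + g b)) / K) / U\<^sup>2 + 4 * real M / K"
proof -
  define X where "X = (\<Sum>n<K. w n) / K"
  define Z where "Z n = (\<Sum>u<U. w (n + g u)) / U" for n
  define Y where "Y = (\<Sum>n<K. Z n) / K"
  have K': "real K > 0" and U': "real U > 0" using K U by auto
  have X1: "\<bar>X\<bar> \<le> 1"
  proof -
    have "\<bar>\<Sum>n<K. w n\<bar> \<le> (\<Sum>n<K. 1)" by (rule order.trans[OF sum_abs sum_mono]) (rule w)
    then show ?thesis using K' by (simp add: X_def divide_simps)
  qed
  have Z1: "\<bar>Z n\<bar> \<le> 1" for n
  proof -
    have "\<bar>\<Sum>u<U. w (n + g u)\<bar> \<le> (\<Sum>u<U. 1)" by (rule order.trans[OF sum_abs sum_mono]) (rule w)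
    then show ?thesis using U' by (simp add: Z_def divide_simps)
  qed
  have Y1: "\<bar>Y\<bar> \<le> 1"
  proof -
    have "\<bar>\<Sum>n<K. Z n\<bar> \<le> (\<Sum>n<K. 1)" by (rule order.trans[OF sum_abs sum_mono]) (rule Z1)
    then show ?thesis using K' by (simp add: Y_def divide_simps)
  qed
  have XY: "\<bar>X - Y\<bar> \<le> 2 * M / K"
  proof -
    have "real U * (\<Sum>n<K. Z n) = (\<Sum>u<U. \<Sum>n<K. w (n + g u))"
      using U' by (subst sum.swap) (simp add: Z_def sum_divide_distrib[symmetric])
    then have "real U * ((\<Sum>n<K. w n) - (\<Sum>n<K. Z n)) = (\<Sum>u<U. (\<Sum>n<K. w n) - (\<Sum>n<K. w (n + g u)))"
      by (simp add: sum_subtractf right_diff_distrib)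
    also have "\<bar>\<dots>\<bar> \<le> (\<Sum>u<U. 2 * real M)"
    proof (rule order.trans[OF sum_abs sum_mono])
      fix u assume "u \<in> {..<U}"
      then show "\<bar>(\<Sum>n<K. w n) - (\<Sum>n<K. w (n + g u))\<bar> \<le> 2 * real M"
        using sum_shift_diff[of w K "g u", OF w] g[of u] by fastforce
    qed
    also have "\<dots> = real U * (2 * real M)" by simp
    finally have "real U * \<bar>(\<Sum>n<K. w n) - (\<Sum>n<K. Z n)\<bar> \<le> real U * (2 * real M)"
      using U' by (simp add: abs_mult)
    then have "\<bar>(\<Sum>n<K. w n) - (\<Sum>n<K. Z n)\<bar> \<le> 2 * real M" using U' by simp
    moreover have "X - Y = ((\<Sum>n<K. w n) - (\<Sum>n<K. Z n)) / K" by (simp add: X_def Y_def diff_divide_distrib)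
    ultimately show ?thesis using K' by (simp add: divide_simps)
  qed
  have "X\<^sup>2 - Y\<^sup>2 = (X - Y) * (X + Y)" by (simp add: power2_eq_square algebra_simps)
  also have "\<dots> \<le> \<bar>X - Y\<bar> * \<bar>X + Y\<bar>" by (metis abs_ge_self abs_mult)
  also have "\<dots> \<le> (2 * M / K) * 2"
    using XY X1 Y1 by (intro mult_mono) auto
  finally have 1: "X\<^sup>2 \<le> Y\<^sup>2 + 4 * real M / K" by simp
  have "Y\<^sup>2 \<le> (\<Sum>n<K. (Z n)\<^sup>2) / K"
    using power_mean_two_power[of "{..<K}" Z 1] K by (simp add: Y_def lessThan_empty_iff)
  also have "\<dots> = (\<Sum>a<U. \<Sum>b<U. (\<Sum>n<K. w (n + g a) * w (n + g b)) / K) / U\<^sup>2"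
  proof -
    have "(Z n)\<^sup>2 = (\<Sum>a<U. \<Sum>b<U. w (n + g a) * w (n + g b)) / U\<^sup>2" for n
      by (simp add: Z_def power_divide power2_eq_square sum_product)
    then have "(\<Sum>n<K. (Z n)\<^sup>2) = (\<Sum>n<K. \<Sum>a<U. \<Sum>b<U. w (n + g a) * w (n + g b)) / U\<^sup>2"
      by (simp add: sum_divide_distrib)
    also have "(\<Sum>n<K. \<Sum>a<U. \<Sum>b<U. w (n + g a) * w (n + g b)) = (\<Sum>a<U. \<Sum>b<U. \<Sum>n<K. w (n + g a) * w (n + g b))"
      by (subst sum.swap, rule sum.cong[OF refl], rule sum.swap)
    finally show ?thesis by (simp add: sum_divide_distrib[symmetric])
  qed
  finally show ?thesis using 1 by (simp add: X_def)
qed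

text \<open>
  On \<open>[0, 1]\<close> the power function is Lipschitz with constant \<open>p\<close>.
\<close>

lemma power_le_add:
  fixes x y e :: real
  assumes "0 \<le> x" "x \<le> 1" "0 \<le> y" "0 \<le> e" "x \<le> y + e"
  shows "x ^ p \<le> y ^ p + p * e"
proof (induction p)
  case (Suc p)
  show ?case
  proof (cases "x \<le> y")
    case True
    then have "x ^ Suc p \<le> y ^ Suc p" using assms by (intro power_mono) auto
    moreover have "0 \<le> Suc p * e" using assms by simp
    ultimately show ?thesis by linarith
  next
    case False
    have "x ^ Suc p = x * x ^ p" by simp
    also have "\<dots> \<le> x * (y ^ p + p * e)" using Suc assms by (intro mult_left_mono) auto
    also have "\<dots> = x * y ^ p + x * (p * e)" by (simp add: algebra_simps)
    also have "x * y ^ p \<le> (y + e) * y ^ p" using assms by (intro mult_right_mono) auto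
    also have "(y + e) * y ^ p = y ^ Suc p + e * y ^ p" by (simp add: algebra_simps)
    also have "e * y ^ p \<le> e * 1" using assms False by (intro mult_left_mono power_le_one) auto
    also have "x * (p * e) \<le> 1 * (p * e)" using assms by (intro mult_right_mono) auto
    finally show ?thesis by (simp add: algebra_simps)
  qed
qed simp

text \<open>
  Iterated van der Corput inequality, with an arbitrary family of shifts in each direction.
  The freedom in the families is essential: they will be adapted to the slope of the sequence.
\<close>

lemma vdc_box:
  fixes w :: "nat \<Rightarrow> real" and K U M :: nat
  assumes w: "\<And>n. \<bar>w n\<bar> \<le> 1" and K: "K > 0" and U: "U > 0"
    and g: "\<And>i u. i < k \<Longrightarrow> u < U \<Longrightarrow> g i u \<le> M"
  shows "((\<Sum>n<K. w n) / K) ^ (2 ^ k) \<le>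
    (\<Sum>u\<in>boxes U k. (\<Sum>n<K. \<Prod>\<omega>\<in>Pow {..<k}. w (n + vertex k g u \<omega>)) / K) / U ^ (2 * k)
     + 4 * (2 ^ k - 1) * real M / K"
  using w g
proof (induction k arbitrary: w)
  case 0
  show ?case by (simp add: boxes_def vertex_def)
next
  case (Suc k)
  let ?W = "\<lambda>u. (\<Sum>n<K. \<Prod>\<omega>\<in>Pow {..<Suc k}. w (n + vertex (Suc k) g u \<omega>))"
  define X where "X = (\<Sum>n<K. w n) / K"
  define W where "W a b n = w (n + g k a) * w (n + g k b)" for a b n
  define A where "A a b = (\<Sum>n<K. W a b n) / K" for a b
  define Y where "Y = (\<Sum>a<U. \<Sum>b<U. A a b) / U\<^sup>2"
  define B where "B a b = (\<Sum>u\<in>boxes U k. (\<Sum>n<K. \<Prod>\<omega>\<in>Pow {..<k}. W a b (n + vertex k g u \<omega>)) / K) / U ^ (2 * k)" for a b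
  let ?e = "4 * real M / K"
  have K': "real K > 0" and U': "real U > 0" using K U by auto
  have X1: "\<bar>X\<bar> \<le> 1"
  proof -
    have "\<bar>\<Sum>n<K. w n\<bar> \<le> (\<Sum>n<K. 1)" by (rule order.trans[OF sum_abs sum_mono]) (rule Suc.prems)
    then show ?thesis using K' by (simp add: X_def divide_simps)
  qed
  \<comment> \<open>The last direction is treated first; the remaining ones act on the products \<open>W a b\<close>.\<close>
  have XY: "X\<^sup>2 \<le> Y + ?e"
    unfolding X_def Y_def A_def W_def using Suc.prems K U by (intro vdc_step) auto
  have Y0: "0 \<le> Y"
  proof -
    have "(\<Sum>a<U. \<Sum>b<U. A a b) = (\<Sum>n<K. (\<Sum>a<U. w (n + g k a))\<^sup>2) / K"
    proof -
      have "(\<Sum>a<U. \<Sum>b<U. \<Sum>n<K. W a b n) = (\<Sum>n<K. \<Sum>a<U. \<Sum>b<U. W a b n)"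
        by (subst (2) sum.swap, rule sum.cong[OF refl], rule sum.swap)
      then show ?thesis
        by (simp add: A_def W_def sum_divide_distrib[symmetric] power2_eq_square sum_product)
    qed
    also have "\<dots> \<ge> 0" by (intro divide_nonneg_nonneg sum_nonneg) auto
    finally show ?thesis by (simp add: Y_def)
  qed
  have W1: "\<bar>W a b n\<bar> \<le> 1" for a b n
    unfolding W_def abs_mult using mult_mono[OF Suc.prems(1) Suc.prems(1), of "n + g k b" "n + g k a"] by simp
  have IH: "A a b ^ (2 ^ k) \<le> B a b + 4 * (2 ^ k - 1) * real M / K" for a b
    unfolding A_def B_def using Suc.prems by (intro Suc.IH W1) auto
  have "X ^ (2 ^ Suc k) = (X\<^sup>2) ^ (2 ^ k)"
    by (simp add: power_mult)
  also have "\<dots> \<le> Y ^ (2 ^ k) + (2 ^ k) * ?e"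
    using power_le_add[of "X\<^sup>2" Y ?e "2 ^ k"] XY Y0 X1 by (simp add: abs_square_le_1)
  also have "Y ^ (2 ^ k) \<le> (\<Sum>(a, b)\<in>{..<U} \<times> {..<U}. A a b ^ (2 ^ k)) / U\<^sup>2"
    using power_mean_two_power[of "{..<U} \<times> {..<U}" "\<lambda>(a, b). A a b" k] U
    by (simp add: lessThan_empty_iff Y_def sum.cartesian_product power2_eq_square case_prod_unfold)
  also have "(\<Sum>(a, b)\<in>{..<U} \<times> {..<U}. A a b ^ (2 ^ k)) \<le>
      (\<Sum>(a, b)\<in>{..<U} \<times> {..<U}. B a b + 4 * (2 ^ k - 1) * real M / K)"
    by (rule sum_mono) (use IH in auto)
  also have "\<dots> = (\<Sum>a<U. \<Sum>b<U. B a b) + U\<^sup>2 * (4 * (2 ^ k - 1) * real M / K)"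
    by (simp add: sum.cartesian_product[symmetric] sum.distrib power2_eq_square)
  also have "\<dots> / U\<^sup>2 = (\<Sum>a<U. \<Sum>b<U. B a b) / U\<^sup>2 + 4 * (2 ^ k - 1) * real M / K"
    using U' by (simp add: add_divide_distrib)
  finally have main: "X ^ (2 ^ Suc k) \<le> (\<Sum>a<U. \<Sum>b<U. B a b) / U\<^sup>2 + 4 * (2 ^ Suc k - 1) * real M / K"
    using U' by (simp add: divide_right_mono algebra_simps add_divide_distrib diff_divide_distrib)
  have "(\<Sum>u\<in>boxes U (Suc k). ?W u / K) =
     (\<Sum>a<U. \<Sum>b<U. \<Sum>u\<in>boxes U k. (\<Sum>n<K. \<Prod>\<omega>\<in>Pow {..<k}. W a b (n + vertex k g u \<omega>)) / K)"
    unfolding sum_boxes_Suc prod_Pow_Suc W_def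
    by (intro sum.cong arg_cong2[of _ _ _ _ "(/)"] prod.cong refl) (auto simp: vertex_Suc add.assoc)
  also have "\<dots> = (\<Sum>a<U. \<Sum>b<U. B a b) * U ^ (2 * k)"
    using U' by (simp add: B_def sum_divide_distrib[symmetric])
  finally have "(\<Sum>u\<in>boxes U (Suc k). ?W u / K) / U ^ (2 * Suc k)
     = (\<Sum>a<U. \<Sum>b<U. B a b) / U\<^sup>2"
    using U' by (simp add: power2_eq_square)
  then show ?case using main by (simp only: X_def)
qed

section \<open>Reduction of cubes to the lowest digits\<close>

text \<open>
  A perturbation by nearly a multiple of \<open>2 ^ b\<close> leaves the digits in \<open>[a, b)\<close> unchanged,
  unless the number is so close to a multiple of \<open>2 ^ a\<close> that the error causes a carry.
\<close>

lemma floor_div_power_shift: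
  fixes X X' e :: real and P :: int
  assumes X: "0 \<le> X" "0 \<le> X'" and ab: "a \<le> b"
    and close: "\<bar>X' - X - 2 ^ b * of_int P\<bar> \<le> e * 2 ^ a"
    and far: "\<And>z::int. \<not> \<bar>X - 2 ^ a * of_int z\<bar> \<le> e * 2 ^ a"
  shows "int (nat \<lfloor>X'\<rfloor> div 2 ^ a) = int (nat \<lfloor>X\<rfloor> div 2 ^ a) + 2 ^ (b - a) * P"
proof -
  have fl: "int (nat \<lfloor>Y\<rfloor> div 2 ^ a) = \<lfloor>Y / 2 ^ a\<rfloor>" if "0 \<le> Y" for Y :: real
    using floor_divide_real_eq_div[of "2 ^ a" Y] that by (simp add: zdiv_int)
  define z where "z = \<lfloor>X / 2 ^ a\<rfloor>"
  have p: "(0::real) < 2 ^ a" by simp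
  have z1: "2 ^ a * of_int z \<le> X" "X < 2 ^ a * (of_int z + 1)"
  proof -
    have "of_int z \<le> X / 2 ^ a" "X / 2 ^ a < of_int z + 1"
      unfolding z_def by linarith+
    then show "2 ^ a * of_int z \<le> X" "X < 2 ^ a * (of_int z + 1)"
      using p by (simp_all add: pos_le_divide_eq pos_divide_less_eq mult.commute)
  qed
  have f1: "X - 2 ^ a * of_int z > e * 2 ^ a" using far[of z] z1 by linarith
  have f2: "2 ^ a * of_int (z + 1) - X > e * 2 ^ a" using far[of "z + 1"] z1 unfolding of_int_add of_int_1 by linarith
  have pb: "(2::real) ^ b = 2 ^ a * 2 ^ (b - a)" using ab by (simp flip: power_add)
  have "\<lfloor>X' / 2 ^ a\<rfloor> = z + 2 ^ (b - a) * P"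
  proof (rule floor_unique)
    have "2 ^ a * (of_int (z + 2 ^ (b - a) * P)) = 2 ^ a * of_int z + 2 ^ b * real_of_int P"
      by (simp add: pb algebra_simps)
    also have "\<dots> \<le> X'" using f1 close by linarith
    finally show "of_int (z + 2 ^ (b - a) * P) \<le> X' / 2 ^ a"
      by (simp add: pos_le_divide_eq mult.commute)
    have "X' < 2 ^ a * of_int (z + 1) + 2 ^ b * of_int P" using f2 close by linarith
    also have "\<dots> = 2 ^ a * (of_int (z + 2 ^ (b - a) * P) + 1)"
      by (simp add: pb algebra_simps)
    finally show "X' / 2 ^ a < of_int (z + 2 ^ (b - a) * P) + 1"
      by (simp add: pos_divide_less_eq mult.commute)
  qed
  then show ?thesis using fl[OF X(1)] fl[OF X(2)] by (simp add: z_def)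
qed

text \<open>
  One direction without influence suffices for complete cancellation: the vertices cancel in
  pairs.
\<close>

lemma prod_Pow_pairs:
  fixes f :: "nat set \<Rightarrow> real"
  assumes i: "i < k"
    and eq: "\<And>\<omega>. \<omega> \<subseteq> {..<k} \<Longrightarrow> i \<notin> \<omega> \<Longrightarrow> f (insert i \<omega>) = f \<omega>"
    and sq: "\<And>\<omega>. f \<omega> * f \<omega> = 1"
  shows "(\<Prod>\<omega>\<in>Pow {..<k}. f \<omega>) = 1"
proof -
  let ?A = "{..<k} - {i}"
  have "{..<k} = insert i ?A" using i by auto
  then have "(\<Prod>\<omega>\<in>Pow {..<k}. f \<omega>) = (\<Prod>\<omega>\<in>Pow ?A \<union> insert i ` Pow ?A. f \<omega>)"
    using Pow_insert[of i ?A] by simp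
  also have "\<dots> = (\<Prod>\<omega>\<in>Pow ?A. f \<omega>) * (\<Prod>\<omega>\<in>insert i ` Pow ?A. f \<omega>)"
    by (rule prod.union_disjoint) auto
  also have "(\<Prod>\<omega>\<in>insert i ` Pow ?A. f \<omega>) = (\<Prod>\<omega>\<in>Pow ?A. f (insert i \<omega>))"
  proof (rule prod.reindex_cong[OF _ refl refl])
    show "inj_on (insert i) (Pow ?A)"
      by (rule inj_on_inverseI[of _ "\<lambda>\<omega>. \<omega> - {i}"]) auto
  qed
  also have "\<dots> = (\<Prod>\<omega>\<in>Pow ?A. f \<omega>)" by (rule prod.cong[OF refl]) (rule eq, auto)
  finally show ?thesis by (simp add: prod.distrib[symmetric] sq)
qed

lemma vertex_insert:
  assumes "i < k" "i \<notin> \<omega>"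
  shows "real (vertex k g u (insert i \<omega>)) - real (vertex k g u \<omega>) =
     real (g i (fst (u i))) - real (g i (snd (u i)))"
proof -
  have "real (vertex k g u (insert i \<omega>)) - real (vertex k g u \<omega>) =
     (\<Sum>j<k. if j = i then real (g i (fst (u i))) - real (g i (snd (u i))) else 0)"
    unfolding vertex_def of_nat_sum sum_subtractf[symmetric] using assms by (intro sum.cong) auto
  then show ?thesis using assms by simp
qed

lemma vertex_le:
  assumes u: "u \<in> boxes U k" and g: "\<And>i a. i < k \<Longrightarrow> a < U \<Longrightarrow> g i a \<le> M0"
  shows "vertex k g u \<omega> \<le> k * M0"
proof -
  have "vertex k g u \<omega> \<le> (\<Sum>i<k. M0)"
    unfolding vertex_def
  proof (rule sum_mono)
    fix i assume "i \<in> {..<k}"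
    then have i: "i < k" by simp
    show "g i ((if i \<in> \<omega> then fst else snd) (u i)) \<le> M0"
      by (rule g[OF i boxesD[OF u i]])
  qed
  then show ?thesis by simp
qed

text \<open>
  Each family of shifts acts on the lowest digits like \<open>a \<mapsto> a + c i\<close>, up to a small error. The
  errors of the \<open>k\<close> directions add up.
\<close>

lemma vertex_approx:
  fixes \<alpha> s B :: real and c :: "nat \<Rightarrow> nat"
  assumes u: "u \<in> boxes U k"
    and h2: "\<And>i a. i < k \<Longrightarrow> a < U \<Longrightarrow> \<exists>Q::int. \<bar>real (g i a) * \<alpha> - real (a + c i) - B * of_int Q\<bar> \<le> 1 / s"
  shows "\<exists>Q::int. \<bar>real (vertex k g u \<omega>) * \<alpha> - real (vertex k (\<lambda>i a. a) u \<omega> + (\<Sum>i<k. c i)) - B * of_int Q\<bar> \<le> k / s"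
proof -
  define a where "a i = (if i \<in> \<omega> then fst else snd) (u i)" for i
  have "\<forall>i. \<exists>q::int. i < k \<longrightarrow> \<bar>real (g i (a i)) * \<alpha> - real (a i + c i) - B * of_int q\<bar> \<le> 1 / s"
  proof
    fix i
    show "\<exists>q::int. i < k \<longrightarrow> \<bar>real (g i (a i)) * \<alpha> - real (a i + c i) - B * of_int q\<bar> \<le> 1 / s"
    proof (cases "i < k")
      case True
      then have "a i < U" unfolding a_def by (rule boxesD[OF u])
      then show ?thesis using h2[OF True, of "a i"] by blast
    qed simp
  qed
  from choice[OF this] obtain Q :: "nat \<Rightarrow> int" where
    Q: "\<And>i. i < k \<Longrightarrow> \<bar>real (g i (a i)) * \<alpha> - real (a i + c i) - B * of_int (Q i)\<bar> \<le> 1 / s" by blast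
  have "real (vertex k g u \<omega>) * \<alpha> - real (vertex k (\<lambda>i a. a) u \<omega> + (\<Sum>i<k. c i)) - B * of_int (\<Sum>i<k. Q i)
     = (\<Sum>i<k. real (g i (a i)) * \<alpha> - real (a i + c i) - B * of_int (Q i))"
    unfolding vertex_def a_def by (simp add: sum_subtractf sum_distrib_left sum_distrib_right sum.distrib)
  also have "\<bar>\<dots>\<bar> \<le> (\<Sum>i<k. 1 / s)"
    by (rule order.trans[OF sum_abs sum_mono]) (use Q in auto)
  finally have "\<bar>real (vertex k g u \<omega>) * \<alpha> - real (vertex k (\<lambda>i a. a) u \<omega> + (\<Sum>i<k. c i)) - B * of_int (\<Sum>i<k. Q i)\<bar> \<le> k / s"
    by simp
  then show ?thesis by blast
qed

text \<open>
  The product over a cube reduces to the lowest \<open>b 0\<close> digits. Block \<open>i\<close> of the digits is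
  insensitive to direction \<open>i\<close>, and the digits above \<open>b k\<close> are insensitive to direction \<open>0\<close>,
  whose shifts are short. All these pieces of the sign cancel in pairs. The remaining digits
  see integers plus exact shifts. The hypotheses on \<open>near\<close> exclude the points where rounding
  errors trigger a carry.
\<close>

lemma cube_product_eq:
  fixes F :: "nat \<Rightarrow> real" and \<alpha> \<beta> s :: real and b c :: "nat \<Rightarrow> nat" and K M M0 U n :: nat
  assumes k: "k > 0" and s: "s > 0"
    and b: "\<And>i. i < k \<Longrightarrow> b i \<le> b (Suc i)"
    and F: "\<And>n. 0 \<le> F n" "\<And>n. n \<le> K + M \<Longrightarrow> \<bar>F n - (\<beta> + n * \<alpha>)\<bar> \<le> 1 / s"
    and g: "\<And>i a. i < k \<Longrightarrow> a < U \<Longrightarrow> g i a \<le> M0" and M: "k * M0 \<le> M"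
    and h1: "\<And>i a a'. i < k \<Longrightarrow> a < U \<Longrightarrow> a' < U \<Longrightarrow>
       \<exists>P::int. \<bar>(real (g i a) - real (g i a')) * \<alpha> - 2 ^ b (Suc i) * of_int P\<bar> \<le> 2 ^ b i / s"
    and h2: "\<And>i a. i < k \<Longrightarrow> a < U \<Longrightarrow>
       \<exists>Q::int. \<bar>real (g i a) * \<alpha> - real (a + c i) - 2 ^ b 0 * of_int Q\<bar> \<le> 1 / s"
    and h3: "\<And>a a'. a < U \<Longrightarrow> a' < U \<Longrightarrow> \<bar>(real (g 0 a) - real (g 0 a')) * \<alpha>\<bar> \<le> 2 ^ b k / s"
    and near: "\<And>a n. near a n \<longleftrightarrow> (\<exists>z::int. \<bar>F n - 2 ^ a * of_int z\<bar> \<le> (k + 3) / s * 2 ^ a)"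
    and u: "u \<in> boxes U k" and n: "n < K" and n_far: "\<not> near 0 n"
    and far: "\<And>\<omega> i. \<omega> \<subseteq> {..<k} \<Longrightarrow> i \<le> k \<Longrightarrow> \<not> near (b i) (n + vertex k g u \<omega>)"
  shows "(\<Prod>\<omega>\<in>Pow {..<k}. tm (nat \<lfloor>F (n + vertex k g u \<omega>)\<rfloor>)) =
    (\<Prod>\<omega>\<in>Pow {..<k}. tm ((nat \<lfloor>F n\<rfloor> + (\<Sum>i<k. c i) + vertex k (\<lambda>i a. a) u \<omega>) mod 2 ^ b 0))"
proof -
  let ?d = "\<lambda>i. (real (g i (fst (u i))) - real (g i (snd (u i))))"
  let ?N = "\<lambda>\<omega>. n + vertex k g u \<omega>"
  let ?f = "\<lambda>\<omega>. nat \<lfloor>F (?N \<omega>)\<rfloor>"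
  have N: "?N \<omega> \<le> K + M" for \<omega> using vertex_le[OF u, of g M0 \<omega>, OF g] n M by linarith
  have uU: "fst (u i) < U" "snd (u i) < U" if "i < k" for i
    using boxesD[OF u that, of "{i}"] boxesD[OF u that, of "{}"] by auto
  have diff: "\<bar>F (?N (insert i \<omega>)) - F (?N \<omega>) - ?d i * \<alpha>\<bar> \<le> 2 / s"
    if "i < k" "i \<notin> \<omega>" for i \<omega>
  proof -
    have "real (?N (insert i \<omega>)) * \<alpha> - real (?N \<omega>) * \<alpha> =
        (real (vertex k g u (insert i \<omega>)) - real (vertex k g u \<omega>)) * \<alpha>"
      by (simp add: algebra_simps)
    then have e: "real (?N (insert i \<omega>)) * \<alpha> - real (?N \<omega>) * \<alpha> = ?d i * \<alpha>"
      by (simp only: vertex_insert[OF that])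
    have *: "\<bar>x' - x - d\<bar> \<le> 2 * t" if "y' - y = d" "\<bar>x - (\<beta> + y)\<bar> \<le> t" "\<bar>x' - (\<beta> + y')\<bar> \<le> t" for x x' y y' d t :: real
      using that by (auto simp: abs_le_iff)
    show ?thesis using *[OF e F(2)[OF N] F(2)[OF N]] by simp
  qed
  have p1: "(1::real) \<le> 2 ^ a" for a :: nat by simp
  have block: "(\<Prod>\<omega>\<in>Pow {..<k}. tm (?f \<omega> div 2 ^ b i mod 2 ^ (b (Suc i) - b i))) = 1" if i: "i < k" for i
  proof (rule prod_Pow_pairs[OF i])
    fix \<omega> assume w: "\<omega> \<subseteq> {..<k}" "i \<notin> \<omega>"
    obtain P :: int where P: "\<bar>?d i * \<alpha> - 2 ^ b (Suc i) * of_int P\<bar> \<le> 2 ^ b i / s"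
      using h1[OF i uU[OF i]] by blast
    have "\<bar>F (?N (insert i \<omega>)) - F (?N \<omega>) - 2 ^ b (Suc i) * of_int P\<bar> \<le> 2 / s + 2 ^ b i / s"
      using diff[OF i w(2)] P by linarith
    also have "\<dots> \<le> 2 * 2 ^ b i / s + 2 ^ b i / s"
      using s p1[of "b i"] by (intro add_right_mono divide_right_mono) auto
    also have "\<dots> = 3 / s * 2 ^ b i" using s by (simp add: field_simps)
    also have "\<dots> \<le> (k + 3) / s * 2 ^ b i" using s by (intro mult_right_mono divide_right_mono) auto
    finally have le: "\<bar>F (?N (insert i \<omega>)) - F (?N \<omega>) - 2 ^ b (Suc i) * of_int P\<bar> \<le> (k + 3) / s * 2 ^ b i" .
    have "\<not> \<bar>F (?N \<omega>) - 2 ^ b i * of_int z\<bar> \<le> (k + 3) / s * 2 ^ b i" for z :: int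
      using far[OF w(1), of i] i unfolding near by auto
    then have "int (?f (insert i \<omega>) div 2 ^ b i) = int (?f \<omega> div 2 ^ b i) + 2 ^ (b (Suc i) - b i) * P"
      by (rule floor_div_power_shift[OF F(1) F(1) b[OF i] le])
    then have "int (?f (insert i \<omega>) div 2 ^ b i) mod 2 ^ (b (Suc i) - b i) = int (?f \<omega> div 2 ^ b i) mod 2 ^ (b (Suc i) - b i)"
      by simp
    then have "int (?f (insert i \<omega>) div 2 ^ b i mod 2 ^ (b (Suc i) - b i)) = int (?f \<omega> div 2 ^ b i mod 2 ^ (b (Suc i) - b i))"
      unfolding zmod_int by simp
    then show "tm (?f (insert i \<omega>) div 2 ^ b i mod 2 ^ (b (Suc i) - b i)) = tm (?f \<omega> div 2 ^ b i mod 2 ^ (b (Suc i) - b i))"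
      by (simp only: of_nat_eq_iff)
  qed simp
  have top: "(\<Prod>\<omega>\<in>Pow {..<k}. tm (?f \<omega> div 2 ^ b k)) = 1"
  proof (rule prod_Pow_pairs[OF k])
    fix \<omega> assume w: "\<omega> \<subseteq> {..<k}" "0 \<notin> \<omega>"
    have P: "\<bar>(real (g 0 (fst (u 0))) - real (g 0 (snd (u 0)))) * \<alpha>\<bar> \<le> 2 ^ b k / s"
      using h3[OF uU[OF k]] .
    have "\<bar>F (?N (insert 0 \<omega>)) - F (?N \<omega>) - 2 ^ b k * of_int 0\<bar> \<le> 2 / s + 2 ^ b k / s"
      unfolding of_int_0 mult_zero_right diff_zero using diff[OF k w(2)] P by linarith
    also have "\<dots> \<le> 2 * 2 ^ b k / s + 2 ^ b k / s"
      using s p1[of "b k"] by (intro add_right_mono divide_right_mono) auto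
    also have "\<dots> = 3 / s * 2 ^ b k" using s by (simp add: field_simps)
    also have "\<dots> \<le> (k + 3) / s * 2 ^ b k" using s by (intro mult_right_mono divide_right_mono) auto
    finally have le: "\<bar>F (?N (insert 0 \<omega>)) - F (?N \<omega>) - 2 ^ b k * of_int 0\<bar> \<le> (k + 3) / s * 2 ^ b k" .
    have "\<not> \<bar>F (?N \<omega>) - 2 ^ b k * of_int z\<bar> \<le> (k + 3) / s * 2 ^ b k" for z :: int
      using far[OF w(1), of k] unfolding near by auto
    then have "int (?f (insert 0 \<omega>) div 2 ^ b k) = int (?f \<omega> div 2 ^ b k) + 2 ^ (b k - b k) * 0"
      by (rule floor_div_power_shift[OF F(1) F(1) order.refl le])
    then show "tm (?f (insert 0 \<omega>) div 2 ^ b k) = tm (?f \<omega> div 2 ^ b k)"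
      by simp
  qed simp
  have window: "?f \<omega> mod 2 ^ b 0 = (nat \<lfloor>F n\<rfloor> + (\<Sum>i<k. c i) + vertex k (\<lambda>i a. a) u \<omega>) mod 2 ^ b 0" for \<omega>
  proof -
    let ?S = "vertex k (\<lambda>i a. a) u \<omega> + (\<Sum>i<k. c i)"
    obtain Q :: int where Q: "\<bar>real (vertex k g u \<omega>) * \<alpha> - real ?S - 2 ^ b 0 * of_int Q\<bar> \<le> k / s"
      using vertex_approx[OF u, of g \<alpha> c "2 ^ b 0" s \<omega>] h2 by blast
    have "n \<le> K + M" using n by simp
    then have 1: "\<bar>F n - (\<beta> + real n * \<alpha>)\<bar> \<le> 1 / s" by (rule F(2))
    have 2: "\<bar>F (?N \<omega>) - (\<beta> + real (?N \<omega>) * \<alpha>)\<bar> \<le> 1 / s" by (rule F(2)[OF N])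
    have "\<bar>F (?N \<omega>) - F n - (real ?S + 2 ^ b 0 * of_int Q)\<bar> \<le> (k + 2) / s"
    proof -
      have e: "real (?N \<omega>) * \<alpha> = real n * \<alpha> + real (vertex k g u \<omega>) * \<alpha>" by (simp add: algebra_simps)
      have *: "\<bar>x' - x - (S + Q)\<bar> \<le> t1 + t + t" if "y' = y + d" "\<bar>x - (\<beta> + y)\<bar> \<le> t" "\<bar>x' - (\<beta> + y')\<bar> \<le> t" "\<bar>d - S - Q\<bar> \<le> t1"
        for x x' y y' d t t1 S Q :: real
        using that by (auto simp: abs_le_iff)
      show ?thesis using *[OF e 1 2 Q] by (simp add: add_divide_distrib)
    qed
    also have "\<dots> \<le> (k + 3) / s * 2 ^ 0" using s by (simp add: divide_right_mono)
    finally have le: "\<bar>F (?N \<omega>) - F n - 2 ^ 0 * of_int (int ?S + 2 ^ b 0 * Q)\<bar> \<le> (k + 3) / s * 2 ^ 0" by simp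
    have "\<not> \<bar>F n - 2 ^ 0 * of_int z\<bar> \<le> (k + 3) / s * 2 ^ 0" for z :: int
      using n_far unfolding near by auto
    then have "int (?f \<omega> div 2 ^ 0) = int (nat \<lfloor>F n\<rfloor> div 2 ^ 0) + 2 ^ (0 - 0) * (int ?S + 2 ^ b 0 * Q)"
      by (rule floor_div_power_shift[OF F(1) F(1) order.refl le])
    then have "int (?f \<omega>) = int (nat \<lfloor>F n\<rfloor> + ?S) + 2 ^ b 0 * Q" by simp
    then have "int (?f \<omega>) mod 2 ^ b 0 = int (nat \<lfloor>F n\<rfloor> + ?S) mod 2 ^ b 0" by (simp only: mod_mult_self2)
    then have "int (?f \<omega> mod 2 ^ b 0) = int ((nat \<lfloor>F n\<rfloor> + ?S) mod 2 ^ b 0)" unfolding zmod_int by simp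
    then show ?thesis by (simp only: of_nat_eq_iff ac_simps)
  qed
  have "(\<Prod>\<omega>\<in>Pow {..<k}. tm (?f \<omega>)) =
     (\<Prod>\<omega>\<in>Pow {..<k}. tm (?f \<omega> mod 2 ^ b 0) *
    (\<Prod>i<k. tm (?f \<omega> div 2 ^ b i mod 2 ^ (b (Suc i) - b i))) * tm (?f \<omega> div 2 ^ b k))"
    by (rule prod.cong[OF refl]) (rule tm_blocks[of k b, OF b])
  also have "\<dots> = (\<Prod>\<omega>\<in>Pow {..<k}. tm (?f \<omega> mod 2 ^ b 0)) *
     (\<Prod>\<omega>\<in>Pow {..<k}. \<Prod>i<k. tm (?f \<omega> div 2 ^ b i mod 2 ^ (b (Suc i) - b i))) *
     (\<Prod>\<omega>\<in>Pow {..<k}. tm (?f \<omega> div 2 ^ b k))"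
    by (simp only: prod.distrib)
  also have "(\<Prod>\<omega>\<in>Pow {..<k}. \<Prod>i<k. tm (?f \<omega> div 2 ^ b i mod 2 ^ (b (Suc i) - b i))) =
     (\<Prod>i<k. \<Prod>\<omega>\<in>Pow {..<k}. tm (?f \<omega> div 2 ^ b i mod 2 ^ (b (Suc i) - b i)))"
    by (rule prod.swap)
  also have "\<dots> = 1" using block by (intro prod.neutral) auto
  finally show ?thesis unfolding top window by simp
qed

section \<open>Averages over one window\<close>

lemma sum_shift_le:
  fixes \<psi> :: "nat \<Rightarrow> real"
  assumes "\<And>n. 0 \<le> \<psi> n" "\<And>n. \<psi> n \<le> 1"
  shows "(\<Sum>n<K. \<psi> (n + d)) \<le> (\<Sum>n<K. \<psi> n) + real d"
proof (induction d)
  case (Suc d)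
  have "(\<Sum>n<K. \<psi> (n + Suc d)) + \<psi> d = (\<Sum>n<Suc K. \<psi> (n + d))"
    by (subst sum.lessThan_Suc_shift) simp
  also have "\<dots> = (\<Sum>n<K. \<psi> (n + d)) + \<psi> (K + d)" by simp
  finally have "(\<Sum>n<K. \<psi> (n + Suc d)) = (\<Sum>n<K. \<psi> (n + d)) + \<psi> (K + d) - \<psi> d" by linarith
  then show ?case using Suc assms(1)[of d] assms(2)[of "K + d"] unfolding of_nat_Suc by linarith
qed simp

text \<open>
  The digits between \<open>l * j\<close> and \<open>\<rho>\<close> are among the arbitrary functions of the higher digits
  that the previous cancellation tolerates.
\<close>

lemma window_product_average:
  assumes k: "k = 2 ^ m" and l: "l = 2 * m + 3" and lj: "l * j \<le> \<rho>"
  shows "(\<Sum>u\<in>boxes (2 ^ (l * j)) k. \<Prod>\<omega>\<in>Pow {..<k}. tm ((x + vertex k (\<lambda>i a. a) u \<omega>) mod 2 ^ \<rho>))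
     \<le> (2 ^ (2 * k * l) - 2) ^ j"
proof -
  let ?q = "l * j"
  let ?x = "\<lambda>u \<omega>. (x + vertex k (\<lambda>i a. a) u \<omega>)"
  have split: "tm (n mod 2 ^ \<rho>) = tm (n mod 2 ^ ?q) * tm (n div 2 ^ ?q mod 2 ^ (\<rho> - ?q))" for n
  proof -
    have p: "(2::nat) ^ \<rho> = 2 ^ ?q * 2 ^ (\<rho> - ?q)" using lj by (simp flip: power_add)
    have 1: "n mod 2 ^ \<rho> mod 2 ^ ?q = n mod 2 ^ ?q" by (simp add: p mod_mult2_eq)
    have 2: "n mod 2 ^ \<rho> div 2 ^ ?q = n div 2 ^ ?q mod 2 ^ (\<rho> - ?q)" by (simp add: p mod_mult2_eq)
    show ?thesis using tm_mod_div[of "n mod 2 ^ \<rho>" ?q] unfolding 1 2 .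
  qed
  have "\<bar>\<Sum>u\<in>boxes (2 ^ ?q) k. \<Prod>\<omega>\<in>Pow {..<k}.
      tm (?x u \<omega> mod 2 ^ ?q) *
      tm (?x u \<omega> div 2 ^ ?q mod 2 ^ (\<rho> - ?q))\<bar> \<le> (2 ^ (2 * k * l) - 2) ^ j"
    by (rule cube_cancel[OF k l, of x "\<lambda>_. x" "\<lambda>_ n. tm (n mod 2 ^ (\<rho> - ?q))"]) auto
  then show ?thesis unfolding split by linarith
qed

text \<open>
  The analytic part for one window: van der Corput turns the average into averages over cubes,
  the cubes reduce to the lowest digits, and these cancel. The points excluded in the
  reduction cost \<open>\<kappa>\<close> per digit position, and each of the \<open>2 ^ k + 1\<close> points of a cube has to
  avoid them.
\<close>

lemma thue_morse_window:
  fixes F :: "nat \<Rightarrow> real" and \<alpha> \<beta> s \<kappa> :: real and b c :: "nat \<Rightarrow> nat" and K M M0 U :: nat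
  assumes k: "k = 2 ^ m" and l: "l = 2 * m + 3" and U: "U = 2 ^ (l * j)" and lj: "l * j \<le> b 0"
    and s: "s > 0" and K: "K > 0"
    and b: "\<And>i. i < k \<Longrightarrow> b i \<le> b (Suc i)"
    and F: "\<And>n. 0 \<le> F n" "\<And>n. n \<le> K + M \<Longrightarrow> \<bar>F n - (\<beta> + n * \<alpha>)\<bar> \<le> 1 / s"
    and g: "\<And>i a. i < k \<Longrightarrow> a < U \<Longrightarrow> g i a \<le> M0" and M: "k * M0 \<le> M"
    and h1: "\<And>i a a'. i < k \<Longrightarrow> a < U \<Longrightarrow> a' < U \<Longrightarrow>
       \<exists>P::int. \<bar>(real (g i a) - real (g i a')) * \<alpha> - 2 ^ b (Suc i) * of_int P\<bar> \<le> 2 ^ b i / s"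
    and h2: "\<And>i a. i < k \<Longrightarrow> a < U \<Longrightarrow>
       \<exists>Q::int. \<bar>real (g i a) * \<alpha> - real (a + c i) - 2 ^ b 0 * of_int Q\<bar> \<le> 1 / s"
    and h3: "\<And>a a'. a < U \<Longrightarrow> a' < U \<Longrightarrow> \<bar>(real (g 0 a) - real (g 0 a')) * \<alpha>\<bar> \<le> 2 ^ b k / s"
    and few: "\<And>a. a \<in> insert 0 (b ` {..k}) \<Longrightarrow>
       real (card {n. n < K \<and> (\<exists>z::int. \<bar>F n - 2 ^ a * of_int z\<bar> \<le> (real k + 3) / s * 2 ^ a)}) \<le> \<kappa> * K"
  shows "((\<Sum>n<K. tm (nat \<lfloor>F n\<rfloor>)) / K) ^ (2 ^ k) \<le>
    (1 - 2 / 2 ^ (2 * k * l)) ^ j + 2 * (2 ^ k + 1) * ((real k + 2) * \<kappa> + M / K) + 4 * 2 ^ k * real M / real K"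
proof -
  define near where "near a n \<longleftrightarrow> (\<exists>z::int. \<bar>F n - 2 ^ a * of_int z\<bar> \<le> (real k + 3) / s * 2 ^ a)" for a n
  define bad where "bad n \<longleftrightarrow> (\<exists>a\<in>insert 0 (b ` {..k}). near a n)" for n
  define \<psi> :: "nat \<Rightarrow> real" where "\<psi> n = (if bad n then 1 else 0)" for n
  let ?w = "\<lambda>n. tm (nat \<lfloor>F n\<rfloor>)"
  let ?V = "vertex k g"
  let ?W = "\<lambda>u. (\<Sum>n<K. \<Prod>\<omega>\<in>Pow {..<k}. ?w (n + ?V u \<omega>))"
  let ?Q = "\<lambda>u n. (\<Sum>\<omega>\<in>Pow {..<k}. \<psi> (n + ?V u \<omega>))"
  define P0 where "P0 u n = (\<Prod>\<omega>\<in>Pow {..<k}. tm ((nat \<lfloor>F n\<rfloor> + (\<Sum>i<k. c i) + vertex k (\<lambda>i a. a) u \<omega>) mod 2 ^ b 0))" for u n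
  define E where "E = (real k + 2) * \<kappa> * K + real M"
  have K': "real K > 0" using K by simp
  have k0: "0 < k" by (simp add: k)
  have U0: "0 < U" by (simp add: U)
  have \<kappa>0: "0 \<le> \<kappa> * K" using few[of 0] by (rule order.trans[rotated]) auto
  have \<psi>01: "0 \<le> \<psi> n" "\<psi> n \<le> 1" for n by (auto simp: \<psi>_def)
  have count: "(\<Sum>n<K. \<psi> n) \<le> (real k + 2) * \<kappa> * K"
  proof -
    let ?I = "insert 0 (b ` {..k})"
    have "(\<Sum>n<K. \<psi> n) = real (card {n. n < K \<and> bad n})"
    proof -
      have "{n. n < K \<and> bad n} = {n \<in> {..<K}. bad n}" by auto
      then show ?thesis unfolding \<psi>_def by (simp add: sum.If_cases Int_def)
    qed
    also have "{n. n < K \<and> bad n} = (\<Union>a\<in>?I. {n. n < K \<and> near a n})" by (auto simp: bad_def)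
    also have "real (card (\<Union>a\<in>?I. {n. n < K \<and> near a n})) \<le> (\<Sum>a\<in>?I. real (card {n. n < K \<and> near a n}))"
      unfolding of_nat_sum[symmetric] of_nat_le_iff by (rule card_UN_le) simp
    also have "\<dots> \<le> (\<Sum>a\<in>?I. \<kappa> * K)"
      using few unfolding near_def by (intro sum_mono) auto
    also have "\<dots> = real (card ?I) * (\<kappa> * K)" by (rule sum_constant)
    also have "card ?I \<le> k + 2"
    proof -
      have "card ?I \<le> Suc (card (b ` {..k}))" by (rule card_insert_le_m1) auto
      also have "card (b ` {..k}) \<le> card {..k}" by (rule card_image_le) simp
      finally show ?thesis by simp
    qed
    then have "real (card ?I) * (\<kappa> * K) \<le> (real k + 2) * (\<kappa> * K)"
      using \<kappa>0 by (intro mult_right_mono) auto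
    finally show ?thesis by (simp only: mult.assoc)
  qed
  have shifted: "(\<Sum>n<K. \<psi> (n + d)) \<le> E" if "d \<le> M" for d
    using sum_shift_le[of \<psi> d K, OF \<psi>01] count that unfolding E_def by linarith
  have pointwise: "(\<Prod>\<omega>\<in>Pow {..<k}. ?w (n + ?V u \<omega>)) \<le> P0 u n + 2 * (\<psi> n + ?Q u n)"
    if u: "u \<in> boxes U k" and n: "n < K" for u n
  proof (cases "bad n \<or> (\<exists>\<omega>\<in>Pow {..<k}. bad (n + ?V u \<omega>))")
    case True
    have "\<bar>\<Prod>\<omega>\<in>Pow {..<k}. ?w (n + ?V u \<omega>)\<bar> \<le> 1" by (rule abs_prod_le_1) simp
    moreover have "\<bar>P0 u n\<bar> \<le> 1" unfolding P0_def by (rule abs_prod_le_1) simp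
    moreover have "1 \<le> \<psi> n + ?Q u n"
    proof (cases "bad n")
      case True
      have "0 \<le> ?Q u n" by (intro sum_nonneg \<psi>01)
      then show ?thesis using True by (simp add: \<psi>_def)
    next
      case False
      then obtain \<omega> where w: "\<omega> \<in> Pow {..<k}" "bad (n + ?V u \<omega>)" using True by blast
      have "\<psi> (n + ?V u \<omega>) \<le> ?Q u n"
        using w(1) by (intro member_le_sum \<psi>01) auto
      then show ?thesis using w(2) \<psi>01(1)[of n] by (simp add: \<psi>_def)
    qed
    moreover have "p \<le> P + 2 * t" if "\<bar>p\<bar> \<le> 1" "\<bar>P\<bar> \<le> 1" "1 \<le> t" for p P t :: real
      using that by linarith
    ultimately show ?thesis by blast
  next
    case False
    have "(\<Prod>\<omega>\<in>Pow {..<k}. ?w (n + ?V u \<omega>)) = P0 u n"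
      unfolding P0_def
    proof (rule cube_product_eq[where k = k and s = s and b = b and F = F and K = K and M = M and \<alpha> = \<alpha> and \<beta> = \<beta>
        and g = g and U = U and ?M0.0 = M0 and c = c and near = near and n = n and u = u, OF k0 s b F g M h1 h2 h3 near_def u n])
      show "\<not> near 0 n" using False by (auto simp: bad_def)
      show "\<not> near (b i) (n + ?V u \<omega>)" if "\<omega> \<subseteq> {..<k}" "i \<le> k" for \<omega> i
        using False that by (auto simp: bad_def)
    qed
    moreover have "0 \<le> ?Q u n" by (intro sum_nonneg \<psi>01)
    moreover have "p \<le> P + 2 * (t + r)" if "p = P" "0 \<le> r" "0 \<le> t" for p P r t :: real
      using that by simp
    ultimately show ?thesis using \<psi>01(1)[of n] by blast
  qed
  have inner: "?W u \<le> (\<Sum>n<K. P0 u n) + 2 * (2 ^ k + 1) * E"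
    if u: "u \<in> boxes U k" for u
  proof -
    have V: "?V u \<omega> \<le> M" for \<omega> using vertex_le[OF u, of g M0 \<omega>, OF g] M by linarith
    have "?W u \<le>
        (\<Sum>n<K. P0 u n + 2 * (\<psi> n + ?Q u n))"
      by (rule sum_mono) (use pointwise[OF u] in auto)
    also have "\<dots> = (\<Sum>n<K. P0 u n) + 2 * ((\<Sum>n<K. \<psi> n) + (\<Sum>\<omega>\<in>Pow {..<k}. \<Sum>n<K. \<psi> (n + ?V u \<omega>)))"
      unfolding sum.distrib sum_distrib_left[symmetric] by (subst sum.swap) (rule refl)
    also have "(\<Sum>n<K. \<psi> n) \<le> E" using shifted[of 0] by simp
    also have "(\<Sum>\<omega>\<in>Pow {..<k}. \<Sum>n<K. \<psi> (n + ?V u \<omega>)) \<le> (\<Sum>\<omega>\<in>Pow {..<k}. E)"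
      by (rule sum_mono) (rule shifted[OF V])
    also have "\<dots> = 2 ^ k * E" by (simp add: card_Pow)
    finally show ?thesis by (simp add: algebra_simps)
  qed
  let ?X = "(2 ^ (2 * k * l) - 2 :: real) ^ j"
  have "(\<Sum>u\<in>boxes U k. \<Sum>n<K. \<Prod>\<omega>\<in>Pow {..<k}. ?w (n + ?V u \<omega>)) \<le>
      (\<Sum>u\<in>boxes U k. (\<Sum>n<K. P0 u n) + 2 * (2 ^ k + 1) * E)"
    by (rule sum_mono) (rule inner)
  also have "\<dots> = (\<Sum>n<K. \<Sum>u\<in>boxes U k. P0 u n) + U ^ (2 * k) * (2 * (2 ^ k + 1) * E)"
    unfolding sum.distrib by (subst sum.swap) (simp add: card_boxes)
  also have "(\<Sum>n<K. \<Sum>u\<in>boxes U k. P0 u n) \<le> (\<Sum>n<K. ?X)"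
    unfolding P0_def U by (rule sum_mono) (rule window_product_average[OF k l lj])
  also have "\<dots> = K * ?X" by simp
  finally have tot: "(\<Sum>u\<in>boxes U k. \<Sum>n<K. \<Prod>\<omega>\<in>Pow {..<k}. ?w (n + ?V u \<omega>)) \<le>
    K * ?X + U ^ (2 * k) * (2 * (2 ^ k + 1) * E)" by simp
  have UX: "real (U ^ (2 * k)) = (2 ^ (2 * k * l)) ^ j"
  proof -
    have "l * j * (2 * k) = 2 * k * l * j" by (simp only: ac_simps)
    then show ?thesis unfolding U of_nat_power of_nat_numeral power_mult[symmetric] by (simp only:)
  qed
  have Upos: "real (U ^ (2 * k)) > 0" using U0 by simp
  have vdc: "((\<Sum>n<K. ?w n) / K) ^ (2 ^ k) \<le>
    (\<Sum>u\<in>boxes U k. ?W u / K) / U ^ (2 * k) + 4 * (2 ^ k - 1) * real M0 / K"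
    by (rule vdc_box[OF _ K U0 g]) auto
  have "(\<Sum>u\<in>boxes U k. ?W u / K) / U ^ (2 * k)
     \<le> ((K * ?X + U ^ (2 * k) * (2 * (2 ^ k + 1) * E)) / K) / U ^ (2 * k)"
    unfolding sum_divide_distrib[symmetric] using tot Upos K' by (intro divide_right_mono) auto
  also have "\<dots> = ?X / U ^ (2 * k) + 2 * (2 ^ k + 1) * E / K"
    using Upos K' by (simp add: field_simps)
  also have "?X / U ^ (2 * k) = (1 - 2 / 2 ^ (2 * k * l)) ^ j"
    unfolding UX power_divide[symmetric] by (simp add: diff_divide_distrib)
  also have "2 * (2 ^ k + 1) * E / K = 2 * (2 ^ k + 1) * ((real k + 2) * \<kappa> + M / K)"
    using K' by (simp add: E_def field_simps)
  finally have 1: "(\<Sum>u\<in>boxes U k. ?W u / K) / U ^ (2 * k)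
    \<le> (1 - 2 / 2 ^ (2 * k * l)) ^ j + 2 * (2 ^ k + 1) * ((real k + 2) * \<kappa> + M / K)" .
  have M0: "M0 \<le> M" using M k0 by (metis One_nat_def Suc_leI le_trans mult_le_mono1 nat_mult_1)
  have "4 * (2 ^ k - 1) * real M0 \<le> 4 * 2 ^ k * real M"
    by (rule mult_mono) (use M0 in auto)
  then have "4 * (2 ^ k - 1) * real M0 / K \<le> 4 * 2 ^ k * real M / real K"
    by (rule divide_right_mono) simp
  moreover have "x \<le> z + b'" if "x \<le> y + a" "y \<le> z" "a \<le> b'" for x y z a b' :: real
    using that by linarith
  ultimately show ?thesis using vdc 1 by blast
qed

section \<open>Shifts adapted to a slope\<close>

text \<open>
  Pigeonhole principle on the torus, for the pair of fractional parts of \<open>h * \<alpha> / B1\<close> and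
  \<open>h * \<alpha> / B2\<close>.
\<close>

lemma simultaneous_Dirichlet:
  fixes \<alpha> B1 B2 :: real and C1 C2 :: nat
  assumes B: "0 < B1" "0 < B2" and C: "0 < C1" "0 < C2"
  obtains h :: nat and p q :: int where "1 \<le> h" "h \<le> C1 * C2"
    "\<bar>h * \<alpha> - B1 * of_int p\<bar> \<le> B1 / C1" "\<bar>h * \<alpha> - B2 * of_int q\<bar> \<le> B2 / C2"
proof -
  define cell where "cell h = (nat \<lfloor>C1 * frac (real h * \<alpha> / B1)\<rfloor>, nat \<lfloor>C2 * frac (real h * \<alpha> / B2)\<rfloor>)" for h :: nat
  have cell_lt: "nat \<lfloor>real C * frac x\<rfloor> < C" if "0 < C" for C x
  proof -
    have "real C * frac x < real C * 1" using that frac_lt_1[of x] by (intro mult_strict_left_mono) auto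
    then have "\<lfloor>real C * frac x\<rfloor> < int C" by (simp add: floor_less_iff)
    then show ?thesis using that by (simp add: nat_less_iff)
  qed
  have "cell ` {..C1 * C2} \<subseteq> {..<C1} \<times> {..<C2}"
    using C by (auto simp: cell_def cell_lt)
  then have "card (cell ` {..C1 * C2}) \<le> card ({..<C1} \<times> {..<C2})" by (intro card_mono) auto
  also have "\<dots> < card {..C1 * C2}" by simp
  finally have "\<not> inj_on cell {..C1 * C2}" by (metis card_image nat_neq_iff)
  then obtain h1 h2 where hh: "h1 \<le> C1 * C2" "h2 \<le> C1 * C2" "h1 \<noteq> h2" "cell h1 = cell h2"
    unfolding inj_on_def by auto
  have close: "\<bar>real C * frac x - real C * frac y\<bar> < 1" if "nat \<lfloor>real C * frac x\<rfloor> = nat \<lfloor>real C * frac y\<rfloor>" for C x y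
  proof -
    have "0 \<le> real C * frac x" "0 \<le> real C * frac y" by auto
    then have "\<lfloor>real C * frac x\<rfloor> = \<lfloor>real C * frac y\<rfloor>" using that by (metis eq_nat_nat_iff zero_le_floor)
    moreover have "\<bar>a - b\<bar> < 1" if "\<lfloor>a\<rfloor> = \<lfloor>b\<rfloor>" for a b :: real
      using that by linarith
    ultimately show ?thesis by blast
  qed
  have step: "\<exists>p::int. \<bar>real (j - i) * \<alpha> - B * of_int p\<bar> \<le> B / C"
    if "0 < B" "0 < C" "i < j" "nat \<lfloor>real C * frac (real i * \<alpha> / B)\<rfloor> = nat \<lfloor>real C * frac (real j * \<alpha> / B)\<rfloor>"
    for i j C :: nat and B
  proof -
    define p where "p = \<lfloor>real j * \<alpha> / B\<rfloor> - \<lfloor>real i * \<alpha> / B\<rfloor>"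
    have "real C * (frac (real j * \<alpha> / B) - frac (real i * \<alpha> / B)) =
        real C / B * (real (j - i) * \<alpha> - B * of_int p)"
      using that by (simp add: frac_def p_def of_nat_diff field_simps)
    moreover have "\<bar>real C * (frac (real j * \<alpha> / B) - frac (real i * \<alpha> / B))\<bar> < 1"
      using close[OF that(4)] by (simp add: right_diff_distrib abs_minus_commute)
    ultimately have "real C / B * \<bar>real (j - i) * \<alpha> - B * of_int p\<bar> < 1"
      using that by (simp add: abs_mult)
    then show ?thesis using that by (intro exI[of _ p]) (simp add: field_simps)
  qed
  define i j where "i = min h1 h2" and "j = max h1 h2"
  have ij: "i < j" "j \<le> C1 * C2" "cell i = cell j" using hh by (auto simp: i_def j_def min_def max_def)
  obtain p where p: "\<bar>real (j - i) * \<alpha> - B1 * of_int p\<bar> \<le> B1 / C1"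
    using step[OF B(1) C(1) ij(1)] ij(3) by (auto simp: cell_def)
  obtain q where q: "\<bar>real (j - i) * \<alpha> - B2 * of_int q\<bar> \<le> B2 / C2"
    using step[OF B(2) C(2) ij(1)] ij(3) by (auto simp: cell_def)
  show thesis by (rule that[OF _ _ p q]) (use ij in auto)
qed

text \<open>
  Construction of the shifts in one direction from a single multiplier \<open>h\<close>. Modulo \<open>B\<close>, the
  number \<open>h * \<alpha>\<close> is tiny, so that multiples of \<open>h\<close> do not disturb the digits of a whole block.
  Modulo \<open>2 ^ \<rho>\<close> it is a step of length at most \<open>\<delta>\<close>, but at least \<open>\<epsilon>\<close>; so its first \<open>R\<close>
  multiples pass close to each of \<open>U\<close> consecutive integers. If the step is negative these
  integers are reached from above, which the constant \<open>c\<close> absorbs.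
\<close>

lemma shift_family:
  fixes \<alpha> A B W \<epsilon> \<delta> :: real and h H R U :: nat and p q :: int
  assumes h: "h \<le> H" and hp: "\<bar>h * \<alpha> - B * of_int p\<bar> \<le> A"
    and step: "\<epsilon> \<le> \<bar>h * \<alpha> - 2 ^ \<rho> * of_int q\<bar>" "\<bar>h * \<alpha> - 2 ^ \<rho> * of_int q\<bar> \<le> \<delta>"
    and \<epsilon>: "0 < \<epsilon>" and U: "U \<le> 2 ^ \<rho>" "U / \<epsilon> \<le> R"
  obtains g :: "nat \<Rightarrow> nat" and c :: nat where
    "\<And>a. a < U \<Longrightarrow> g a \<le> R * H"
    "\<And>a a'. a < U \<Longrightarrow> a' < U \<Longrightarrow> \<exists>P::int. \<bar>(real (g a) - real (g a')) * \<alpha> - B * of_int P\<bar> \<le> R * A"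
    "\<And>a. a < U \<Longrightarrow> \<exists>Q::int. \<bar>real (g a) * \<alpha> - real (a + c) - 2 ^ \<rho> * of_int Q\<bar> \<le> \<delta>"
proof -
  define \<sigma> where "\<sigma> = h * \<alpha> - 2 ^ \<rho> * of_int q"
  have \<sigma>: "\<epsilon> \<le> \<bar>\<sigma>\<bar>" "\<bar>\<sigma>\<bar> \<le> \<delta>" using step by (auto simp: \<sigma>_def)
  have floor_bound: "real (nat \<lfloor>x / t\<rfloor>) * t \<le> x \<and> x - t \<le> real (nat \<lfloor>x / t\<rfloor>) * t"
    if "0 < t" "0 \<le> x" for x t :: real
  proof -
    have "real_of_int \<lfloor>x / t\<rfloor> = real (nat \<lfloor>x / t\<rfloor>)" using that by simp
    then have "real (nat \<lfloor>x / t\<rfloor>) \<le> x / t" "x / t < real (nat \<lfloor>x / t\<rfloor>) + 1"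
      using floor_correct[of "x / t"] by linarith+
    then show ?thesis using that pos_le_divide_eq[OF that(1), of "real (nat \<lfloor>x / t\<rfloor>)" x]
        pos_divide_less_eq[OF that(1), of x "real (nat \<lfloor>x / t\<rfloor>) + 1"]
      by (simp add: algebra_simps)
  qed
  have R: "r \<le> R" if "0 < t" "\<epsilon> \<le> t" "real r * t \<le> x" "x \<le> U" for r and t x :: real
  proof -
    have "real r * \<epsilon> \<le> real r * t" using that by (intro mult_left_mono) auto
    also have "\<dots> \<le> U" using that by linarith
    finally have "real r \<le> U / \<epsilon>" using \<epsilon> by (simp add: field_simps)
    then show ?thesis using U(2) by linarith
  qed
  have "\<exists>r c. \<forall>a<U. r a \<le> R \<and> (\<exists>Q::int. \<bar>real (r a) * \<sigma> - real (a + c) - 2 ^ \<rho> * of_int Q\<bar> \<le> \<delta>)"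
  proof (cases "0 < \<sigma>")
    case True
    have "nat \<lfloor>real a / \<sigma>\<rfloor> \<le> R \<and> (\<exists>Q::int. \<bar>real (nat \<lfloor>real a / \<sigma>\<rfloor>) * \<sigma> - real (a + 0) - 2 ^ \<rho> * of_int Q\<bar> \<le> \<delta>)" if "a < U" for a
    proof
      have fb: "real (nat \<lfloor>real a / \<sigma>\<rfloor>) * \<sigma> \<le> a" "a - \<sigma> \<le> real (nat \<lfloor>real a / \<sigma>\<rfloor>) * \<sigma>"
        using floor_bound[OF True, of "real a", OF of_nat_0_le_iff] by blast+
      show "nat \<lfloor>real a / \<sigma>\<rfloor> \<le> R" using R[OF True _ fb(1)] \<sigma>(1) True that by simp
      show "\<exists>Q::int. \<bar>real (nat \<lfloor>real a / \<sigma>\<rfloor>) * \<sigma> - real (a + 0) - 2 ^ \<rho> * of_int Q\<bar> \<le> \<delta>"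
        using fb \<sigma>(2) True by (intro exI[of _ 0]) (simp add: abs_le_iff)
    qed
    then show ?thesis by (intro exI[of _ "\<lambda>a. nat \<lfloor>real a / \<sigma>\<rfloor>"] exI[of _ 0]) blast
  next
    case False
    then have t: "0 < - \<sigma>" using \<sigma>(1) \<epsilon> by linarith
    \<comment> \<open>With a negative step, the multiples have to cover the distance from \<open>U\<close> down to \<open>a\<close>.\<close>
    define r where "r a = nat \<lfloor>(real U - real a) / (- \<sigma>)\<rfloor>" for a
    have "r a \<le> R \<and> (\<exists>Q::int. \<bar>real (r a) * \<sigma> - real (a + (2 ^ \<rho> - U)) - 2 ^ \<rho> * of_int Q\<bar> \<le> \<delta>)" if "a < U" for a
    proof
      have fb: "real (r a) * (- \<sigma>) \<le> real U - real a" "real U - real a - (- \<sigma>) \<le> real (r a) * (- \<sigma>)"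
        using floor_bound[OF t, of "real U - real a"] that by (auto simp: r_def)
      show "r a \<le> R" using R[OF t _ fb(1)] \<sigma>(1) t by simp
      have "real (2 ^ \<rho> - U) = 2 ^ \<rho> - real U" using U(1) by (simp add: of_nat_diff)
      then show "\<exists>Q::int. \<bar>real (r a) * \<sigma> - real (a + (2 ^ \<rho> - U)) - 2 ^ \<rho> * of_int Q\<bar> \<le> \<delta>"
        using fb \<sigma>(2) t by (intro exI[of _ "-1"]) (simp add: abs_le_iff)
    qed
    then show ?thesis by (intro exI[of _ r] exI[of _ "2 ^ \<rho> - U"]) blast
  qed
  then obtain r :: "nat \<Rightarrow> nat" and c where r: "\<And>a. a < U \<Longrightarrow> r a \<le> R"
    and Q: "\<And>a. a < U \<Longrightarrow> \<exists>Q::int. \<bar>real (r a) * \<sigma> - real (a + c) - 2 ^ \<rho> * of_int Q\<bar> \<le> \<delta>"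
    by blast
  show thesis
  proof (rule that[of "\<lambda>a. r a * h" c])
    show "r a * h \<le> R * H" if "a < U" for a using r[OF that] h by (rule mult_le_mono)
    show "\<exists>P::int. \<bar>(real (r a * h) - real (r a' * h)) * \<alpha> - B * of_int P\<bar> \<le> R * A"
      if "a < U" "a' < U" for a a'
    proof (intro exI[of _ "(int (r a) - int (r a')) * p"])
      have "(real (r a * h) - real (r a' * h)) * \<alpha> - B * of_int ((int (r a) - int (r a')) * p) =
        (real (r a) - real (r a')) * (h * \<alpha> - B * of_int p)"
        by (simp add: algebra_simps)
      also have "\<bar>\<dots>\<bar> \<le> R * A"
        unfolding abs_mult
      proof (rule mult_mono[OF _ hp])
        show "\<bar>real (r a) - real (r a')\<bar> \<le> real R" using r[OF that(1)] r[OF that(2)] by (auto simp: abs_le_iff)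
      qed auto
      finally show "\<bar>(real (r a * h) - real (r a' * h)) * \<alpha> - B * of_int ((int (r a) - int (r a')) * p)\<bar> \<le> R * A" .
    qed
    show "\<exists>Q::int. \<bar>real (r a * h) * \<alpha> - real (a + c) - 2 ^ \<rho> * of_int Q\<bar> \<le> \<delta>" if a: "a < U" for a
    proof -
      obtain Q :: int where "\<bar>real (r a) * \<sigma> - real (a + c) - 2 ^ \<rho> * of_int Q\<bar> \<le> \<delta>" using Q[OF a] by blast
      moreover have "real (r a) * \<sigma> - real (a + c) - 2 ^ \<rho> * of_int Q =
         real (r a * h) * \<alpha> - real (a + c) - 2 ^ \<rho> * of_int (int (r a) * q + Q)"
        by (simp add: \<sigma>_def algebra_simps)
      ultimately show ?thesis by (intro exI[of _ "int (r a) * q + Q"]) simp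
    qed
  qed
qed

section \<open>Points near the multiples of a number\<close>

lemma card_int_interval: "finite {z::int. x \<le> real_of_int z \<and> real_of_int z \<le> y}"
  "x \<le> y + 1 \<Longrightarrow> real (card {z::int. x \<le> real_of_int z \<and> real_of_int z \<le> y}) \<le> y - x + 1"
proof -
  let ?Z = "{z::int. x \<le> real_of_int z \<and> real_of_int z \<le> y}"
  have eq: "?Z = {\<lceil>x\<rceil>..\<lfloor>y\<rfloor>}"
    by (auto simp: ceiling_le_iff le_floor_iff)
  show "finite ?Z" unfolding eq by simp
  assume xy: "x \<le> y + 1"
  have "real (card {\<lceil>x\<rceil>..\<lfloor>y\<rfloor>}) = max 0 (of_int \<lfloor>y\<rfloor> - of_int \<lceil>x\<rceil> + 1)"
    by (simp add: max_def)
  also have "\<dots> \<le> y - x + 1"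
    using xy le_of_int_ceiling[of x] of_int_floor_le[of y] by linarith
  finally show "real (card ?Z) \<le> y - x + 1" unfolding eq .
qed

lemma card_nat_interval:
  assumes "\<And>r. r \<in> S \<Longrightarrow> x \<le> real r \<and> real r \<le> y" "x \<le> y + 1"
  shows "finite S" "real (card S) \<le> y - x + 1"
proof -
  let ?Z = "{z::int. x \<le> real_of_int z \<and> real_of_int z \<le> y}"
  have sub: "int ` S \<subseteq> ?Z" using assms(1) by auto
  then have "finite (int ` S)" using card_int_interval(1) finite_subset by blast
  then show "finite S" by (simp add: finite_image_iff)
  have "card S = card (int ` S)" by (simp add: card_image)
  also have "\<dots> \<le> card ?Z" using sub card_int_interval(1) by (rule card_mono[rotated])
  finally show "real (card S) \<le> y - x + 1" using card_int_interval(2)[OF assms(2)] by linarith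
qed

text \<open>
  The progression moves through an interval of length \<open>T * \<bar>\<eta>\<bar>\<close> in steps of length \<open>\<bar>\<eta>\<bar>\<close>:
  count the integers it can meet, and the terms near each of them.
\<close>

lemma card_progression_near:
  fixes \<gamma> \<eta> W :: real and T :: nat
  assumes \<eta>: "\<eta> \<noteq> 0" and W: "0 \<le> W"
  shows "real (card {r. r < T \<and> (\<exists>z::int. \<bar>\<gamma> + real r * \<eta> - of_int z\<bar> \<le> W)})
     \<le> (T * \<bar>\<eta>\<bar> + 2 * W + 1) * (2 * W / \<bar>\<eta>\<bar> + 1)"
proof -
  let ?N = "{r. r < T \<and> (\<exists>z::int. \<bar>\<gamma> + real r * \<eta> - of_int z\<bar> \<le> W)}"
  define lo where "lo = min \<gamma> (\<gamma> + T * \<eta>)"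
  let ?Z = "{z::int. lo - W \<le> of_int z \<and> of_int z \<le> lo + T * \<bar>\<eta>\<bar> + W}"
  let ?S = "\<lambda>z::int. {r. r < T \<and> \<bar>\<gamma> + real r * \<eta> - of_int z\<bar> \<le> W}"
  have sub: "?N \<subseteq> (\<Union>z\<in>?Z. ?S z)"
  proof clarify
    fix r and z :: int assume r: "r < T" "\<bar>\<gamma> + real r * \<eta> - of_int z\<bar> \<le> W"
    have "lo \<le> \<gamma> + real r * \<eta>" "\<gamma> + real r * \<eta> \<le> lo + T * \<bar>\<eta>\<bar>"
    proof -
      have "0 \<le> \<eta> \<Longrightarrow> real r * \<eta> \<le> T * \<eta>" "0 \<le> \<eta> \<Longrightarrow> 0 \<le> real r * \<eta>" "0 \<le> \<eta> \<Longrightarrow> 0 \<le> T * \<eta>"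
        "\<eta> \<le> 0 \<Longrightarrow> T * \<eta> \<le> 0" "\<eta> \<le> 0 \<Longrightarrow> T * \<eta> \<le> real r * \<eta>" "\<eta> \<le> 0 \<Longrightarrow> real r * \<eta> \<le> 0"
        using r(1) by (auto intro: mult_right_mono mult_right_mono_neg mult_nonneg_nonpos)
      then have "lo \<le> \<gamma> + real r * \<eta> \<and> \<gamma> + real r * \<eta> \<le> lo + T * \<bar>\<eta>\<bar>"
        unfolding lo_def by (cases "0 \<le> \<eta>") (simp_all add: min_def abs_if)
      then show "lo \<le> \<gamma> + real r * \<eta>" "\<gamma> + real r * \<eta> \<le> lo + T * \<bar>\<eta>\<bar>" by auto
    qed
    then have "z \<in> ?Z" using r(2) by (auto simp: abs_le_iff)
    then show "r \<in> (\<Union>z\<in>?Z. ?S z)" using r by blast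
  qed
  have S: "finite (?S z)" "real (card (?S z)) \<le> 2 * W / \<bar>\<eta>\<bar> + 1" for z
  proof -
    have in_int: "(of_int z - \<gamma>) / \<eta> - W / \<bar>\<eta>\<bar> \<le> real r \<and> real r \<le> (of_int z - \<gamma>) / \<eta> + W / \<bar>\<eta>\<bar>" if "r \<in> ?S z" for r
    proof -
      have "\<gamma> + real r * \<eta> - of_int z = \<eta> * (real r - (of_int z - \<gamma>) / \<eta>)" using \<eta> by (simp add: field_simps)
      then have "\<bar>\<eta>\<bar> * \<bar>real r - (of_int z - \<gamma>) / \<eta>\<bar> \<le> W" using that by (simp add: abs_mult)
      then have "\<bar>real r - (of_int z - \<gamma>) / \<eta>\<bar> \<le> W / \<bar>\<eta>\<bar>" using \<eta> by (simp add: field_simps)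
      then show ?thesis by (auto simp: abs_le_iff)
    qed
    have W': "0 \<le> W / \<bar>\<eta>\<bar>" using W by simp
    show "finite (?S z)" by simp
    have "real (card (?S z)) \<le> ((of_int z - \<gamma>) / \<eta> + W / \<bar>\<eta>\<bar>) - ((of_int z - \<gamma>) / \<eta> - W / \<bar>\<eta>\<bar>) + 1"
      by (rule card_nat_interval(2)[OF in_int]) (use W' in auto)
    then show "real (card (?S z)) \<le> 2 * W / \<bar>\<eta>\<bar> + 1" by simp
  qed
  have fZ: "finite ?Z" by (rule card_int_interval)
  have "card ?N \<le> card (\<Union>z\<in>?Z. ?S z)"
    using sub fZ S(1) by (intro card_mono) auto
  also have "\<dots> \<le> (\<Sum>z\<in>?Z. card (?S z))" by (rule card_UN_le[OF fZ])
  finally have "real (card ?N) \<le> (\<Sum>z\<in>?Z. real (card (?S z)))"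
    by (simp flip: of_nat_sum)
  also have "\<dots> \<le> (\<Sum>z\<in>?Z. 2 * W / \<bar>\<eta>\<bar> + 1)" by (rule sum_mono) (rule S(2))
  also have "\<dots> = real (card ?Z) * (2 * W / \<bar>\<eta>\<bar> + 1)" by simp
  also have "real (card ?Z) \<le> (lo + T * \<bar>\<eta>\<bar> + W) - (lo - W) + 1"
    by (rule card_int_interval(2)) (use W in auto)
  then have "real (card ?Z) * (2 * W / \<bar>\<eta>\<bar> + 1) \<le> (T * \<bar>\<eta>\<bar> + 2 * W + 1) * (2 * W / \<bar>\<eta>\<bar> + 1)"
    using W by (intro mult_right_mono) auto
  finally show ?thesis .
qed

text \<open>
  An almost linear sequence is rarely close to multiples of \<open>B\<close>, provided that no small
  multiple of the slope is too close to one. By Dirichlet's theorem some \<open>q \<le> s\<close> makes \<open>q * \<alpha>\<close>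
  nearly a multiple of \<open>B\<close>; along each residue class modulo \<open>q\<close> the sequence then drifts
  slowly, but by the nondegeneracy assumption not too slowly, through the residues modulo \<open>B\<close>.
\<close>

lemma near_count:
  fixes F :: "nat \<Rightarrow> real" and \<alpha> \<beta> B \<eta>0 :: real and s K k :: nat
  assumes s: "2 * k + 8 \<le> s" and B: "1 \<le> B" and \<eta>0: "0 < \<eta>0"
    and F: "\<And>n. n < K \<Longrightarrow> \<bar>F n - (\<beta> + n * \<alpha>)\<bar> \<le> 1 / real s"
    and nondeg: "\<And>(q::nat) (p::int). 1 \<le> q \<Longrightarrow> q \<le> s \<Longrightarrow> \<eta>0 * B \<le> \<bar>q * \<alpha> - B * of_int p\<bar>"
    and K: "real s ^ 2 / \<eta>0 \<le> K"
  shows "real (card {n. n < K \<and> (\<exists>z::int. \<bar>F n - B * of_int z\<bar> \<le> (real k + 3) / s * B)}) \<le> (4 * real k + 22) / s * K"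
proof -
  let ?N = "{n. n < K \<and> (\<exists>z::int. \<bar>F n - B * of_int z\<bar> \<le> (real k + 3) / s * B)}"
  have s0: "0 < s" using s by simp
  obtain q :: nat and p p' :: int where q: "1 \<le> q" "q \<le> s * 1"
    and p: "\<bar>q * \<alpha> - B * of_int p\<bar> \<le> B / real s"
    by (rule simultaneous_Dirichlet[of B 1 s 1 \<alpha>]) (use B s0 in auto)
  have qs: "q \<le> s" using q by simp
  define \<eta> where "\<eta> = (q * \<alpha> - B * of_int p) / B"
  have B0: "0 < B" using B by simp
  have \<eta>l: "\<eta>0 \<le> \<bar>\<eta>\<bar>" using nondeg[OF q(1) qs, of p] B0 by (simp add: \<eta>_def field_simps)
  have \<eta>u: "\<bar>\<eta>\<bar> \<le> 1 / s" using p B0 s0 by (simp add: \<eta>_def field_simps)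
  have \<eta>: "\<eta> \<noteq> 0" using \<eta>l \<eta>0 by auto
  define W where "W = (real k + 4) / s"
  have W0: "0 \<le> W" by (simp add: W_def)
  have W1: "2 * W \<le> 1" using s s0 by (simp add: W_def divide_simps)
  define T where "T = K div q + 1"
  let ?R = "\<lambda>i. {r. r < T \<and> (\<exists>z::int. \<bar>(\<beta> + real i * \<alpha>) / B + real r * \<eta> - of_int z\<bar> \<le> W)}"
  have sub: "?N \<subseteq> (\<Union>i<q. (\<lambda>r. i + r * q) ` ?R i)"
  proof clarify
    fix n and z :: int assume n: "n < K" and z: "\<bar>F n - B * of_int z\<bar> \<le> (real k + 3) / s * B"
    define i r where "i = n mod q" and "r = n div q"
    have nir: "n = i + r * q" by (simp add: i_def r_def)
    have "\<bar>\<beta> + n * \<alpha> - B * of_int z\<bar> \<le> 1 / s + (real k + 3) / s * B"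
      using F[OF n] z by linarith
    also have "1 / s \<le> 1 / s * B" using B s0 by (simp add: field_simps)
    also have "1 / s * B + (real k + 3) / s * B = W * B" by (simp add: W_def add_divide_distrib algebra_simps)
    finally have 1: "\<bar>\<beta> + n * \<alpha> - B * of_int z\<bar> \<le> W * B" by simp
    have "\<beta> + n * \<alpha> - B * of_int z = B * ((\<beta> + real i * \<alpha>) / B + real r * \<eta> - of_int (z - int r * p))"
      using B0 by (simp add: nir \<eta>_def field_simps)
    then have "B * \<bar>(\<beta> + real i * \<alpha>) / B + real r * \<eta> - of_int (z - int r * p)\<bar> \<le> B * W"
      using 1 B0 by (simp add: abs_mult mult.commute)
    then have "\<bar>(\<beta> + real i * \<alpha>) / B + real r * \<eta> - of_int (z - int r * p)\<bar> \<le> W"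
      using B0 by simp
    moreover have "r < T" using n by (simp add: r_def T_def div_le_mono less_Suc_eq_le)
    ultimately have "r \<in> ?R i" by blast
    moreover have "i < q" using q by (simp add: i_def)
    ultimately show "n \<in> (\<Union>i<q. (\<lambda>r. i + r * q) ` ?R i)" using nir by blast
  qed
  have "card ?N \<le> card (\<Union>i<q. (\<lambda>r. i + r * q) ` ?R i)"
    using sub by (intro card_mono) auto
  also have "\<dots> \<le> (\<Sum>i<q. card ((\<lambda>r. i + r * q) ` ?R i))" by (rule card_UN_le) simp
  also have "\<dots> \<le> (\<Sum>i<q. card (?R i))" by (rule sum_mono) (rule card_image_le, simp)
  finally have "real (card ?N) \<le> (\<Sum>i<q. real (card (?R i)))"
    by (simp flip: of_nat_sum)
  also have "\<dots> \<le> (\<Sum>i<q. (T * \<bar>\<eta>\<bar> + 2 * W + 1) * (2 * W / \<bar>\<eta>\<bar> + 1))"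
    by (rule sum_mono) (rule card_progression_near[OF \<eta> W0])
  also have "\<dots> = q * ((T * \<bar>\<eta>\<bar> + 2 * W + 1) * (2 * W / \<bar>\<eta>\<bar> + 1))" by simp
  finally have c1: "real (card ?N)
     \<le> q * ((T * \<bar>\<eta>\<bar> + 2 * W + 1) * (2 * W / \<bar>\<eta>\<bar> + 1))" .
  have q0: "0 < real q" using q by simp
  have s1: "1 \<le> real s" using s0 by simp
  have \<eta>01: "\<eta>0 \<le> 1 / s" using \<eta>l \<eta>u by linarith
  have \<eta>0s: "\<eta>0 * s \<le> 1" using \<eta>01 s0 by (simp add: field_simps)
  have sK: "real s / \<eta>0 \<le> K / s" using K \<eta>0 s0 by (simp add: field_simps power2_eq_square)
  have sK': "real s \<le> K / s"
  proof -
    have "\<eta>0 \<le> 1" using \<eta>0s s1 \<eta>0 by (smt (verit) mult_le_cancel_left1)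
    then have "real s \<le> real s / \<eta>0" using \<eta>0 s0 by (simp add: field_simps)
    then show ?thesis using sK by linarith
  qed
  have "real s \<le> K"
  proof -
    have "K / s \<le> real K / 1" using s1 by (intro divide_left_mono) auto
    then show ?thesis using sK' by simp
  qed
  then have qK: "real q \<le> K" using qs by linarith
  have "real (K div q) \<le> K / q" by (rule of_nat_div_le_of_nat)
  then have "real T \<le> K / q + 1" by (simp add: T_def)
  also have "\<dots> \<le> 2 * K / q" using qK q0 by (simp add: field_simps)
  finally have T: "real T \<le> 2 * K / q" .
  have \<eta>p: "0 < \<bar>\<eta>\<bar>" using \<eta> by simp
  have "q * ((T * \<bar>\<eta>\<bar> + 2 * W + 1) * (2 * W / \<bar>\<eta>\<bar> + 1)) \<le> q * ((2 * K / q * \<bar>\<eta>\<bar> + 2) * (2 * W / \<bar>\<eta>\<bar> + 1))"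
  proof (intro mult_left_mono mult_right_mono)
    have "real T * \<bar>\<eta>\<bar> \<le> 2 * K / q * \<bar>\<eta>\<bar>" using T by (rule mult_right_mono) simp
    then show "T * \<bar>\<eta>\<bar> + 2 * W + 1 \<le> 2 * K / q * \<bar>\<eta>\<bar> + 2" using W1 by linarith
  qed (use W0 in auto)
  also have "\<dots> = 4 * real K * W + 2 * real K * \<bar>\<eta>\<bar> + 2 * real q * (2 * W) * (1 / \<bar>\<eta>\<bar>) + 2 * real q"
    using q0 \<eta>p by (simp add: field_simps)
  also have "2 * real q * (2 * W) * (1 / \<bar>\<eta>\<bar>) \<le> 2 * real s * 1 * (1 / \<eta>0)"
  proof (rule mult_mono)
    show "2 * real q * (2 * W) \<le> 2 * real s * 1" by (rule mult_mono) (use qs W1 W0 in auto)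
    show "1 / \<bar>\<eta>\<bar> \<le> 1 / \<eta>0" using \<eta>l \<eta>0 \<eta>p by (intro divide_left_mono) auto
  qed auto
  also have "2 * real s * 1 * (1 / \<eta>0) = 2 * (s / \<eta>0)" by simp
  also have "2 * (s / \<eta>0) \<le> 2 * (K / s)" using sK by simp
  also have "2 * real q \<le> 2 * (K / s)" using sK' qs by simp
  also have "2 * real K * \<bar>\<eta>\<bar> \<le> 2 * real K * (1 / s)" using \<eta>u by (intro mult_left_mono) auto
  also have "4 * real K * W + 2 * real K * (1 / s) + 2 * (K / s) + 2 * (K / s) = (4 * real k + 22) / s * K"
    using s0 by (simp add: W_def field_simps)
  finally show ?thesis using c1 by linarith
qed

section \<open>Counting degenerate slopes\<close>

lemma card_gapped_near:
  fixes d :: "nat \<Rightarrow> real"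
  assumes gap: "\<And>i j. i \<in> I \<Longrightarrow> j \<in> I \<Longrightarrow> i \<le> j \<Longrightarrow> \<mu> * (real j - real i) \<le> d j - d i" and \<mu>: "0 < \<mu>"
    and fin: "finite I" and w: "0 \<le> w"
  shows "real (card {n \<in> I. \<bar>d n - y\<bar> \<le> w}) \<le> 2 * w / \<mu> + 1"
proof (cases "{n \<in> I. \<bar>d n - y\<bar> \<le> w} = {}")
  case True
  show ?thesis unfolding True using w \<mu> by simp
next
  case False
  let ?S = "{n \<in> I. \<bar>d n - y\<bar> \<le> w}"
  define a where "a = Min ?S"
  have fS: "finite ?S" using fin by simp
  have a: "a \<in> ?S" unfolding a_def using fS False by (rule Min_in)
  have "real a \<le> real n \<and> real n \<le> real a + 2 * w / \<mu>" if n: "n \<in> ?S" for n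
  proof -
    have an: "a \<le> n" unfolding a_def using fS n by (rule Min_le)
    have "\<mu> * (real n - real a) \<le> d n - d a" using gap[of a n] a n an by auto
    also have "\<dots> \<le> 2 * w" using a n by (auto simp: abs_le_iff)
    finally have "real n - real a \<le> 2 * w / \<mu>" using \<mu> by (simp add: field_simps)
    then show ?thesis using an by simp
  qed
  then have "real (card ?S) \<le> (real a + 2 * w / \<mu>) - real a + 1"
    by (rule card_nat_interval(2)) (use w \<mu> in auto)
  then show ?thesis by simp
qed

text \<open>
  Counting indices by the derivative: as \<open>d\<close> increases by at least \<open>\<mu>\<close> per step, few of its
  values fall into a short interval. The factor \<open>real h\<close> in the bound for \<open>card (Y h)\<close>
  balances the width \<open>e / h\<close> of the intervals.
\<close>

lemma card_multiples_near:
  fixes d :: "nat \<Rightarrow> real" and Y :: "nat \<Rightarrow> real set"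
  assumes gap: "\<And>i j. i \<in> I \<Longrightarrow> j \<in> I \<Longrightarrow> i \<le> j \<Longrightarrow> \<mu> * (real j - real i) \<le> d j - d i" and \<mu>: "0 < \<mu>"
    and fin: "finite I" and e: "0 \<le> e"
    and Y: "\<And>h. finite (Y h)" "\<And>h. real (card (Y h)) \<le> V * real h"
  shows "real (card {n \<in> I. \<exists>h. 1 \<le> h \<and> h \<le> H \<and> (\<exists>y\<in>Y h. \<bar>real h * d n - y\<bar> \<le> e)}) \<le> V * (2 * e * H / \<mu> + real H ^ 2)"
proof -
  let ?N = "{n \<in> I. \<exists>h. 1 \<le> h \<and> h \<le> H \<and> (\<exists>y\<in>Y h. \<bar>real h * d n - y\<bar> \<le> e)}"
  let ?S = "\<lambda>h y. {n \<in> I. \<bar>d n - y / real h\<bar> \<le> e / real h}"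
  have V: "0 \<le> V" using Y(2)[of 1] by (simp add: order.trans[rotated])
  have sub: "?N \<subseteq> (\<Union>h\<in>{1..H}. \<Union>y\<in>Y h. ?S h y)"
  proof clarify
    fix n h y assume n: "n \<in> I" "1 \<le> h" "h \<le> H" "y \<in> Y h" "\<bar>real h * d n - y\<bar> \<le> e"
    have "real h * d n - y = real h * (d n - y / real h)" using n by (simp add: field_simps)
    then have "real h * \<bar>d n - y / real h\<bar> \<le> e" using n by (simp add: abs_mult)
    then have "\<bar>d n - y / real h\<bar> \<le> e / real h" using n by (simp add: field_simps)
    then show "n \<in> (\<Union>h\<in>{1..H}. \<Union>y\<in>Y h. ?S h y)" using n by auto
  qed
  have inner: "real (card (\<Union>y\<in>Y h. ?S h y)) \<le> V * (2 * e / \<mu> + H)" if h: "h \<in> {1..H}" for h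
  proof -
    have h0: "0 < real h" using h by simp
    have "card (\<Union>y\<in>Y h. ?S h y) \<le> (\<Sum>y\<in>Y h. card (?S h y))" by (rule card_UN_le[OF Y(1)])
    then have "real (card (\<Union>y\<in>Y h. ?S h y)) \<le> (\<Sum>y\<in>Y h. real (card (?S h y)))"
      by (simp flip: of_nat_sum)
    also have "\<dots> \<le> (\<Sum>y\<in>Y h. 2 * (e / h) / \<mu> + 1)"
      by (rule sum_mono) (rule card_gapped_near[OF gap \<mu> fin], use e h0 in auto)
    also have "\<dots> = real (card (Y h)) * (2 * (e / h) / \<mu> + 1)" by simp
    also have "\<dots> \<le> V * h * (2 * (e / h) / \<mu> + 1)"
      using Y(2) e \<mu> h0 by (intro mult_right_mono) auto
    also have "\<dots> = V * (2 * e / \<mu> + h)" using h0 \<mu> by (simp add: field_simps)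
    also have "\<dots> \<le> V * (2 * e / \<mu> + H)" using V h by (intro mult_left_mono) auto
    finally show ?thesis .
  qed
  have "card ?N \<le> card (\<Union>h\<in>{1..H}. \<Union>y\<in>Y h. ?S h y)"
    using sub fin Y(1) by (intro card_mono) auto
  also have "\<dots> \<le> (\<Sum>h\<in>{1..H}. card (\<Union>y\<in>Y h. ?S h y))" by (rule card_UN_le) simp
  finally have "real (card ?N) \<le> (\<Sum>h\<in>{1..H}. real (card (\<Union>y\<in>Y h. ?S h y)))"
    by (simp flip: of_nat_sum)
  also have "\<dots> \<le> (\<Sum>h\<in>{1..H}. V * (2 * e / \<mu> + H))" by (rule sum_mono) (rule inner)
  also have "\<dots> = V * (2 * e * H / \<mu> + real H ^ 2)" by (simp add: power2_eq_square algebra_simps)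
  finally show ?thesis .
qed

lemma card_pos_multiples:
  fixes B x :: real
  assumes "0 < B" "0 \<le> x"
  shows "finite {p::int. 1 \<le> p \<and> B * of_int p \<le> x}" "real (card {p::int. 1 \<le> p \<and> B * of_int p \<le> x}) \<le> x / B"
proof -
  have eq: "{p::int. 1 \<le> p \<and> B * of_int p \<le> x} = {p. 1 \<le> real_of_int p \<and> real_of_int p \<le> x / B}"
    using assms(1) by (auto simp: field_simps)
  show "finite {p::int. 1 \<le> p \<and> B * of_int p \<le> x}" unfolding eq by (rule card_int_interval)
  show "real (card {p::int. 1 \<le> p \<and> B * of_int p \<le> x}) \<le> x / B"
    unfolding eq using card_int_interval(2)[of 1 "x / B"] assms by simp
qed

text \<open>
  As \<open>e < D1\<close>, the multiple \<open>0\<close> cannot occur. The number of candidates is therefore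
  proportional to \<open>D2 / B\<close>, even when \<open>B\<close> is much larger than \<open>D2\<close>.
\<close>

lemma card_multiple_near_lattice:
  fixes d :: "nat \<Rightarrow> real"
  assumes gap: "\<And>i j. i \<in> I \<Longrightarrow> j \<in> I \<Longrightarrow> i \<le> j \<Longrightarrow> \<mu> * (real j - real i) \<le> d j - d i" and \<mu>: "0 < \<mu>"
    and fin: "finite I" and d: "\<And>n. n \<in> I \<Longrightarrow> D1 \<le> d n \<and> d n \<le> D2" and e: "0 \<le> e" "e < D1" and B: "0 < B" and D0: "0 \<le> D2"
  shows "real (card {n \<in> I. \<exists>h. 1 \<le> h \<and> h \<le> H \<and> (\<exists>p::int. \<bar>real h * d n - B * of_int p\<bar> \<le> e)})
     \<le> 2 * D2 / B * (2 * e * H / \<mu> + real H ^ 2)"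
proof (cases "I = {}")
  case True
  show ?thesis unfolding True using D0 e B \<mu> by simp
next
  case False
  then obtain n0 where "n0 \<in> I" by blast
  then have D: "D1 \<le> D2" using d by force
  let ?N = "{n \<in> I. \<exists>h. 1 \<le> h \<and> h \<le> H \<and> (\<exists>p::int. \<bar>real h * d n - B * of_int p\<bar> \<le> e)}"
  define Y where "Y h = (\<lambda>p::int. B * of_int p) ` {p. 1 \<le> p \<and> B * of_int p \<le> 2 * real h * D2}" for h :: nat
  have D2: "0 < D2" using e D by linarith
  let ?M = "{n \<in> I. \<exists>h. 1 \<le> h \<and> h \<le> H \<and> (\<exists>y\<in>Y h. \<bar>real h * d n - y\<bar> \<le> e)}"
  have Y: "finite (Y h)" "real (card (Y h)) \<le> 2 * D2 / B * real h" for h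
  proof -
    have x: "0 \<le> 2 * real h * D2" using D2 by simp
    show "finite (Y h)" unfolding Y_def by (intro finite_imageI card_pos_multiples(1)[OF B x])
    have "real (card (Y h)) \<le> real (card {p::int. 1 \<le> p \<and> B * of_int p \<le> 2 * real h * D2})"
      unfolding Y_def of_nat_le_iff by (intro card_image_le card_pos_multiples(1)[OF B x])
    also have "\<dots> \<le> 2 * real h * D2 / B" by (rule card_pos_multiples(2)[OF B x])
    finally show "real (card (Y h)) \<le> 2 * D2 / B * real h" by (simp add: algebra_simps)
  qed
  have "?N \<subseteq>
        ?M"
  proof clarify
    fix n h and p :: int assume n: "n \<in> I" "1 \<le> h" "h \<le> H" "\<bar>real h * d n - B * of_int p\<bar> \<le> e"
    have h1: "1 \<le> real h" using n by simp
    have "D1 \<le> d n" "d n \<le> D2" using d n by auto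
    have "1 * D1 \<le> real h * d n" using h1 \<open>D1 \<le> d n\<close> e by (intro mult_mono) auto
    then have "0 < B * of_int p" using n e by linarith
    then have p1: "1 \<le> p" using B by (simp add: zero_less_mult_iff)
    have "real h * d n \<le> real h * D2" using \<open>d n \<le> D2\<close> by (rule mult_left_mono) simp
    moreover have "1 * D2 \<le> real h * D2" using h1 D2 by (intro mult_right_mono) auto
    ultimately have "B * of_int p \<le> 2 * real h * D2" using n(4) e D by linarith
    then have "B * of_int p \<in> Y h" using p1 unfolding Y_def by blast
    then show "\<exists>h\<ge>1. h \<le> H \<and> (\<exists>y\<in>Y h. \<bar>real h * d n - y\<bar> \<le> e)" using n by blast
  qed
  then have "card ?N \<le>
        card ?M"
    using fin by (intro card_mono) auto
  also have "real \<dots> \<le> 2 * D2 / B * (2 * e * H / \<mu> + real H ^ 2)"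
    by (rule card_multiples_near[OF gap \<mu> fin e(1) Y])
  finally show ?thesis by simp
qed

text \<open>
  Both conditions together are rarer than each of them alone. This saves the factor that is
  lost by the number \<open>H\<close> of possible multipliers, and it is the reason why the exceptional set
  for the shifts of a block is small.
\<close>

lemma card_multiple_near_two_lattices:
  fixes d :: "nat \<Rightarrow> real"
  assumes gap: "\<And>i j. i \<in> I \<Longrightarrow> j \<in> I \<Longrightarrow> i \<le> j \<Longrightarrow> \<mu> * (real j - real i) \<le> d j - d i" and \<mu>: "0 < \<mu>"
    and fin: "finite I" and d: "\<And>n. n \<in> I \<Longrightarrow> D1 \<le> d n \<and> d n \<le> D2" and e: "0 \<le> e" "e \<le> A" "A < D1"
    and B: "0 < B" and G: "0 < G" "G \<le> A" and D: "0 \<le> D2"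
  shows "real (card {n \<in> I. \<exists>h. 1 \<le> h \<and> h \<le> H \<and> (\<exists>p q::int. \<bar>real h * d n - B * of_int p\<bar> \<le> A \<and> \<bar>real h * d n - G * of_int q\<bar> \<le> e)})
     \<le> 10 * D2 * A / (B * G) * (2 * e * H / \<mu> + real H ^ 2)"
proof (cases "I = {}")
  case True
  show ?thesis unfolding True using D e B G \<mu> by simp
next
  case False
  then obtain n0 where "n0 \<in> I" by blast
  then have D12: "D1 \<le> D2" using d by force
  let ?N = "{n \<in> I. \<exists>h. 1 \<le> h \<and> h \<le> H \<and> (\<exists>p q::int. \<bar>real h * d n - B * of_int p\<bar> \<le> A \<and> \<bar>real h * d n - G * of_int q\<bar> \<le> e)}"
  define P where "P h = {p::int. 1 \<le> p \<and> B * of_int p \<le> 2 * real h * D2}" for h :: nat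
  define Q where "Q p = {q::int. (B * of_int p - 2 * A) / G \<le> of_int q \<and> of_int q \<le> (B * of_int p + 2 * A) / G}" for p :: int
  define Y where "Y h = (\<lambda>q::int. G * of_int q) ` (\<Union>p\<in>P h. Q p)" for h :: nat
  have D2: "0 < D2" using e D12 by linarith
  have A0: "0 < A" using G by linarith
  let ?M = "{n \<in> I. \<exists>h. 1 \<le> h \<and> h \<le> H \<and> (\<exists>y\<in>Y h. \<bar>real h * d n - y\<bar> \<le> e)}"
  have Q: "finite (Q p)" "real (card (Q p)) \<le> 5 * A / G" for p
  proof -
    show "finite (Q p)" unfolding Q_def by (rule card_int_interval)
    have le: "(B * of_int p - 2 * A) / G \<le> (B * of_int p + 2 * A) / G + 1"
      using A0 G by (simp add: field_simps)
    have "real (card (Q p)) \<le> (B * of_int p + 2 * A) / G - (B * of_int p - 2 * A) / G + 1"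
      unfolding Q_def by (rule card_int_interval(2)[OF le])
    also have "\<dots> = 4 * A / G + 1" using G by (simp add: field_simps)
    also have "1 \<le> A / G" using G by simp
    finally show "real (card (Q p)) \<le> 5 * A / G" by simp
  qed
  have Y: "finite (Y h)" "real (card (Y h)) \<le> 10 * D2 * A / (B * G) * real h" for h
  proof -
    have x: "0 \<le> 2 * real h * D2" using D2 by simp
    have fP: "finite (P h)" unfolding P_def by (rule card_pos_multiples(1)[OF B x])
    show "finite (Y h)" unfolding Y_def by (intro finite_imageI finite_UN_I fP Q(1))
    have "card (Y h) \<le> card (\<Union>p\<in>P h. Q p)"
      unfolding Y_def by (intro card_image_le finite_UN_I fP Q(1))
    also have "\<dots> \<le> (\<Sum>p\<in>P h. card (Q p))" by (rule card_UN_le[OF fP])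
    finally have "real (card (Y h)) \<le> (\<Sum>p\<in>P h. real (card (Q p)))" by (simp flip: of_nat_sum)
    also have "\<dots> \<le> (\<Sum>p\<in>P h. 5 * A / G)" by (rule sum_mono) (rule Q(2))
    also have "\<dots> = real (card (P h)) * (5 * A / G)" by simp
    also have "\<dots> \<le> (2 * real h * D2 / B) * (5 * A / G)"
      using card_pos_multiples(2)[OF B x] A0 G unfolding P_def by (intro mult_right_mono) auto
    finally show "real (card (Y h)) \<le> 10 * D2 * A / (B * G) * real h" by (simp add: algebra_simps)
  qed
  have "?N \<subseteq>
        ?M"
  proof clarify
    fix n h and p q :: int
    assume n: "n \<in> I" "1 \<le> h" "h \<le> H" "\<bar>real h * d n - B * of_int p\<bar> \<le> A" "\<bar>real h * d n - G * of_int q\<bar> \<le> e"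
    have h1: "1 \<le> real h" using n by simp
    have "D1 \<le> d n" "d n \<le> D2" using d n by auto
    have "1 * D1 \<le> real h * d n" using h1 \<open>D1 \<le> d n\<close> e by (intro mult_mono) auto
    then have "0 < B * of_int p" using n e by linarith
    then have p1: "1 \<le> p" using B by (simp add: zero_less_mult_iff)
    have "real h * d n \<le> real h * D2" using \<open>d n \<le> D2\<close> by (rule mult_left_mono) simp
    moreover have "1 * D2 \<le> real h * D2" using h1 D2 by (intro mult_right_mono) auto
    ultimately have "B * of_int p \<le> 2 * real h * D2" using n(4) e D12 by linarith
    then have "p \<in> P h" using p1 unfolding P_def by blast
    have "B * of_int p - 2 * A \<le> G * of_int q" "G * of_int q \<le> B * of_int p + 2 * A"
      using n(4,5) e by (auto simp: abs_le_iff)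
    then have "q \<in> Q p" unfolding Q_def using G by (simp add: pos_divide_le_eq pos_le_divide_eq mult.commute)
    then have "G * of_int q \<in> Y h" unfolding Y_def using \<open>p \<in> P h\<close> by blast
    then show "\<exists>h\<ge>1. h \<le> H \<and> (\<exists>y\<in>Y h. \<bar>real h * d n - y\<bar> \<le> e)" using n by blast
  qed
  then have "card ?N \<le>
        card ?M"
    using fin by (intro card_mono) auto
  also have "real \<dots> \<le> 10 * D2 * A / (B * G) * (2 * e * H / \<mu> + real H ^ 2)"
    by (rule card_multiples_near[OF gap \<mu> fin e(1) Y])
  finally show ?thesis by simp
qed

section \<open>Generic slopes\<close>

text \<open>
  The positions at which the digits are cut, in units of \<open>\<sigma> = log 2 S\<close>: a window of \<open>4 * \<sigma>\<close>
  digits, a first block of \<open>5 * \<sigma>\<close>, and blocks of \<open>20 * \<sigma>\<close> digits. The first block is the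
  shortest one, as its shifts must also keep the digits above the last block unchanged.
\<close>

definition cut :: "nat \<Rightarrow> nat" where
  "cut i = (if i = 0 then 4 else 20 * i - 11)"

text \<open>
  The window estimate with all parameters expressed by powers of \<open>S\<close>. The hypotheses \<open>G1\<close>,
  \<open>T1\<close>, \<open>T2\<close> say that the slope \<open>\<alpha>\<close> is generic: \<open>G1\<close> feeds \<open>near_count\<close>, while \<open>T1\<close> and \<open>T2\<close>
  forbid degenerate steps in \<open>shift_family\<close> for the first block and for the later blocks. For
  the first block the window and the block are adjacent, so that being small modulo \<open>S ^ 9\<close>
  already makes the step modulo \<open>S ^ 4\<close> small; for the later blocks the two moduli have to be
  treated simultaneously. The shifts are at most \<open>S ^ 34\<close>, short compared with the window
  length \<open>S ^ 36\<close>.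
\<close>

lemma window_bound:
  fixes F :: "nat \<Rightarrow> real" and \<alpha> \<beta> S :: real and s k m l j :: nat
  assumes k: "k = 2 ^ m" and l: "l = 2 * m + 3" and s: "s = 2 ^ (l * j)" and ks: "2 * k + 8 \<le> s" and S: "S = real s"
    and \<alpha>: "0 < \<alpha>" "\<alpha> * S ^ 15 \<le> S ^ cut k"
    and F: "\<And>n. 0 \<le> F n" "\<And>n. n \<le> s ^ 36 + k * s ^ 34 \<Longrightarrow> \<bar>F n - (\<beta> + n * \<alpha>)\<bar> \<le> 1 / S"
    and G1: "\<And>a (q::nat) (p::int). a \<in> insert 0 (cut ` {..k}) \<Longrightarrow> 1 \<le> q \<Longrightarrow> q \<le> s \<Longrightarrow>
       S ^ a / S ^ 20 \<le> \<bar>q * \<alpha> - S ^ a * of_int p\<bar>"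
    and T1: "\<And>(h::nat) (p::int). 1 \<le> h \<Longrightarrow> h \<le> s ^ 10 \<Longrightarrow> 1 / S ^ 3 \<le> \<bar>h * \<alpha> - S ^ 9 * of_int p\<bar>"
    and T2: "\<And>i (h::nat) (p::int) (q::int). 1 \<le> i \<Longrightarrow> i < k \<Longrightarrow> 1 \<le> h \<Longrightarrow> h \<le> s ^ 30 \<Longrightarrow>
       \<bar>h * \<alpha> - S ^ cut (Suc i) * of_int p\<bar> \<le> S ^ cut i / S ^ 5 \<Longrightarrow> 1 / S ^ 3 \<le> \<bar>h * \<alpha> - S ^ 4 * of_int q\<bar>"
  shows "((\<Sum>n<s ^ 36. tm (nat \<lfloor>F n\<rfloor>)) / real (s ^ 36)) ^ (2 ^ k) \<le>
    (1 - 2 / 2 ^ (2 * k * l)) ^ j +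
      (2 * (2 ^ k + 1) * ((real k + 2) * (4 * real k + 22) + real k) + 4 * 2 ^ k * real k) / S"
proof -
  define b where "b i = l * j * cut i" for i
  have S1: "1 \<le> S" using ks by (simp add: S)
  have S0: "0 < S" using S1 by simp
  have s0: "0 < s" using ks by simp
  have k0: "0 < k" by (simp add: k)
  have pow: "2 ^ (l * j * n) = S ^ n" for n :: nat
    by (simp add: S s power_mult)
  have pb: "2 ^ b i = S ^ cut i" for i by (simp only: b_def pow)
  have Sn: "S ^ n = real (s ^ n)" for n by (simp add: S)
  have cuts: "cut 0 = 4" "cut (Suc 0) = 9" "1 \<le> i \<Longrightarrow> cut (Suc i) = cut i + 20" for i
    by (auto simp: cut_def)
  have U4: "s \<le> 2 ^ (l * j * 4)" unfolding s by (rule power_increasing) auto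
  have eps: "real s / (1 / S ^ 3) \<le> real (s ^ 4)" by (simp add: S power4_eq_xxxx power3_eq_cube)
  have eps0: "0 < 1 / S ^ 3" using S0 by simp
  \<comment> \<open>The shifts for each block. Only those for the first block must be bounded by \<open>s ^ 14\<close>, as
      they are the ones that leave the top digits alone.\<close>
  have ex: "\<exists>g c. (\<forall>a<s. g a \<le> s ^ 34) \<and>
      (\<forall>a<s. \<forall>a'<s. \<exists>P::int. \<bar>(real (g a) - real (g a')) * \<alpha> - 2 ^ b (Suc i) * of_int P\<bar> \<le> 2 ^ b i / S) \<and>
      (\<forall>a<s. \<exists>Q::int. \<bar>real (g a) * \<alpha> - real (a + c) - 2 ^ b 0 * of_int Q\<bar> \<le> 1 / S) \<and>
      (i = 0 \<longrightarrow> (\<forall>a<s. g a \<le> s ^ 14))" if i: "i < k" for i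
  proof (cases "i = 0")
    case True
    \<comment> \<open>The modulus \<open>1\<close>, with a single cell, reduces this to the classical theorem.\<close>
    obtain h :: nat and p q :: int where h: "1 \<le> h" "h \<le> s ^ 10 * 1" and p: "\<bar>h * \<alpha> - S ^ 9 * of_int p\<bar> \<le> S ^ 9 / real (s ^ 10)"
      by (rule simultaneous_Dirichlet[of "S ^ 9" 1 "s ^ 10" 1 \<alpha>]) (use S0 s0 in auto)
    have S10: "S ^ 10 = S ^ 9 * S" by (simp flip: power_Suc2)
    have "S ^ 9 / real (s ^ 10) = 1 / S" unfolding Sn[symmetric] S10 using S0 by simp
    then have p': "\<bar>h * \<alpha> - S ^ 9 * of_int p\<bar> \<le> 1 / S" using p by simp
    have e9: "S ^ 9 * of_int p = 2 ^ (l * j * 4) * of_int (2 ^ (l * j * 5) * p)"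
    proof -
      have "S ^ 9 = S ^ 4 * S ^ 5" by (simp flip: power_add)
      then show ?thesis by (simp add: pow)
    qed
    obtain g c where g: "\<And>a. a < s \<Longrightarrow> g a \<le> s ^ 4 * s ^ 10"
      "\<And>a a'. a < s \<Longrightarrow> a' < s \<Longrightarrow> \<exists>P::int. \<bar>(real (g a) - real (g a')) * \<alpha> - S ^ 9 * of_int P\<bar> \<le> real (s ^ 4) * (1 / S)"
      "\<And>a. a < s \<Longrightarrow> \<exists>Q::int. \<bar>real (g a) * \<alpha> - real (a + c) - 2 ^ (l * j * 4) * of_int Q\<bar> \<le> 1 / S"
    proof (rule shift_family[of h "s ^ 10" \<alpha> "S ^ 9" p "1 / S" "1 / S ^ 3" "l * j * 4" "2 ^ (l * j * 5) * p" "1 / S" s "s ^ 4"])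
      show "h \<le> s ^ 10" using h by simp
      show "1 / S ^ 3 \<le> \<bar>real h * \<alpha> - 2 ^ (l * j * 4) * of_int (2 ^ (l * j * 5) * p)\<bar>"
        unfolding e9[symmetric] using T1 h by simp
      show "\<bar>real h * \<alpha> - 2 ^ (l * j * 4) * of_int (2 ^ (l * j * 5) * p)\<bar> \<le> 1 / S"
        unfolding e9[symmetric] by (rule p')
    qed (use p' eps0 U4 eps in auto)
    have "s ^ 4 * s ^ 10 = s ^ 14" by (simp flip: power_add)
    moreover have "s ^ 14 \<le> s ^ 34" using s0 by (intro power_increasing) auto
    ultimately have g14: "g a \<le> s ^ 14" "g a \<le> s ^ 34" if "a < s" for a using g(1)[OF that] by auto
    show ?thesis
      using g14 g(2,3) True by (intro exI[of _ g] exI[of _ c]) (simp add: pb cuts pow S)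
  next
    case False
    then have i1: "1 \<le> i" by simp
    let ?B = "S ^ cut (Suc i)" and ?A = "S ^ cut i / S ^ 5"
    have B: "?B = ?A * S ^ 25"
    proof -
      have "?B = S ^ cut i * S ^ 20" by (simp only: cuts(3)[OF i1] power_add)
      moreover have "S ^ 20 = S ^ 25 / S ^ 5" using power_diff[of S 5 25] S0 by simp
      ultimately show ?thesis by simp
    qed
    obtain h :: nat and p q :: int where h: "1 \<le> h" "h \<le> s ^ 25 * s ^ 5"
      and p: "\<bar>h * \<alpha> - ?B * of_int p\<bar> \<le> ?B / real (s ^ 25)"
      and q: "\<bar>h * \<alpha> - S ^ 4 * of_int q\<bar> \<le> S ^ 4 / real (s ^ 5)"
      by (rule simultaneous_Dirichlet[of ?B "S ^ 4" "s ^ 25" "s ^ 5" \<alpha>]) (use S0 s0 in auto)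
    have "s ^ 25 * s ^ 5 = s ^ 30" by (simp flip: power_add)
    then have h30: "h \<le> s ^ 30" using h by simp
    have "?B / real (s ^ 25) = ?A" unfolding Sn[symmetric] B
      by (rule nonzero_mult_div_cancel_right) (use S0 in simp)
    then have p': "\<bar>h * \<alpha> - ?B * of_int p\<bar> \<le> ?A" using p by simp
    have S5: "S ^ 5 = S ^ 4 * S" by (simp flip: power_Suc2)
    have "S ^ 4 / real (s ^ 5) = 1 / S" unfolding Sn[symmetric] S5 using S0 by simp
    then have q': "\<bar>h * \<alpha> - S ^ 4 * of_int q\<bar> \<le> 1 / S" using q by simp
    obtain g c where g: "\<And>a. a < s \<Longrightarrow> g a \<le> s ^ 4 * s ^ 30"
      "\<And>a a'. a < s \<Longrightarrow> a' < s \<Longrightarrow> \<exists>P::int. \<bar>(real (g a) - real (g a')) * \<alpha> - ?B * of_int P\<bar> \<le> real (s ^ 4) * ?A"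
      "\<And>a. a < s \<Longrightarrow> \<exists>Q::int. \<bar>real (g a) * \<alpha> - real (a + c) - 2 ^ (l * j * 4) * of_int Q\<bar> \<le> 1 / S"
    proof (rule shift_family[of h "s ^ 30" \<alpha> ?B p ?A "1 / S ^ 3" "l * j * 4" q "1 / S" s "s ^ 4"])
      show "1 / S ^ 3 \<le> \<bar>real h * \<alpha> - 2 ^ (l * j * 4) * of_int q\<bar>"
        unfolding pow by (rule T2[OF i1 i h(1) h30 p'])
      show "\<bar>real h * \<alpha> - 2 ^ (l * j * 4) * of_int q\<bar> \<le> 1 / S"
        unfolding pow by (rule q')
    qed (use h30 p' eps0 U4 eps in auto)
    have "s ^ 4 * s ^ 30 = s ^ 34" by (simp flip: power_add)
    then have g34: "g a \<le> s ^ 34" if "a < s" for a using g(1)[OF that] by simp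
    have RA: "real (s ^ 4) * ?A = S ^ cut i / S" unfolding Sn[symmetric] S5 using S0 by simp
    show ?thesis
      using g34 g(2)[unfolded RA] g(3) False by (intro exI[of _ g] exI[of _ c]) (simp add: pb cuts pow)
  qed
  have "\<forall>i. \<exists>gc. i < k \<longrightarrow> (\<forall>a<s. fst gc a \<le> s ^ 34) \<and>
      (\<forall>a<s. \<forall>a'<s. \<exists>P::int. \<bar>(real (fst gc a) - real (fst gc a')) * \<alpha> - 2 ^ b (Suc i) * of_int P\<bar> \<le> 2 ^ b i / S) \<and>
      (\<forall>a<s. \<exists>Q::int. \<bar>real (fst gc a) * \<alpha> - real (a + snd gc) - 2 ^ b 0 * of_int Q\<bar> \<le> 1 / S) \<and>
      (i = 0 \<longrightarrow> (\<forall>a<s. fst gc a \<le> s ^ 14))"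
    (is "\<forall>i. \<exists>gc. i < k \<longrightarrow> ?P i (fst gc) (snd gc)")
  proof
    fix i
    show "\<exists>gc. i < k \<longrightarrow> ?P i (fst gc) (snd gc)"
    proof (cases "i < k")
      case True
      then obtain g c where "?P i g c" using ex by blast
      then have "?P i (fst (g, c)) (snd (g, c))" by (simp only: fst_conv snd_conv)
      then show ?thesis by blast
    qed blast
  qed
  from choice[OF this] obtain gc where gc: "\<And>i. i < k \<Longrightarrow> ?P i (fst (gc i)) (snd (gc i))" by blast
  define g c where "g i = fst (gc i)" and "c i = snd (gc i)" for i
  have few: "real (card {n. n < s ^ 36 \<and> (\<exists>z::int. \<bar>F n - 2 ^ a * of_int z\<bar> \<le> (real k + 3) / S * 2 ^ a)})
     \<le> (4 * real k + 22) / S * real (s ^ 36)" if a: "a \<in> insert 0 (b ` {..k})" for a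
  proof -
    obtain a' where a': "a = l * j * a'" "a' \<in> insert 0 (cut ` {..k})"
    proof (cases "a = 0")
      case True
      then show thesis by (intro that[of 0]) auto
    next
      case False
      then obtain i where "i \<le> k" "a = b i" using a by auto
      then show thesis by (intro that[of "cut i"]) (auto simp: b_def)
    qed
    have "real s ^ 2 / (1 / S ^ 20) \<le> real (s ^ 36)"
    proof -
      have "real s ^ 2 / (1 / S ^ 20) = S ^ 22" by (simp add: S flip: power_add)
      also have "\<dots> \<le> S ^ 36" using S1 by (intro power_increasing) auto
      finally show ?thesis by (simp add: Sn)
    qed
    moreover have "1 \<le> S ^ a'" using S1 by (rule one_le_power)
    moreover have "\<bar>F n - (\<beta> + n * \<alpha>)\<bar> \<le> 1 / real s" if "n < s ^ 36" for n
      using F(2)[of n] that by (simp add: S)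
    moreover have "1 / S ^ 20 * S ^ a' \<le> \<bar>q * \<alpha> - S ^ a' * of_int p\<bar>" if "1 \<le> q" "q \<le> s" for q :: nat and p :: int
      using G1[OF a'(2) that, of p] by simp
    ultimately have "real (card {n. n < s ^ 36 \<and> (\<exists>z::int. \<bar>F n - S ^ a' * of_int z\<bar> \<le> (real k + 3) / real s * S ^ a')})
       \<le> (4 * real k + 22) / real s * real (s ^ 36)"
      using ks S0 by (intro near_count[where \<alpha> = \<alpha> and \<beta> = \<beta> and ?\<eta>0.0 = "1 / S ^ 20"]) auto
    then show ?thesis unfolding a'(1) pow S .
  qed
  have main: "((\<Sum>n<s ^ 36. tm (nat \<lfloor>F n\<rfloor>)) / real (s ^ 36)) ^ (2 ^ k) \<le>
    (1 - 2 / 2 ^ (2 * k * l)) ^ j + 2 * (2 ^ k + 1) * ((real k + 2) * ((4 * real k + 22) / S) + real (k * s ^ 34) / real (s ^ 36)) + 4 * 2 ^ k * real (k * s ^ 34) / real (s ^ 36)"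
  proof (rule thue_morse_window[where m = m and b = b and g = g and c = c and \<alpha> = \<alpha> and \<beta> = \<beta> and s = S and U = s and ?M0.0 = "s ^ 34" and \<kappa> = "(4 * real k + 22) / S"])
    show "k = 2 ^ m" "l = 2 * m + 3" "s = 2 ^ (l * j)" by fact+
    show "l * j \<le> b 0" by (simp add: b_def cuts)
    show "S > 0" by (rule S0)
    show "s ^ 36 > 0" using s0 by simp
    show "b i \<le> b (Suc i)" for i by (auto simp: b_def cut_def)
    show "0 \<le> F n" for n by (rule F)
    show "\<bar>F n - (\<beta> + real n * \<alpha>)\<bar> \<le> 1 / S" if "n \<le> s ^ 36 + k * s ^ 34" for n by (rule F(2)[OF that])
    show "g i a \<le> s ^ 34" if "i < k" "a < s" for i a using gc[OF that(1)] that by (simp add: g_def)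
    show "\<exists>P::int. \<bar>(real (g i a) - real (g i a')) * \<alpha> - 2 ^ b (Suc i) * of_int P\<bar> \<le> 2 ^ b i / S"
      if "i < k" "a < s" "a' < s" for i a a' using gc[OF that(1)] that unfolding g_def by blast
    show "\<exists>Q::int. \<bar>real (g i a) * \<alpha> - real (a + c i) - 2 ^ b 0 * of_int Q\<bar> \<le> 1 / S"
      if "i < k" "a < s" for i a using gc[OF that(1)] that unfolding g_def c_def by blast
    show "\<bar>(real (g 0 a) - real (g 0 a')) * \<alpha>\<bar> \<le> 2 ^ b k / S" if "a < s" "a' < s" for a a'
    proof -
      have "g 0 a \<le> s ^ 14" "g 0 a' \<le> s ^ 14" using gc[OF k0] that by (auto simp: g_def)
      then have "real (g 0 a) \<le> real (s ^ 14)" "real (g 0 a') \<le> real (s ^ 14)" by (simp_all only: of_nat_le_iff)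
      then have le: "\<bar>real (g 0 a) - real (g 0 a')\<bar> \<le> S ^ 14" unfolding Sn by (auto simp: abs_le_iff simp del: of_nat_power)
      have "\<bar>(real (g 0 a) - real (g 0 a')) * \<alpha>\<bar> \<le> S ^ 14 * \<alpha>"
        unfolding abs_mult using le \<alpha> by (intro mult_mono) auto
      also have "\<dots> \<le> S ^ cut k / S"
      proof -
        have "S ^ 15 = S ^ 14 * S" by (simp flip: power_Suc2)
        then have "S ^ 14 * \<alpha> * S \<le> S ^ cut k" using \<alpha>(2) by (simp add: algebra_simps)
        then show ?thesis using S0 by (simp only: pos_le_divide_eq)
      qed
      finally show ?thesis unfolding pb .
    qed
  qed (use few in auto)
  have MK: "real (k * s ^ 34) / real (s ^ 36) \<le> real k / S"
  proof -
    have S36: "S ^ 36 = S ^ 34 * S * S" by (simp flip: power_Suc2)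
    have "real (k * s ^ 34) / real (s ^ 36) = real k / S / S"
      unfolding of_nat_mult Sn[symmetric] S36 using S0 by simp
    also have "\<dots> \<le> real k / S / 1" using S1 S0 by (intro divide_left_mono) auto
    finally show ?thesis by simp
  qed
  have 2: "4 * 2 ^ k * real (k * s ^ 34) / real (s ^ 36) \<le> 4 * 2 ^ k * (real k / S)"
    using mult_left_mono[OF MK, of "4 * 2 ^ k"] by simp
  have "2 * (2 ^ k + 1) * ((real k + 2) * ((4 * real k + 22) / S) + real (k * s ^ 34) / real (s ^ 36))
     \<le> 2 * (2 ^ k + 1) * ((real k + 2) * ((4 * real k + 22) / S) + real k / S)"
    using MK by (intro mult_left_mono add_left_mono) auto
  moreover have "2 * (2 ^ k + 1) * ((real k + 2) * ((4 * real k + 22) / S) + real k / S) + 4 * 2 ^ k * (real k / S) =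
     (2 * (2 ^ k + 1) * ((real k + 2) * (4 * real k + 22) + real k) + 4 * 2 ^ k * real k) / S"
    by (simp add: add_divide_distrib distrib_left)
  ultimately show ?thesis using main 2 by linarith
qed

section \<open>The function \<open>n powr c\<close> on a dyadic block\<close>

lemma powr_mean_value:
  fixes c a b :: real
  assumes "0 < a" "a \<le> b"
  obtains z where "a \<le> z" "z \<le> b" "b powr c - a powr c = (b - a) * (c * z powr (c - 1))"
proof (cases "a = b")
  case True
  then show thesis by (intro that[of a]) auto
next
  case False
  then have "a < b" using assms by simp
  then have "\<exists>z>a. z < b \<and> b powr c - a powr c = (b - a) * (c * z powr (c - 1))"
  proof (rule MVT2)
    fix x assume "a \<le> x" "x \<le> b"
    then show "((\<lambda>x. x powr c) has_real_derivative c * x powr (c - 1)) (at x)"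
      using assms by (intro has_real_derivative_powr) auto
  qed
  then show thesis using that by (metis less_imp_le)
qed

text \<open>
  Two applications of the mean value theorem; \<open>c < 2\<close> makes the second derivative decrease, so
  that it is largest at the left end point.
\<close>

lemma powr_linear_approx:
  fixes c x t :: real
  assumes c: "1 < c" "c < 2" and x: "0 < x" and t: "0 \<le> t"
  shows "\<bar>(x + t) powr c - (x powr c + t * (c * x powr (c - 1)))\<bar> \<le> 2 * t\<^sup>2 * x powr (c - 2)"
proof -
  obtain y where y: "x \<le> y" "y \<le> x + t" and e1: "(x + t) powr c - x powr c = (x + t - x) * (c * y powr (c - 1))"
    using powr_mean_value[of x "x + t" c] x t by auto
  obtain z where z: "x \<le> z" "z \<le> y" and e2: "y powr (c - 1) - x powr (c - 1) = (y - x) * ((c - 1) * z powr (c - 1 - 1))"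
    using powr_mean_value[of x y "c - 1"] x y by auto
  have "(x + t) powr c - (x powr c + t * (c * x powr (c - 1))) = t * c * (y powr (c - 1) - x powr (c - 1))"
    using e1 by (simp add: algebra_simps)
  also have "\<dots> = t * c * ((y - x) * ((c - 1) * z powr (c - 2)))"
    unfolding e2 by (simp add: algebra_simps)
  finally have eq: "(x + t) powr c - (x powr c + t * (c * x powr (c - 1))) = (c * (c - 1)) * (t * (y - x)) * z powr (c - 2)"
    by (simp add: algebra_simps)
  have "c * (c - 1) \<le> 2 * 1" using c by (intro mult_mono) auto
  moreover have "t * (y - x) \<le> t * t" using y t by (intro mult_left_mono) auto
  moreover have "z powr (c - 2) \<le> x powr (c - 2)" using z x c by (intro powr_mono2') auto
  ultimately have "(c * (c - 1)) * (t * (y - x)) * z powr (c - 2) \<le> 2 * 1 * (t * t) * x powr (c - 2)"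
    using c t y by (intro mult_mono) auto
  moreover have "0 \<le> (c * (c - 1)) * (t * (y - x)) * z powr (c - 2)" using c t y by simp
  ultimately show ?thesis unfolding eq by (simp add: power2_eq_square)
qed

lemma derivative_range:
  fixes c :: real and N n :: nat
  assumes c: "1 < c" "c < 2" and N: "1 \<le> N" "N \<le> n" "n \<le> 2 * N"
  shows "N powr (c - 1) \<le> c * n powr (c - 1)" "c * n powr (c - 1) \<le> 4 * N powr (c - 1)"
proof -
  have "1 * N powr (c - 1) \<le> c * n powr (c - 1)"
    using c N by (intro mult_mono powr_mono2) auto
  then show "N powr (c - 1) \<le> c * n powr (c - 1)" by simp
  have "real n powr (c - 1) \<le> (2 * real N) powr (c - 1)" using c N by (intro powr_mono2) auto
  also have "\<dots> = 2 powr (c - 1) * N powr (c - 1)" by (simp add: powr_mult)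
  also have "2 powr (c - 1) \<le> 2 powr (1::real)" using c by (intro powr_mono) auto
  finally have "real n powr (c - 1) \<le> 2 * N powr (c - 1)" by (simp add: mult_right_mono)
  then have "c * n powr (c - 1) \<le> 2 * (2 * N powr (c - 1))" using c by (intro mult_mono) auto
  then show "c * n powr (c - 1) \<le> 4 * N powr (c - 1)" by simp
qed

lemma derivative_gap:
  fixes c :: real and N i j :: nat
  assumes c: "1 < c" "c < 2" and N: "1 \<le> N" "N \<le> i" "i \<le> j" "j \<le> 2 * N"
  shows "(c - 1) / 2 * N powr (c - 2) * (real j - real i) \<le> c * j powr (c - 1) - c * i powr (c - 1)"
proof -
  obtain z where z: "real i \<le> z" "z \<le> real j" and e: "real j powr (c - 1) - real i powr (c - 1) = (real j - real i) * ((c - 1) * z powr (c - 1 - 1))"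
    using powr_mean_value[of "real i" "real j" "c - 1"] N by auto
  have z0: "0 < z" using z N by linarith
  have "(1 / 2) * N powr (c - 2) \<le> 2 powr (c - 2) * N powr (c - 2)"
  proof (rule mult_right_mono)
    have "2 powr (-1::real) \<le> 2 powr (c - 2)" using c by (intro powr_mono) auto
    then show "1 / 2 \<le> 2 powr (c - 2)" by (simp add: powr_minus_divide)
  qed simp
  also have "\<dots> = (2 * N) powr (c - 2)" by (simp add: powr_mult)
  also have "\<dots> \<le> z powr (c - 2)" using z z0 N c by (intro powr_mono2') auto
  finally have zz: "(1 / 2) * N powr (c - 2) \<le> z powr (c - 2)" .
  have "(c - 1) / 2 * N powr (c - 2) * (real j - real i) = 1 * ((real j - real i) * ((c - 1) * ((1 / 2) * N powr (c - 2))))" by simp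
  also have "\<dots> \<le> c * ((real j - real i) * ((c - 1) * z powr (c - 2)))"
    using c N zz by (intro mult_mono mult_left_mono) auto
  also have "\<dots> = c * (real j powr (c - 1) - real i powr (c - 1))" unfolding e by simp
  also have "\<dots> = c * j powr (c - 1) - c * i powr (c - 1)" by (simp add: algebra_simps)
  finally show ?thesis .
qed

lemma cut_mono: "i \<le> j \<Longrightarrow> cut i \<le> cut j"
  by (auto simp: cut_def)

text \<open>
  Replacing each term by the average over the window that starts at it costs only a boundary
  term. Overlapping windows avoid any partition of the block, and every starting point may
  have its own slope.
\<close>

lemma sum_le_sum_windows:
  fixes z :: "nat \<Rightarrow> real" and K n :: nat
  assumes z: "\<And>n. \<bar>z n\<bar> \<le> 1" and K: "0 < K" and NN: "N \<le> N'"
  shows "\<bar>\<Sum>n\<in>{N..<N'}. z n\<bar> \<le> (\<Sum>n\<in>{N..<N'}. \<bar>(\<Sum>i<K. z (n + i)) / K\<bar>) + 2 * real K"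
proof -
  let ?I = "{N..<N'}"
  let ?D = "\<lambda>i. (\<Sum>n\<in>?I. z n) - (\<Sum>n\<in>?I. z (n + i))"
  have shift: "\<bar>?D i\<bar> \<le> 2 * real i" for i
  proof -
    have re: "(\<Sum>n\<in>?I. f n) = (\<Sum>n<N' - N. f (N + n))" for f :: "nat \<Rightarrow> real"
      using sum.shift_bounds_nat_ivl[of f 0 N "N' - N"] NN by (simp add: lessThan_atLeast0 add.commute)
    show ?thesis unfolding re using sum_shift_diff[of "\<lambda>n. z (N + n)" "N' - N" i] z by (simp add: add.assoc)
  qed
  have eq: "(\<Sum>n\<in>?I. z n) * K = (\<Sum>i<K. ?D i) + (\<Sum>i<K. \<Sum>n\<in>?I. z (n + i))"
    by (simp add: sum_subtractf)
  have 1: "\<bar>\<Sum>i<K. ?D i\<bar> \<le> (\<Sum>i<K. 2 * real K)"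
  proof (rule order.trans[OF sum_abs sum_mono])
    fix i assume "i \<in> {..<K}"
    then have "2 * real i \<le> 2 * real K" by simp
    then show "\<bar>?D i\<bar> \<le> 2 * real K"
      by (rule order.trans[OF shift])
  qed
  have 2: "\<bar>\<Sum>i<K. \<Sum>n\<in>?I. z (n + i)\<bar> \<le> (\<Sum>n\<in>?I. \<bar>\<Sum>i<K. z (n + i)\<bar>)"
    by (subst sum.swap) (rule sum_abs)
  have "\<bar>(\<Sum>n\<in>?I. z n) * K\<bar> \<le> (\<Sum>i<K. 2 * real K) + (\<Sum>n\<in>?I. \<bar>\<Sum>i<K. z (n + i)\<bar>)"
    unfolding eq by (rule order.trans[OF abs_triangle_ineq add_mono[OF 1 2]])
  then have "\<bar>\<Sum>n\<in>?I. z n\<bar> * K \<le> (\<Sum>n\<in>?I. \<bar>\<Sum>i<K. z (n + i)\<bar>) + 2 * K * K"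
    by (simp add: abs_mult)
  then have "\<bar>\<Sum>n\<in>?I. z n\<bar> \<le> ((\<Sum>n\<in>?I. \<bar>\<Sum>i<K. z (n + i)\<bar>) + 2 * K * K) / K"
    using K by (simp add: pos_le_divide_eq)
  also have "\<dots> = (\<Sum>n\<in>?I. \<bar>(\<Sum>i<K. z (n + i)) / K\<bar>) + 2 * real K"
    using K by (simp add: add_divide_distrib sum_divide_distrib[where A = "?I"])
  finally show ?thesis by simp
qed

text \<open>
  One dyadic block. Starting points whose derivative \<open>d n\<close> is not generic are discarded; the
  counting lemmas bound their number by a multiple of \<open>N / S\<close>. At every other starting point
  the window estimate applies, because \<open>big\<close> makes the curvature negligible over a window.
\<close>

lemma block_bound:
  fixes c S :: real and N N' s k m l j :: nat
  assumes c: "1 < c" "c < 2"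
    and k: "k = 2 ^ m" and l: "l = 2 * m + 3" and s: "s = 2 ^ (l * j)" and ks: "2 * k + 8 \<le> s" and S: "S = real s"
    and N: "1 \<le> N" "N \<le> N'" "N' \<le> 2 * N"
    and lo: "4 * N powr (c - 1) * S ^ 15 \<le> S ^ cut k" and hi: "S ^ cut k \<le> N powr (c - 1) * S ^ 18"
    and big: "8 * S ^ 73 \<le> N powr (2 - c)"
  shows "\<bar>\<Sum>n\<in>{N..<N'}. tm (nat \<lfloor>real n powr c\<rfloor>)\<bar> \<le> real N *
    ((2 * real k + 3) * (160 / (c - 1) + 40) / S +
      ((1 - 2 / 2 ^ (2 * k * l)) ^ j +
        (2 * (2 ^ k + 1) * ((real k + 2) * (4 * real k + 22) + real k) + 4 * 2 ^ k * real k) / S) powr (1 / 2 ^ k)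
      + 2 / S)"
proof -
  let ?P = "insert 0 (cut ` {..k})"
  define d where "d n = c * real n powr (c - 1)" for n :: nat
  define D where "D = N powr (c - 1)"
  define \<mu> where "\<mu> = (c - 1) / 2 * N powr (c - 2)"
  define X where "X = (160 / (c - 1) + 40) * N / S"
  define E where "E = (1 - 2 / 2 ^ (2 * k * l)) ^ j +
        (2 * (2 ^ k + 1) * ((real k + 2) * (4 * real k + 22) + real k) + 4 * 2 ^ k * real k) / S"
  define z where "z n = tm (nat \<lfloor>real n powr c\<rfloor>)" for n
  define A where "A n = (\<Sum>i<s ^ 36. z (n + i)) / real (s ^ 36)" for n
  let ?I = "{N..<N'}"
  let ?w = "(8 / (c - 1) * N / S)"
  have S1: "1 < S" using ks by (simp add: S)
  have S0: "0 < S" using S1 by simp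
  have s0: "0 < s" using ks by simp
  have k0: "0 < k" by (simp add: k)
  have N0: "0 < real N" using N by simp
  have D0: "0 < D" using N0 by (simp add: D_def)
  have \<mu>0: "0 < \<mu>" using c N0 by (simp add: \<mu>_def)
  have S73: "S ^ 73 = S ^ 72 * S" by (simp flip: power_Suc2)
  have ND: "N = D * N powr (2 - c)"
  proof -
    have "D * N powr (2 - c) = N powr (c - 1 + (2 - c))" unfolding D_def powr_add ..
    then show ?thesis using N0 by simp
  qed
  \<comment> \<open>Smallness of the curvature also means that the slope is smaller than \<open>N\<close> by a large power
      of \<open>S\<close>. This absorbs the terms \<open>H\<^sup>2\<close> of the counting lemmas, which come from one point for
      each interval.\<close>
  have DN: "D * (8 * S ^ 73) \<le> N" using mult_left_mono[OF big, of D] D0 ND by simp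
  have D\<mu>: "4 * D / \<mu> = 8 / (c - 1) * N"
  proof -
    have "N powr (c - 2) * N = N powr (c - 2) * N powr 1" using N0 by simp
    also have "\<dots> = N powr (c - 2 + 1)" by (simp only: powr_add)
    finally have "N powr (c - 2) * N = D" by (simp add: D_def)
    moreover have "4 * (t * x) / ((c - 1) / 2 * t) = 8 / (c - 1) * x" if "0 < t" for t x :: real
      using that c by (simp add: divide_simps)
    then have "4 * (N powr (c - 2) * N) / ((c - 1) / 2 * N powr (c - 2)) = 8 / (c - 1) * N" using N0 by simp
    ultimately show ?thesis by (simp only: \<mu>_def)
  qed
  have DS: "8 * D * S ^ p \<le> N / S" if "p \<le> 72" for p
  proof -
    have "8 * D * S ^ p \<le> 8 * D * S ^ 72" using that S1 D0 by (intro mult_left_mono power_increasing) auto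
    moreover have "8 * D * S ^ 72 * S = D * (8 * S ^ 73)" by (simp add: S73)
    ultimately have "8 * D * S ^ p * S \<le> D * (8 * S ^ 73)" using S0 by (metis mult_right_mono less_imp_le)
    then show ?thesis using DN S0 by (simp add: pos_le_divide_eq)
  qed
  have NS: "N / S ^ p \<le> N / S" if "1 \<le> p" for p
  proof -
    have "S ^ 1 \<le> S ^ p" using that S1 by (intro power_increasing) auto
    then show ?thesis using S0 N0 by (intro divide_left_mono) auto
  qed
  have gap: "\<mu> * (real i' - real i) \<le> d i' - d i" if "i \<in> ?I" "i' \<in> ?I" "i \<le> i'" for i i'
    unfolding d_def \<mu>_def using c N that by (intro derivative_gap) auto
  have dr: "D \<le> d n \<and> d n \<le> 4 * D" if "n \<in> ?I" for n
    unfolding d_def D_def using derivative_range[OF c, of N n] N that by auto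
  have cutS: "S ^ cut i \<le> S ^ cut k" if "i \<le> k" for i
    using S1 by (intro power_increasing cut_mono that) auto
  define BG where "BG a = {n \<in> ?I. \<exists>h. 1 \<le> h \<and> h \<le> s \<and> (\<exists>p::int. \<bar>real h * d n - S ^ a * of_int p\<bar> \<le> S ^ a / S ^ 20)}" for a
  define B1 where "B1 = {n \<in> ?I. \<exists>h. 1 \<le> h \<and> h \<le> s ^ 10 \<and> (\<exists>p::int. \<bar>real h * d n - S ^ 9 * of_int p\<bar> \<le> 1 / S ^ 3)}"
  define B2 where "B2 i = {n \<in> ?I. \<exists>h. 1 \<le> h \<and> h \<le> s ^ 30 \<and> (\<exists>p q::int. \<bar>real h * d n - S ^ cut (Suc i) * of_int p\<bar> \<le> S ^ cut i / S ^ 5 \<and>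
      \<bar>real h * d n - S ^ 4 * of_int q\<bar> \<le> 1 / S ^ 3)}" for i
  have c1: "0 < 8 / (c - 1) * N" using c N0 by simp
  have X1: "q * ?w + r * (N / S) \<le> X" if "q \<le> 20" "r \<le> 40" for q r
  proof -
    have "q * ?w \<le> 20 * ?w" using that(1) c N0 S0 by (intro mult_right_mono) auto
    moreover have "r * (N / S) \<le> 40 * (N / S)" using that(2) N0 S0 by (intro mult_right_mono) auto
    moreover have "20 * ?w + 40 * (N / S) = X" using S0 c by (simp add: X_def field_simps)
    ultimately show ?thesis by linarith
  qed
  have NSc: "8 / (c - 1) * N / S ^ p \<le> 8 / (c - 1) * N / S" if "1 \<le> p" for p
    using mult_left_mono[OF NS[OF that], of "8 / (c - 1)"] c by simp
  have comb: "u \<le> x" if "u \<le> v + w" "v \<le> v'" "w \<le> w'" "v' + w' \<le> x" for u v w v' w' x :: real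
    using that by linarith
  have NSc2: "8 / (c - 1) * N / S ^ 2 \<le> 8 / (c - 1) * N / S" by (rule NSc) simp
  have NSc19: "8 / (c - 1) * N / S ^ 19 \<le> 8 / (c - 1) * N / S" by (rule NSc) simp
  have d31: "8 * D * S ^ 31 \<le> N / S" by (rule DS) simp
  have BG: "real (card (BG a)) \<le> X" if a: "a \<in> ?P" for a
  proof -
    have "S ^ a \<le> S ^ cut k" using a cutS S1 by auto
    then have "S ^ a < D * S ^ 20"
    proof -
      have "S ^ 18 < S ^ 20" using S1 by (intro power_strict_increasing) auto
      then have "D * S ^ 18 < D * S ^ 20" using D0 by simp
      then show ?thesis using \<open>S ^ a \<le> S ^ cut k\<close> hi unfolding D_def by linarith
    qed
    then have lt: "S ^ a / S ^ 20 < D" using S0 by (simp add: pos_divide_less_eq)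
    have "real (card (BG a)) \<le> 2 * (4 * D) / S ^ a * (2 * (S ^ a / S ^ 20) * s / \<mu> + real s ^ 2)"
      unfolding BG_def by (rule card_multiple_near_lattice[OF gap \<mu>0 _ dr _ lt]) (use S0 D0 in auto)
    also have "\<dots> = 4 * (4 * D / \<mu>) * (S / S ^ 20) + 8 * D * S ^ 2 * (1 / S ^ a)"
      using S0 \<mu>0 by (simp add: S[symmetric] field_simps)
    finally have le: "real (card (BG a)) \<le> 4 * (4 * D / \<mu>) * (S / S ^ 20) + 8 * D * S ^ 2 * (1 / S ^ a)" .
    have "S / S ^ 20 = 1 / S ^ 19" using S0 by (simp add: field_simps flip: power_Suc)
    then have "4 * (4 * D / \<mu>) * (S / S ^ 20) = 4 * (8 / (c - 1) * N / S ^ 19)" unfolding D\<mu> by simp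
    then have "4 * (4 * D / \<mu>) * (S / S ^ 20) \<le> 4 * ?w" using NSc19 by linarith
    moreover have "8 * D * S ^ 2 * (1 / S ^ a) \<le> 1 * (N / S)"
    proof -
      have "8 * D * S ^ 2 * (1 / S ^ a) \<le> N / S * 1"
        by (rule mult_mono) (use DS[of 2] S1 S0 N0 in \<open>auto simp: one_le_power\<close>)
      then show ?thesis by simp
    qed
    moreover have "4 * ?w + 1 * (N / S) \<le> X" by (rule X1) auto
    ultimately show ?thesis using comb[OF le] by blast
  qed
  have B1: "real (card B1) \<le> X"
  proof -
    have lt: "1 / S ^ 3 < D"
    proof -
      have "1 / S ^ 3 < 1" using S1 by (simp add: one_less_power)
      also have "1 \<le> D" using N c unfolding D_def by (intro ge_one_powr_ge_zero) auto
      finally show ?thesis .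
    qed
    have "real (card B1) \<le> 2 * (4 * D) / S ^ 9 * (2 * (1 / S ^ 3) * real (s ^ 10) / \<mu> + real (s ^ 10) ^ 2)"
      unfolding B1_def by (rule card_multiple_near_lattice[OF gap \<mu>0 _ dr _ lt]) (use S0 D0 in auto)
    also have "\<dots> = 4 * (4 * D / \<mu>) * (S ^ 10 / S ^ 12) + 8 * D * (S ^ 20 / S ^ 9)"
      using S0 \<mu>0 by (simp add: S[symmetric] field_simps)
    finally have le: "real (card B1) \<le> 4 * (4 * D / \<mu>) * (S ^ 10 / S ^ 12) + 8 * D * (S ^ 20 / S ^ 9)" .
    have "S ^ 10 / S ^ 12 = 1 / S ^ 2" using S0 by (simp add: field_simps)
    then have "4 * (4 * D / \<mu>) * (S ^ 10 / S ^ 12) = 4 * (8 / (c - 1) * N / S ^ 2)" unfolding D\<mu> by simp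
    then have "4 * (4 * D / \<mu>) * (S ^ 10 / S ^ 12) \<le> 4 * ?w" using NSc2 by linarith
    moreover have "S ^ 20 / S ^ 9 = S ^ 11" using S0 by (simp add: field_simps)
    then have "8 * D * (S ^ 20 / S ^ 9) \<le> 1 * (N / S)" using DS[of 11] by simp
    moreover have "4 * ?w + 1 * (N / S) \<le> X" by (rule X1) auto
    ultimately show ?thesis using comb[OF le] by blast
  qed
  have B2: "real (card (B2 i)) \<le> X" if i: "1 \<le> i" "i < k" for i
  proof -
    let ?A = "S ^ cut i / S ^ 5"
    have A0: "0 < ?A" using S0 by simp
    have cS: "cut (Suc i) = cut i + 20" using i by (simp add: cut_def)
    have BA: "S ^ cut (Suc i) = ?A * S ^ 25"
      unfolding cS power_add using power_diff[of S 5 25] S0 by simp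
    have GA: "S ^ 4 \<le> ?A"
    proof -
      have "S ^ 4 * S ^ 5 \<le> S ^ cut i"
        unfolding power_add[symmetric] using i S1 by (intro power_increasing) (auto simp: cut_def)
      then show ?thesis using S0 by (simp only: pos_le_divide_eq zero_less_power)
    qed
    have AD: "?A < D"
    proof -
      have "?A * S ^ 25 \<le> D * S ^ 18" using cutS[of "Suc i"] i hi unfolding BA D_def by linarith
      also have "\<dots> < D * S ^ 25" using D0 S1 by (intro mult_strict_left_mono power_strict_increasing) auto
      finally show ?thesis using S0 by (simp only: mult_less_cancel_right_pos zero_less_power)
    qed
    have eA: "1 / S ^ 3 \<le> ?A"
    proof -
      have "1 / S ^ 3 \<le> 1" using S1 by simp
      also have "1 \<le> S ^ 4" using S1 by (intro one_le_power) auto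
      finally show ?thesis using GA by linarith
    qed
    have le0: "real (card (B2 i)) \<le> 10 * (4 * D) * ?A / (?A * S ^ 25 * S ^ 4) * (2 * (1 / S ^ 3) * real (s ^ 30) / \<mu> + real (s ^ 30) ^ 2)"
      unfolding B2_def BA by (rule card_multiple_near_two_lattices[OF gap \<mu>0 _ dr _ eA AD _ _ GA]) (use S0 D0 A0 in auto)
    have "10 * (4 * D) * A' / (A' * S ^ 25 * S ^ 4) = 10 * (4 * D) / S ^ 29" if "0 < A'" for A' :: real
      using that S0 by (simp add: field_simps)
    then have e1: "10 * (4 * D) * ?A / (?A * S ^ 25 * S ^ 4) = 10 * (4 * D) / S ^ 29" using A0 by blast
    have e2: "10 * (4 * D) / S ^ 29 * (2 * (1 / S ^ 3) * real (s ^ 30) / \<mu> + real (s ^ 30) ^ 2) =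
       20 * (4 * D / \<mu>) * (S ^ 30 / S ^ 32) + 40 * D * (S ^ 60 / S ^ 29)"
      using S0 \<mu>0 by (simp add: S[symmetric] field_simps)
    have le: "real (card (B2 i)) \<le> 20 * (4 * D / \<mu>) * (S ^ 30 / S ^ 32) + 40 * D * (S ^ 60 / S ^ 29)"
      using le0 unfolding e1 e2 .
    have "S ^ 30 / S ^ 32 = 1 / S ^ 2" using S0 by (simp add: field_simps)
    then have "20 * (4 * D / \<mu>) * (S ^ 30 / S ^ 32) = 20 * (8 / (c - 1) * N / S ^ 2)" unfolding D\<mu> by simp
    then have "20 * (4 * D / \<mu>) * (S ^ 30 / S ^ 32) \<le> 20 * ?w" using NSc2 by linarith
    moreover have "40 * D * (S ^ 60 / S ^ 29) \<le> 5 * (N / S)"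
    proof -
    have "S ^ 60 / S ^ 29 = S ^ 31" using S0 by (simp add: field_simps)
    then have "40 * D * (S ^ 60 / S ^ 29) = 5 * (8 * D * S ^ 31)" by simp
    also have "\<dots> \<le> 5 * (N / S)" using d31 by (rule mult_left_mono) simp
    finally show ?thesis .
    qed
    moreover have "20 * ?w + 5 * (N / S) \<le> X" by (rule X1) auto
    ultimately show ?thesis using comb[OF le] by blast
  qed
  \<comment> \<open>\<open>BG\<close> spoils the equidistribution near multiples of a power of two, \<open>B1\<close> and \<open>B2 i\<close> spoil
      the shifts for the first block and for block \<open>i\<close>.\<close>
  define Bad where "Bad = (\<Union>a\<in>?P. BG a) \<union> B1 \<union> (\<Union>i\<in>{1..<k}. B2 i)"
  have X0: "0 \<le> X" using B1 by (rule order.trans[rotated]) simp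
  have Bad_card: "real (card Bad) \<le> (2 * real k + 3) * X"
  proof -
    have "card (?P) \<le> Suc (card (cut ` {..k}))" by (rule card_insert_le_m1) auto
    also have "card (cut ` {..k}) \<le> card {..k}" by (rule card_image_le) simp
    finally have ci: "real (card (?P)) \<le> real k + 2" by simp
    have "card (\<Union>a\<in>?P. BG a) \<le> (\<Sum>a\<in>?P. card (BG a))" by (rule card_UN_le) simp
    then have "real (card (\<Union>a\<in>?P. BG a)) \<le> (\<Sum>a\<in>?P. real (card (BG a)))" by (simp only: of_nat_sum[symmetric] of_nat_le_iff)
    also have "\<dots> \<le> (\<Sum>a\<in>?P. X)" by (rule sum_mono) (rule BG)
    also have "\<dots> = real (card (?P)) * X" by (rule sum_constant)
    also have "\<dots> \<le> (real k + 2) * X" using ci X0 by (rule mult_right_mono)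
    finally have 1: "real (card (\<Union>a\<in>?P. BG a)) \<le> (real k + 2) * X" .
    have "card (\<Union>i\<in>{1..<k}. B2 i) \<le> (\<Sum>i\<in>{1..<k}. card (B2 i))" by (rule card_UN_le) simp
    then have "real (card (\<Union>i\<in>{1..<k}. B2 i)) \<le> (\<Sum>i\<in>{1..<k}. real (card (B2 i)))" by (simp only: of_nat_sum[symmetric] of_nat_le_iff)
    also have "\<dots> \<le> (\<Sum>i\<in>{1..<k}. X)" by (rule sum_mono) (rule B2, auto)
    also have "\<dots> \<le> real k * X" using X0 by (simp add: mult_right_mono)
    finally have 2: "real (card (\<Union>i\<in>{1..<k}. B2 i)) \<le> real k * X" .
    have "card Bad \<le> card (\<Union>a\<in>?P. BG a) + card B1 + card (\<Union>i\<in>{1..<k}. B2 i)"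
      unfolding Bad_def by (intro order.trans[OF card_Un_le] add_right_mono card_Un_le)
    then have "real (card Bad) \<le> real (card (\<Union>a\<in>?P. BG a)) + real (card B1) + real (card (\<Union>i\<in>{1..<k}. B2 i))"
      by linarith
    also have "\<dots> \<le> (real k + 2) * X + X + real k * X" using 1 2 B1 by linarith
    finally show ?thesis by (simp add: algebra_simps)
  qed
  have A1: "\<bar>A n\<bar> \<le> 1" for n
  proof -
    have "\<bar>\<Sum>i<s ^ 36. z (n + i)\<bar> \<le> (\<Sum>i<s ^ 36. 1)" unfolding z_def by (rule order.trans[OF sum_abs sum_mono]) simp
    then show ?thesis using s0 by (simp add: A_def)
  qed
  have good: "\<bar>A n\<bar> \<le> E powr (1 / 2 ^ k)" if n: "n \<in> ?I" "n \<notin> Bad" for n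
  proof -
    have nN: "N \<le> n" "0 < real n" using n N by auto
    have "A n ^ (2 ^ k) \<le> E"
      unfolding A_def E_def z_def of_nat_add
    proof (rule window_bound[where \<alpha> = "d n" and \<beta> = "real n powr c" and S = S])
      show "k = 2 ^ m" "l = 2 * m + 3" "s = 2 ^ (l * j)" "2 * k + 8 \<le> s" "S = real s" by fact+
      show "0 < d n" using dr[OF n(1)] D0 by linarith
      have "d n * S ^ 15 \<le> 4 * D * S ^ 15" using dr[OF n(1)] S0 by (intro mult_right_mono) auto
      also have "\<dots> \<le> S ^ cut k" using lo by (simp add: D_def)
      finally show "d n * S ^ 15 \<le> S ^ cut k" .
      show "0 \<le> (real n + real i) powr c" for i by simp
      show "\<bar>(real n + real i) powr c - (real n powr c + real i * d n)\<bar> \<le> 1 / S" if i: "i \<le> s ^ 36 + k * s ^ 34" for i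
      proof -
        have "k \<le> s" using ks by simp
        then have "k * s ^ 34 \<le> s * s ^ 34" by (rule mult_right_mono) simp
        also have "\<dots> = s ^ 35" by (simp flip: power_Suc)
        also have "\<dots> \<le> s ^ 36" using s0 by (intro power_increasing) auto
        finally have "i \<le> 2 * s ^ 36" using i by simp
        then have iS: "real i \<le> 2 * S ^ 36" 
          unfolding S using of_nat_mono[of i "2 * s ^ 36", where 'a = real] by simp
        have "\<bar>(real n + real i) powr c - (real n powr c + real i * d n)\<bar> \<le> 2 * (real i)\<^sup>2 * real n powr (c - 2)"
          unfolding d_def by (rule powr_linear_approx[OF c nN(2)]) simp
        also have "\<dots> \<le> 2 * (2 * S ^ 36)\<^sup>2 * N powr (c - 2)"
          using iS nN c N0 by (intro mult_mono power_mono powr_mono2') auto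
        also have "2 * (2 * S ^ 36)\<^sup>2 * N powr (c - 2) = 8 * S ^ 72 * N powr (c - 2)" by (simp add: power_mult_distrib flip: power_mult)
        also have "\<dots> \<le> 1 / S"
        proof -
          have "N powr (2 - c) * N powr (c - 2) = N powr (2 - c + (c - 2))" by (simp only: powr_add)
          then have one: "N powr (2 - c) * N powr (c - 2) = 1" using N0 by simp
          have "8 * S ^ 73 * N powr (c - 2) \<le> N powr (2 - c) * N powr (c - 2)" using big by (rule mult_right_mono) simp
          then have "8 * S ^ 73 * N powr (c - 2) \<le> 1" unfolding one .
          moreover have "8 * S ^ 73 * N powr (c - 2) = 8 * S ^ 72 * N powr (c - 2) * S" by (simp add: S73)
          ultimately show ?thesis using S0 by (simp only: pos_le_divide_eq)
        qed
        finally show ?thesis .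
      qed
      show "S ^ a / S ^ 20 \<le> \<bar>real q * d n - S ^ a * of_int p\<bar>"
        if "a \<in> ?P" "1 \<le> q" "q \<le> s" for a q and p :: int
      proof (rule ccontr)
        assume "\<not> S ^ a / S ^ 20 \<le> \<bar>real q * d n - S ^ a * of_int p\<bar>"
        then have "n \<in> BG a" unfolding BG_def using n that by (auto intro!: exI[of _ q] exI[of _ p])
        then show False using n that unfolding Bad_def by blast
      qed
      show "1 / S ^ 3 \<le> \<bar>real h * d n - S ^ 9 * of_int p\<bar>" if "1 \<le> h" "h \<le> s ^ 10" for h and p :: int
      proof (rule ccontr)
        assume "\<not> 1 / S ^ 3 \<le> \<bar>real h * d n - S ^ 9 * of_int p\<bar>"
        then have "n \<in> B1" unfolding B1_def using n that by (auto intro!: exI[of _ h] exI[of _ p])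
        then show False using n that unfolding Bad_def by blast
      qed
      show "1 / S ^ 3 \<le> \<bar>real h * d n - S ^ 4 * of_int q\<bar>"
        if "1 \<le> i" "i < k" "1 \<le> h" "h \<le> s ^ 30" "\<bar>real h * d n - S ^ cut (Suc i) * of_int p\<bar> \<le> S ^ cut i / S ^ 5" for i h and p q :: int
      proof (rule ccontr)
        assume "\<not> 1 / S ^ 3 \<le> \<bar>real h * d n - S ^ 4 * of_int q\<bar>"
        then have "\<bar>real h * d n - S ^ 4 * of_int q\<bar> \<le> 1 / S ^ 3" by simp
        then have "n \<in> B2 i" unfolding B2_def using n(1) that(3-5) by blast
        then show False using n that unfolding Bad_def by auto
      qed
    qed
    moreover have "even ((2::nat) ^ k)" using k0 by simp
    then have "A n ^ (2 ^ k) = \<bar>A n\<bar> ^ (2 ^ k)" by (simp add: power_even_abs)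
    ultimately have le: "\<bar>A n\<bar> ^ (2 ^ k) \<le> E" by simp
    have "\<bar>A n\<bar> = (\<bar>A n\<bar> ^ (2 ^ k)) powr (1 / 2 ^ k)"
    proof (cases "A n = 0")
      case True
      then show ?thesis by simp
    next
      case False
      then have "\<bar>A n\<bar> ^ (2 ^ k) = \<bar>A n\<bar> powr (2 ^ k)" using powr_realpow[of "\<bar>A n\<bar>" "2 ^ k"] by simp
      then show ?thesis using False by (simp add: powr_powr)
    qed
    also have "\<dots> \<le> E powr (1 / 2 ^ k)" using le by (intro powr_mono2) auto
    finally show ?thesis .
  qed
  have BI: "Bad \<subseteq> ?I" unfolding Bad_def BG_def B1_def B2_def by auto
  have "\<bar>\<Sum>n\<in>?I. z n\<bar> \<le> (\<Sum>n\<in>?I. \<bar>A n\<bar>) + 2 * real (s ^ 36)"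
    unfolding A_def by (rule sum_le_sum_windows) (use s0 N in \<open>auto simp: z_def\<close>)
  also have "(\<Sum>n\<in>?I. \<bar>A n\<bar>) = (\<Sum>n\<in>?I - Bad. \<bar>A n\<bar>) + (\<Sum>n\<in>Bad. \<bar>A n\<bar>)"
    using BI by (intro sum.subset_diff) auto
  also have "(\<Sum>n\<in>?I - Bad. \<bar>A n\<bar>) \<le> (\<Sum>n\<in>?I - Bad. E powr (1 / 2 ^ k))"
    by (rule sum_mono) (use good in auto)
  also have "\<dots> \<le> real N * E powr (1 / 2 ^ k)"
  proof -
    have "card (?I - Bad) \<le> card ?I" by (rule card_mono) auto
    then have "real (card (?I - Bad)) \<le> real N" using N by simp
    then show ?thesis by (simp add: mult_right_mono)
  qed
  also have "(\<Sum>n\<in>Bad. \<bar>A n\<bar>) \<le> (\<Sum>n\<in>Bad. 1)" by (rule sum_mono) (rule A1)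
  also have "\<dots> = real (card Bad)" by simp
  also have "\<dots> \<le> (2 * real k + 3) * X" by (rule Bad_card)
  also have "2 * real (s ^ 36) \<le> N * (2 / S)"
  proof -
    have "1 \<le> D" using N c unfolding D_def by (intro ge_one_powr_ge_zero) auto
    then have "1 * S ^ 36 \<le> 8 * D * S ^ 36" using S0 by (intro mult_right_mono) auto
    also have "\<dots> \<le> N / S" by (rule DS) simp
    finally have "2 * S ^ 36 \<le> 2 * (N / S)" by simp
    then show ?thesis unfolding S by (simp add: mult.commute)
  qed
  finally have "\<bar>\<Sum>n\<in>?I. z n\<bar> \<le> real N * E powr (1 / 2 ^ k) + (2 * real k + 3) * X + N * (2 / S)" by simp
  also have "\<dots> = real N * ((2 * real k + 3) * (160 / (c - 1) + 40) / S + E powr (1 / 2 ^ k) + 2 / S)"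
    by (simp add: X_def algebra_simps)
  finally show ?thesis unfolding z_def E_def .
qed

text \<open>
  All error terms are powers with exponent \<open>j\<close>, as \<open>S = (2 ^ l) ^ j\<close>; the weakest saving is
  the one from the cancellation in the window.
\<close>

lemma block_bound_power:
  fixes c :: real and k m l :: nat
  assumes c: "1 < c" "c < 2" and k: "k = 2 ^ m" and l: "l = 2 * m + 3"
  obtains C \<theta> :: real where "0 < \<theta>" "\<theta> < 1" "0 \<le> C"
    "\<And>j N N' S. 2 * k + 8 \<le> (2::nat) ^ (l * j) \<Longrightarrow> S = (2 ^ l) ^ j \<Longrightarrow> 1 \<le> N \<Longrightarrow> N \<le> N' \<Longrightarrow> N' \<le> 2 * N \<Longrightarrow>
       4 * real N powr (c - 1) * S ^ 15 \<le> S ^ cut k \<Longrightarrow> S ^ cut k \<le> real N powr (c - 1) * S ^ 18 \<Longrightarrow>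
       8 * S ^ 73 \<le> real N powr (2 - c) \<Longrightarrow>
       \<bar>\<Sum>n\<in>{N..<N'}. tm (nat \<lfloor>real n powr c\<rfloor>)\<bar> \<le> C * (real N * \<theta> ^ j)"
proof -
  define \<gamma> where "\<gamma> = (1 - 2 / 2 ^ (2 * k * l) :: real)"
  define p where "p = (1 / 2 ^ k :: real)"
  define \<theta> where "\<theta> = \<gamma> powr p"
  define C1 where "C1 = (2 * real k + 3) * (160 / (c - 1) + 40)"
  define C2 where "C2 = 2 * (2 ^ k + 1) * ((real k + 2) * (4 * real k + 22) + real k) + 4 * 2 ^ k * real k"
  have k0: "0 < k" by (simp add: k)
  have p: "0 < p" "p \<le> 1" by (simp_all add: p_def)
  have g: "1 / 2 \<le> \<gamma>" "\<gamma> < 1"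
  proof -
    have "1 * 1 \<le> k * l" using k0 l by (intro mult_le_mono) auto
    then have "(2::real) ^ 2 \<le> 2 ^ (2 * k * l)" by (intro power_increasing) auto
    then have "2 / 2 ^ (2 * k * l) \<le> (1 / 2 :: real)" by (simp add: divide_simps)
    then show "1 / 2 \<le> \<gamma>" unfolding \<gamma>_def by linarith
    show "\<gamma> < 1" by (simp add: \<gamma>_def)
  qed
  have g0: "0 < \<gamma>" using g by linarith
  have C1: "0 \<le> C1" using c by (simp add: C1_def)
  have C2: "0 \<le> C2" by (simp add: C2_def)
  have t: "0 < \<theta>" "\<theta> < 1" "\<gamma> \<le> \<theta>"
  proof -
    show "0 < \<theta>" using g0 by (simp add: \<theta>_def)
    show "\<theta> < 1" unfolding \<theta>_def using powr_less_mono2[of p \<gamma> 1] g g0 p by simp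
    have "\<gamma> powr 1 \<le> \<gamma> powr p" using p g g0 by (intro powr_mono') auto
    then show "\<gamma> \<le> \<theta>" using g0 by (simp add: \<theta>_def)
  qed
  show thesis
  proof (rule that[of \<theta> "C1 + (1 + C2) + 2"])
    show "0 < \<theta>" "\<theta> < 1" by fact+
    show "0 \<le> C1 + (1 + C2) + 2" using C1 C2 by simp
    fix j N N' :: nat and S :: real
    assume ks: "2 * k + 8 \<le> (2::nat) ^ (l * j)" and S: "S = (2 ^ l) ^ j" and N: "1 \<le> N" "N \<le> N'" "N' \<le> 2 * N"
      and lo: "4 * real N powr (c - 1) * S ^ 15 \<le> S ^ cut k" and hi: "S ^ cut k \<le> real N powr (c - 1) * S ^ 18"
      and big: "8 * S ^ 73 \<le> real N powr (2 - c)"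
    have S': "S = real (2 ^ (l * j))" by (simp add: S power_mult)
    have S0: "0 < S" by (simp add: S)
    have "1 / S = (1 / 2 ^ l) ^ j" by (simp add: S power_divide)
    also have "\<dots> \<le> \<gamma> ^ j"
    proof (rule power_mono)
      have "(2::real) ^ 1 \<le> 2 ^ l" using l by (intro power_increasing) auto
      then have "1 / 2 ^ l \<le> (1 / 2 :: real)" by (simp add: divide_simps)
      then show "1 / 2 ^ l \<le> \<gamma>" using g by linarith
    qed simp
    finally have S\<gamma>: "1 / S \<le> \<gamma> ^ j" .
    have \<gamma>\<theta>: "\<gamma> ^ j \<le> \<theta> ^ j" using t g0 by (intro power_mono) auto
    have S\<theta>: "1 / S \<le> \<theta> ^ j" using S\<gamma> \<gamma>\<theta> by linarith
    have "C2 * (1 / S) \<le> C2 * \<gamma> ^ j" using S\<gamma> C2 by (rule mult_left_mono)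
    then have "\<gamma> ^ j + C2 / S \<le> (1 + C2) * \<gamma> ^ j" by (simp add: algebra_simps)
    moreover have "0 \<le> \<gamma> ^ j + C2 / S" using g0 C2 S0 by simp
    ultimately have "(\<gamma> ^ j + C2 / S) powr p \<le> ((1 + C2) * \<gamma> ^ j) powr p"
      using p by (intro powr_mono2) auto
    also have "\<dots> = (1 + C2) powr p * (\<gamma> ^ j) powr p" using C2 g0 by (intro powr_mult) 
    also have "(\<gamma> ^ j) powr p = \<theta> ^ j"
    proof -
      have "(\<gamma> ^ j) powr p = (\<gamma> powr real j) powr p" using g0 by (simp add: powr_realpow)
      also have "\<dots> = (\<gamma> powr p) powr real j" by (simp add: powr_powr mult.commute)
      also have "\<dots> = \<theta> ^ j" using t by (simp add: \<theta>_def powr_realpow)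
      finally show ?thesis .
    qed
    also have "(1 + C2) powr p * \<theta> ^ j \<le> (1 + C2) * \<theta> ^ j"
    proof (rule mult_right_mono)
      have "(1 + C2) powr p \<le> (1 + C2) powr 1" using C2 p by (intro powr_mono) auto
      then show "(1 + C2) powr p \<le> 1 + C2" using C2 by simp
    qed (use t in simp)
    finally have E: "(\<gamma> ^ j + C2 / S) powr p \<le> (1 + C2) * \<theta> ^ j" .
    have "\<bar>\<Sum>n\<in>{N..<N'}. tm (nat \<lfloor>real n powr c\<rfloor>)\<bar> \<le> real N * (C1 / S + (\<gamma> ^ j + C2 / S) powr p + 2 / S)"
      using block_bound[OF c k l refl ks S' N lo hi big] unfolding \<gamma>_def C1_def C2_def p_def .
    also have "\<dots> \<le> real N * ((C1 + (1 + C2) + 2) * \<theta> ^ j)"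
    proof (rule mult_left_mono)
      have "C1 * (1 / S) \<le> C1 * \<theta> ^ j" "2 * (1 / S) \<le> 2 * \<theta> ^ j"
        by (rule mult_left_mono[OF S\<theta> C1], rule mult_left_mono[OF S\<theta>]) simp
      then show "C1 / S + (\<gamma> ^ j + C2 / S) powr p + 2 / S \<le> (C1 + (1 + C2) + 2) * \<theta> ^ j"
        using E by (simp add: algebra_simps)
    qed simp
    finally show "\<bar>\<Sum>n\<in>{N..<N'}. tm (nat \<lfloor>real n powr c\<rfloor>)\<bar> \<le> (C1 + (1 + C2) + 2) * (real N * \<theta> ^ j)"
      by (simp add: algebra_simps)
  qed
qed

section \<open>Choice of the scale\<close>

lemma powr_large:
  fixes Z a :: real
  assumes "0 < a"
  obtains N0 :: nat where "\<And>N. N0 \<le> N \<Longrightarrow> Z \<le> real N powr a"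
proof
  fix N assume N: "nat \<lceil>max 1 Z powr (1 / a)\<rceil> \<le> N"
  have "max 1 Z powr (1 / a) \<le> real N" using N by linarith
  then have "(max 1 Z powr (1 / a)) powr a \<le> real N powr a" using assms by (intro powr_mono2) auto
  then show "Z \<le> real N powr a" using assms by (simp add: powr_powr)
qed

text \<open>
  The scale \<open>S = b ^ j\<close> is the smallest one with \<open>S ^ q \<ge> 4 * N powr (c - 1)\<close>, so that the
  blocks just cover the digits of the slope. The condition on \<open>q\<close> ensures
  \<open>S ^ 73 \<le> N powr ((2 - c) / 2)\<close> up to constants. This is the place where \<open>c < 2\<close> is
  essential, and where the number of blocks grows as \<open>c\<close> approaches \<open>2\<close>.
\<close>

lemma choose_scale:
  fixes c b T \<theta> :: real and q :: nat
  assumes c: "1 < c" "c < 2" and b: "2 \<le> b" and q: "146 / (2 - c) \<le> real q" and \<theta>: "0 < \<theta>" "\<theta> < 1"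
  obtains \<eta> :: real and N0 :: nat where "0 < \<eta>"
    "\<And>N. N0 \<le> N \<Longrightarrow> \<exists>j. T \<le> b ^ j \<and> 4 * real N powr (c - 1) \<le> (b ^ j) ^ q \<and> (b ^ j) ^ q \<le> 4 * real N powr (c - 1) * b ^ q \<and>
       8 * (b ^ j) ^ 73 \<le> real N powr (2 - c) \<and> \<theta> ^ j \<le> real N powr (- \<eta>)"
proof -
  have q0: "0 < real q" using q c by (smt (verit) divide_pos_pos)
  have lb: "0 < ln b" using b by simp
  define \<eta> where "\<eta> = (c - 1) * (- ln \<theta>) / (q * ln b)"
  have \<eta>: "0 < \<eta>" unfolding \<eta>_def using c \<theta> q0 lb by (intro divide_pos_pos mult_pos_pos) auto
  define T' where "T' = max 1 T"
  obtain N1 where N1: "\<And>N. N1 \<le> N \<Longrightarrow> T' ^ q \<le> real N powr (c - 1)"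
    by (rule powr_large[of "c - 1" "T' ^ q"]) (use c in auto)
  obtain N2 where N2: "\<And>N. N2 \<le> N \<Longrightarrow> 8 * (4 * b ^ q) powr ((2 - c) / 2) \<le> real N powr ((2 - c) / 2)"
    by (rule powr_large[of "(2 - c) / 2" "8 * (4 * b ^ q) powr ((2 - c) / 2)"]) (use c in auto)
  show thesis
  proof (rule that[of \<eta> "max 1 (max N1 N2)"])
    show "0 < \<eta>" by fact
    fix N :: nat assume N: "max 1 (max N1 N2) \<le> N"
    define D where "D = real N powr (c - 1)"
    have D1: "1 \<le> D" unfolding D_def using N c by (intro ge_one_powr_ge_zero) auto
    have DN: "D \<le> real N"
    proof -
      have "D \<le> real N powr 1" unfolding D_def using N c by (intro powr_mono) auto
      then show ?thesis using N by simp
    qed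
    define x where "x = ln (4 * D) / (q * ln b)"
    have x0: "0 \<le> x" unfolding x_def using D1 q0 lb by (intro divide_nonneg_pos) auto
    define j where "j = nat \<lceil>x\<rceil>"
    have j: "x \<le> real j" "real j \<le> x + 1" using x0 unfolding j_def by linarith+
    define S where "S = b ^ j"
    have S0: "0 < S" using b by (simp add: S_def)
    have S1: "1 \<le> S" unfolding S_def using b by (intro one_le_power) auto
    have Sq: "S ^ q = exp (q * ln b * real j)"
    proof -
      have "S = exp (real j * ln b)" using b by (simp add: S_def exp_of_nat_mult)
      then show ?thesis by (simp add: exp_of_nat_mult[symmetric] mult_ac)
    qed
    have xq: "q * ln b * x = ln (4 * D)" using q0 lb by (simp add: x_def)
    have e4: "exp (ln (4 * D)) = 4 * D" using D1 by simp
    have lo: "4 * D \<le> S ^ q"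
    proof -
      have "q * ln b * x \<le> q * ln b * real j" using j q0 lb by (intro mult_left_mono) auto
      then show ?thesis unfolding Sq using e4 xq by (metis exp_le_cancel_iff)
    qed
    have up: "S ^ q \<le> 4 * D * b ^ q"
    proof -
      have "q * ln b * real j \<le> q * ln b * (x + 1)" using j q0 lb by (intro mult_left_mono) auto
      also have "\<dots> = ln (4 * D) + q * ln b" unfolding distrib_left xq by simp
      finally have "S ^ q \<le> exp (ln (4 * D) + q * ln b)" unfolding Sq by simp
      also have "\<dots> = 4 * D * b ^ q" using e4 b by (simp add: exp_add exp_of_nat_mult)
      finally show ?thesis .
    qed
    have TS: "T \<le> S"
    proof (rule ccontr)
      assume "\<not> T \<le> S"
      then have "S ^ q < T' ^ q" using S0 q0 by (intro power_strict_mono) (auto simp: T'_def)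
      also have "\<dots> \<le> D" using N1 N by (simp add: D_def)
      finally show False using lo D1 by linarith
    qed
    have big: "8 * S ^ 73 \<le> real N powr (2 - c)"
    proof -
      \<comment> \<open>Half of the exponent \<open>2 - c\<close> bounds the power of \<open>S\<close>, the other half pays for the
          constants.\<close>
      let ?a = "(2 - c) / 2"
      have "146 \<le> real q * (2 - c)" using q c by (simp add: field_simps)
      then have a: "73 \<le> real q * ?a" by simp
      have "S ^ 73 = S powr 73" using S0 powr_realpow[of S 73] by simp
      also have "\<dots> \<le> S powr (real q * ?a)" using S1 a by (intro powr_mono) auto
      also have "\<dots> = (S ^ q) powr ?a" using S0 by (simp add: powr_powr flip: powr_realpow)
      also have "\<dots> \<le> (4 * b ^ q * real N) powr ?a"
      proof (rule powr_mono2)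
        have "4 * D * b ^ q \<le> 4 * real N * b ^ q" using DN b by (intro mult_right_mono) auto
        then show "S ^ q \<le> 4 * b ^ q * real N" using up by (simp add: mult_ac)
      qed (use c S0 in auto)
      also have "\<dots> = (4 * b ^ q) powr ?a * real N powr ?a" using b by (intro powr_mult)
      finally have "8 * S ^ 73 \<le> (8 * (4 * b ^ q) powr ?a) * real N powr ?a" by simp
      also have "\<dots> \<le> real N powr ?a * real N powr ?a" using N2 N by (intro mult_right_mono) auto
      also have "\<dots> = real N powr (?a + ?a)" by (simp only: powr_add)
      also have "?a + ?a = 2 - c" by (simp add: field_simps)
      finally show ?thesis .
    qed
    have th: "\<theta> ^ j \<le> real N powr (- \<eta>)"
    proof -
      have "ln D \<le> ln (4 * D)" using D1 by simp
      moreover have "ln D = (c - 1) * ln (real N)" using N by (simp add: D_def ln_powr)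
      ultimately have "(c - 1) * ln (real N) / (q * ln b) \<le> x" unfolding x_def using q0 lb by (intro divide_right_mono) auto
      then have "(c - 1) * ln (real N) / (q * ln b) \<le> real j" using j by linarith
      then have "ln \<theta> * real j \<le> ln \<theta> * ((c - 1) * ln (real N) / (q * ln b))"
        using \<theta> by (intro mult_left_mono_neg) auto
      also have "\<dots> = (- \<eta>) * ln (real N)" by (simp add: \<eta>_def)
      finally have "exp (real j * ln \<theta>) \<le> exp ((- \<eta>) * ln (real N))" by (simp add: mult.commute)
      moreover have "exp (real j * ln \<theta>) = \<theta> ^ j" using \<theta> by (simp add: exp_of_nat_mult)
      moreover have "exp ((- \<eta>) * ln (real N)) = real N powr (- \<eta>)" using N by (simp add: powr_def)
      ultimately show ?thesis by simp
    qed
    show "\<exists>j. T \<le> b ^ j \<and> 4 * real N powr (c - 1) \<le> (b ^ j) ^ q \<and> (b ^ j) ^ q \<le> 4 * real N powr (c - 1) * b ^ q \<and>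
       8 * (b ^ j) ^ 73 \<le> real N powr (2 - c) \<and> \<theta> ^ j \<le> real N powr (- \<eta>)"
      using TS lo up big th unfolding S_def D_def by blast
  qed
qed

text \<open>
  The number \<open>k\<close> of directions depends only on \<open>c\<close>; it is a power of two on account of
  \<open>prod_tm_card_Pow\<close>.
\<close>

lemma dyadic_saving:
  fixes c :: real
  assumes c: "1 < c" "c < 2"
  obtains C \<eta> :: real and N0 :: nat where "0 \<le> C" "0 < \<eta>" "1 \<le> N0"
    "\<And>N N'. N0 \<le> N \<Longrightarrow> N \<le> N' \<Longrightarrow> N' \<le> 2 * N \<Longrightarrow>
       \<bar>\<Sum>n\<in>{N..<N'}. tm (nat \<lfloor>real n powr c\<rfloor>)\<bar> \<le> C * real N powr (1 - \<eta>)"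
proof -
  obtain m :: nat where m: "10 / (2 - c) + 2 < 2 ^ m" using real_arch_pow[of 2] by auto
  define k where "k = (2::nat) ^ m"
  define l where "l = 2 * m + 3"
  define q where "q = 20 * k - 26"
  have kr: "10 / (2 - c) + 2 < real k" using m by (simp add: k_def)
  have "0 < 10 / (2 - c)" using c by simp
  then have k2: "2 < real k" using kr by linarith
  then have k3: "3 \<le> k" by simp
  have qr: "real q = 20 * real k - 26" using k3 by (simp add: q_def of_nat_diff)
  have q: "146 / (2 - c) \<le> real q"
  proof -
    have "146 / (2 - c) \<le> 20 * (10 / (2 - c))" using c by (simp add: divide_simps)
    then show ?thesis using kr qr by linarith
  qed
  have cutk: "cut k = q + 15" using k3 by (simp add: cut_def q_def)
  obtain C \<theta> :: real where \<theta>: "0 < \<theta>" "\<theta> < 1" and C: "0 \<le> C" and blk: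
    "\<And>j N N' S. 2 * k + 8 \<le> (2::nat) ^ (l * j) \<Longrightarrow> S = (2 ^ l) ^ j \<Longrightarrow> 1 \<le> N \<Longrightarrow> N \<le> N' \<Longrightarrow> N' \<le> 2 * N \<Longrightarrow>
       4 * real N powr (c - 1) * S ^ 15 \<le> S ^ cut k \<Longrightarrow> S ^ cut k \<le> real N powr (c - 1) * S ^ 18 \<Longrightarrow>
       8 * S ^ 73 \<le> real N powr (2 - c) \<Longrightarrow>
       \<bar>\<Sum>n\<in>{N..<N'}. tm (nat \<lfloor>real n powr c\<rfloor>)\<bar> \<le> C * (real N * \<theta> ^ j)"
    by (rule block_bound_power[OF c k_def l_def]) blast
  define b where "b = (2 ^ l :: real)"
  have b2: "2 \<le> b"
  proof -
    have "(2::real) ^ 1 \<le> 2 ^ l" by (intro power_increasing) (auto simp: l_def)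
    then show ?thesis by (simp add: b_def)
  qed
  obtain \<eta> N0 where \<eta>: "0 < \<eta>" and ch:
    "\<And>N. N0 \<le> N \<Longrightarrow> \<exists>j. max (4 * b ^ q) (2 * real k + 8) \<le> b ^ j \<and> 4 * real N powr (c - 1) \<le> (b ^ j) ^ q \<and> (b ^ j) ^ q \<le> 4 * real N powr (c - 1) * b ^ q \<and>
       8 * (b ^ j) ^ 73 \<le> real N powr (2 - c) \<and> \<theta> ^ j \<le> real N powr (- \<eta>)"
    by (rule choose_scale[OF c b2 q \<theta>, of "max (4 * b ^ q) (2 * real k + 8)"]) blast
  show thesis
  proof (rule that[of C \<eta> "max 1 N0"])
    show "0 \<le> C" "0 < \<eta>" "1 \<le> max 1 N0" using C \<eta> by auto
    fix N N' :: nat assume N: "max 1 N0 \<le> N" "N \<le> N'" "N' \<le> 2 * N"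
    then have "N0 \<le> N" by simp
    from ch[OF this] obtain j where j: "4 * b ^ q \<le> b ^ j" "2 * real k + 8 \<le> b ^ j"
      "4 * real N powr (c - 1) \<le> (b ^ j) ^ q" "(b ^ j) ^ q \<le> 4 * real N powr (c - 1) * b ^ q"
      "8 * (b ^ j) ^ 73 \<le> real N powr (2 - c)" "\<theta> ^ j \<le> real N powr (- \<eta>)" by auto
    define S where "S = b ^ j"
    have S1: "1 \<le> S" unfolding S_def using b2 by (intro one_le_power) auto
    have "real (2 * k + 8) \<le> real (2 ^ (l * j))" using j(2) by (simp add: b_def power_mult)
    then have ks: "2 * k + 8 \<le> (2::nat) ^ (l * j)" by (simp only: of_nat_le_iff)
    have N1: "1 \<le> N" using N by simp
    have lo: "4 * real N powr (c - 1) * S ^ 15 \<le> S ^ cut k"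
      unfolding cutk power_add S_def using j(3) b2 by (intro mult_right_mono) auto
    have hi: "S ^ cut k \<le> real N powr (c - 1) * S ^ 18"
    proof -
      have "S ^ cut k \<le> (4 * real N powr (c - 1) * b ^ q) * S ^ 15"
        unfolding cutk power_add S_def using j(4) b2 by (intro mult_right_mono) auto
      also have "\<dots> = real N powr (c - 1) * S ^ 15 * (4 * b ^ q)" by simp
      also have "\<dots> \<le> real N powr (c - 1) * S ^ 15 * S ^ 3"
      proof (rule mult_left_mono)
        have "S ^ 1 \<le> S ^ 3" using S1 by (intro power_increasing) auto
        then show "4 * b ^ q \<le> S ^ 3" using j(1) unfolding S_def by simp
      qed (use S1 in simp)
      also have "\<dots> = real N powr (c - 1) * S ^ 18" by (simp only: mult.assoc power_add[symmetric]) simp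
      finally show ?thesis .
    qed
    have "\<bar>\<Sum>n\<in>{N..<N'}. tm (nat \<lfloor>real n powr c\<rfloor>)\<bar> \<le> C * (real N * \<theta> ^ j)"
      by (rule blk[OF ks _ N1 N(2,3) lo hi]) (use j(5) in \<open>auto simp: S_def b_def\<close>)
    also have "\<dots> \<le> C * (real N * real N powr (- \<eta>))"
      using j(6) C by (intro mult_left_mono) auto
    also have "real N * real N powr (- \<eta>) = real N powr 1 * real N powr (- \<eta>)" using N by simp
    also have "\<dots> = real N powr (1 - \<eta>)" unfolding powr_add[symmetric] by simp
    finally show "\<bar>\<Sum>n\<in>{N..<N'}. tm (nat \<lfloor>real n powr c\<rfloor>)\<bar> \<le> C * real N powr (1 - \<eta>)" .
  qed
qed

section \<open>Summation over dyadic blocks\<close>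

text \<open>
  Halving the range repeatedly gives a geometric series, since
  \<open>(1 / 2) powr (1 - \<eta>) \<le> sqrt (1 / 2) < 3 / 4\<close>.
\<close>

lemma dyadic_summation:
  fixes z :: "nat \<Rightarrow> real" and C \<eta> :: real and N0 X :: nat
  assumes z: "\<And>n. \<bar>z n\<bar> \<le> 1" and C: "0 \<le> C" and \<eta>: "\<eta> \<le> 1 / 2" and N0: "1 \<le> N0"
    and dy: "\<And>N. N0 \<le> N \<Longrightarrow> \<bar>\<Sum>n\<in>{N..<2 * N}. z n\<bar> \<le> C * real N powr (1 - \<eta>)"
    and X: "1 \<le> X"
  shows "\<bar>\<Sum>n<X. z n\<bar> \<le> (2 * real N0 + 3 * C + 4) * real X powr (1 - \<eta>)"
  using X
proof (induction X rule: less_induct)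
  case (less X)
  let ?B = "2 * real N0 + 3 * C + 4"
  have X1: "1 \<le> real X" using less.prems by simp
  have p1: "1 \<le> real X powr (1 - \<eta>)" using X1 \<eta> by (intro ge_one_powr_ge_zero) auto
  show ?case
  proof (cases "X < 2 * N0")
    case True
    have "\<bar>\<Sum>n<X. z n\<bar> \<le> (\<Sum>n<X. 1)" by (rule order.trans[OF sum_abs sum_mono]) (rule z)
    also have "\<dots> \<le> ?B" using True C by simp
    also have "?B * 1 \<le> ?B * real X powr (1 - \<eta>)" using p1 C by (intro mult_left_mono) auto
    finally show ?thesis by simp
  next
    case False
    define Y where "Y = X div 2"
    have Y: "N0 \<le> Y" "Y < X" "1 \<le> Y" using False N0 less.prems by (auto simp: Y_def)
    have X_cases: "X = 2 * Y \<or> X = Suc (2 * Y)" unfolding Y_def by linarith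
    have two: "(\<Sum>n<2 * Y. z n) = (\<Sum>n<Y. z n) + (\<Sum>n\<in>{Y..<2 * Y}. z n)"
      unfolding lessThan_atLeast0 by (rule sum.atLeastLessThan_concat[symmetric]) auto
    have split: "\<bar>(\<Sum>n<X. z n) - ((\<Sum>n<Y. z n) + (\<Sum>n\<in>{Y..<2 * Y}. z n))\<bar> \<le> 1"
      using X_cases z[of "2 * Y"] by (auto simp: two[symmetric])
    have IH: "\<bar>\<Sum>n<Y. z n\<bar> \<le> ?B * real Y powr (1 - \<eta>)" using less.IH[OF Y(2,3)] .
    have Yp: "real Y powr (1 - \<eta>) \<le> 3 / 4 * real X powr (1 - \<eta>)"
    proof -
      have "real Y powr (1 - \<eta>) \<le> (1 / 2 * real X) powr (1 - \<eta>)"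
        using \<eta> by (intro powr_mono2) (auto simp: Y_def)
      also have "\<dots> = (1 / 2) powr (1 - \<eta>) * real X powr (1 - \<eta>)" by (rule powr_mult)
      finally have le: "real Y powr (1 - \<eta>) \<le> (1 / 2) powr (1 - \<eta>) * real X powr (1 - \<eta>)" .
      have "(1 / 2) powr (1 - \<eta>) \<le> (1 / 2) powr (1 / 2 :: real)" using \<eta> by (intro powr_mono') auto
      also have "(1 / 2) powr (1 / 2 :: real) = sqrt (1 / 2)" by (rule powr_half_sqrt) simp
      also have "\<dots> \<le> 3 / 4" by (rule real_le_lsqrt) (auto simp: power2_eq_square)
      finally have "(1 / 2) powr (1 - \<eta>) * real X powr (1 - \<eta>) \<le> 3 / 4 * real X powr (1 - \<eta>)"
        by (rule mult_right_mono) simp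
      with le show ?thesis by (rule order.trans)
    qed
    have "\<bar>\<Sum>n<X. z n\<bar> \<le> ?B * real Y powr (1 - \<eta>) + C * real Y powr (1 - \<eta>) + 1"
    proof -
      have "\<bar>a\<bar> \<le> u + v + 1" if "\<bar>a - (b + e)\<bar> \<le> 1" "\<bar>b\<bar> \<le> u" "\<bar>e\<bar> \<le> v" for a b e u v :: real
        using that by linarith
      then show ?thesis using split IH dy[OF Y(1)] by blast
    qed
    also have "\<dots> = (?B + C) * real Y powr (1 - \<eta>) + 1" by (simp add: algebra_simps)
    also have "\<dots> \<le> (?B + C) * (3 / 4 * real X powr (1 - \<eta>)) + real X powr (1 - \<eta>)"
      using Yp C p1 by (intro add_mono mult_left_mono) auto
    also have "\<dots> = ((?B + C) * (3 / 4) + 1) * real X powr (1 - \<eta>)" by (simp add: algebra_simps)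
    also have "\<dots> \<le> ?B * real X powr (1 - \<eta>)"
      using C by (intro mult_right_mono) auto
    finally show ?thesis .
  qed
qed

theorem theorem2p2:
  fixes c :: real
  assumes "1 < c" and "c < 2"
  shows "simply_normal (\<lambda>n. thue_morse (nat \<lfloor>real n powr c\<rfloor>)) \<and>
    (\<exists>\<eta> C :: real. \<eta> > 0 \<and>
      (\<forall>N :: nat. N \<ge> 1 \<longrightarrow>
        \<bar>1 / real N * real (card {n :: nat. 0 \<le> n \<and> n < N \<and> thue_morse (nat \<lfloor>real n powr c\<rfloor>) = 0}) - 1 / 2\<bar>
          \<le> C * real N powr (- \<eta>)))"
proof -
  define a where "a n = thue_morse (nat \<lfloor>real n powr c\<rfloor>)" for n :: nat
  define z where "z n = tm (nat \<lfloor>real n powr c\<rfloor>)" for n :: nat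
  obtain C \<eta>0 :: real and N0 :: nat where C: "0 \<le> C" and \<eta>0: "0 < \<eta>0" and N0: "1 \<le> N0" and dy:
    "\<And>N N'. N0 \<le> N \<Longrightarrow> N \<le> N' \<Longrightarrow> N' \<le> 2 * N \<Longrightarrow> \<bar>\<Sum>n\<in>{N..<N'}. z n\<bar> \<le> C * real N powr (1 - \<eta>0)"
    unfolding z_def by (rule dyadic_saving[OF assms]) blast
  define \<eta> where "\<eta> = min \<eta>0 (1 / 2)"
  have \<eta>: "0 < \<eta>" "\<eta> \<le> 1 / 2" "\<eta> \<le> \<eta>0" using \<eta>0 by (auto simp: \<eta>_def)
  define B where "B = 2 * real N0 + 3 * C + 4"
  have S: "\<bar>\<Sum>n<N. z n\<bar> \<le> B * real N powr (1 - \<eta>)" if "1 \<le> N" for N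
    unfolding B_def
  proof (rule dyadic_summation[OF _ C \<eta>(2) N0 _ that])
    show "\<bar>z n\<bar> \<le> 1" for n by (simp add: z_def)
    fix M assume M: "N0 \<le> M"
    have "\<bar>\<Sum>n\<in>{M..<2 * M}. z n\<bar> \<le> C * real M powr (1 - \<eta>0)" by (rule dy[OF M]) auto
    also have "\<dots> \<le> C * real M powr (1 - \<eta>)"
      using \<eta>(3) C M N0 by (intro mult_left_mono powr_mono) auto
    finally show "\<bar>\<Sum>n\<in>{M..<2 * M}. z n\<bar> \<le> C * real M powr (1 - \<eta>)" .
  qed
  have za: "z n = 2 * (if a n = 0 then 1 else 0) - 1" for n
    by (auto simp: z_def a_def tm_def thue_morse_def even_iff_mod_2_eq_zero[symmetric] simp del: even_iff_mod_2_eq_zero)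
  have cnt: "(\<Sum>n<N. z n) = 2 * real (card {n. n < N \<and> a n = 0}) - real N" for N
  proof -
    have "{n. n < N \<and> a n = 0} = {..<N} \<inter> {n. a n = 0}" by auto
    then have "(\<Sum>n<N. if a n = 0 then 1 else 0 :: real) = real (card {n. n < N \<and> a n = 0})"
      by (simp add: sum.If_cases)
    then show ?thesis unfolding za by (simp add: sum_subtractf flip: sum_distrib_left)
  qed
  have bound: "\<bar>1 / real N * real (card {n. n < N \<and> a n = 0}) - 1 / 2\<bar> \<le> B / 2 * real N powr (- \<eta>)" if N: "1 \<le> N" for N
  proof -
    have N': "0 < real N" using N by simp
    have "1 / real N * real (card {n. n < N \<and> a n = 0}) - 1 / 2 = (\<Sum>n<N. z n) / (2 * real N)"
      unfolding cnt using N' by (simp add: field_simps)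
    also have "\<bar>\<dots>\<bar> = \<bar>\<Sum>n<N. z n\<bar> / (2 * real N)" by simp
    also have "\<dots> \<le> B * real N powr (1 - \<eta>) / (2 * real N)"
      using S[OF N] N' by (intro divide_right_mono) auto
    also have "real N powr (1 - \<eta>) = real N * real N powr (- \<eta>)"
      using N' powr_add[of "real N" 1 "- \<eta>"] by simp
    finally show ?thesis using N' by simp
  qed
  have lim0: "(\<lambda>N. real (card {n. n < N \<and> a n = 0}) / real N) \<longlonglongrightarrow> 1 / 2"
  proof (rule LIM_zero_cancel, rule Lim_null_comparison)
    show "\<forall>\<^sub>F N in sequentially. norm (real (card {n. n < N \<and> a n = 0}) / real N - 1 / 2) \<le> B / 2 * real N powr (- \<eta>)"
      using eventually_ge_at_top[of 1] by eventually_elim (use bound in auto)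
    have "(\<lambda>N. real N powr (- \<eta>)) \<longlonglongrightarrow> 0"
      using \<eta>(1) by (intro tendsto_neg_powr filterlim_real_sequentially) auto
    then show "(\<lambda>N. B / 2 * real N powr (- \<eta>)) \<longlonglongrightarrow> 0" by (rule tendsto_mult_right_zero)
  qed
  have lim1: "(\<lambda>N. real (card {n. n < N \<and> a n = 1}) / real N) \<longlonglongrightarrow> 1 / 2"
  proof (rule Lim_transform_eventually)
    show "(\<lambda>N. 1 - real (card {n. n < N \<and> a n = 0}) / real N) \<longlonglongrightarrow> 1 / 2"
      using tendsto_diff[OF tendsto_const lim0, of 1] by simp
    show "\<forall>\<^sub>F N in sequentially. 1 - real (card {n. n < N \<and> a n = 0}) / real N = real (card {n. n < N \<and> a n = 1}) / real N"
      using eventually_ge_at_top[of 1]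
    proof eventually_elim
      case (elim N)
      have a01: "a n = 0 \<or> a n = 1" for n by (simp add: a_def thue_morse_def)
      have "{..<N} = {n. n < N \<and> a n = 0} \<union> {n. n < N \<and> a n = 1}" using a01 by auto
      then have "card {..<N} = card ({n. n < N \<and> a n = 0} \<union> {n. n < N \<and> a n = 1})" by (rule arg_cong)
      also have "\<dots> = card {n. n < N \<and> a n = 0} + card {n. n < N \<and> a n = 1}"
        by (rule card_Un_disjoint) auto
      finally have "real N = real (card {n. n < N \<and> a n = 0}) + real (card {n. n < N \<and> a n = 1})" by simp
      then show ?case using elim by (simp add: field_simps)
    qed
  qed
  have "simply_normal a" unfolding simply_normal_def using lim0 lim1 by simp
  moreover have "\<exists>\<eta> C :: real. \<eta> > 0 \<and> (\<forall>N :: nat. N \<ge> 1 \<longrightarrow>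
      \<bar>1 / real N * real (card {n :: nat. 0 \<le> n \<and> n < N \<and> a n = 0}) - 1 / 2\<bar> \<le> C * real N powr (- \<eta>))"
    using \<eta>(1) bound by (intro exI[of _ \<eta>] exI[of _ "B / 2"]) simp
  ultimately show ?thesis unfolding a_def by simp
qed

end
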